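(* Let $n\ge1$ and let $K\subset\mathbb{R}^n$ be a centrally symmetric convex body. Then $$v(K)\ \ge\ \frac{2^n(n!)^2\pi^n}{(2n)!\,\bigl((n/2)!\bigr)^2}=\gamma_n\Bigl(\frac{\pi}{4}\Bigr)^n v(C_n),$$ where $$\gamma_n=\frac{(n!)^3\,2^n}{(2n)!\,\bigl((n/2)!\bigr)^2}$$ satisfies $\gamma_n\ge\frac{4}{\pi}$ for all $n\ge 1$ and $\gamma_n\to\sqrt2$ as $n\to\infty$.
   Context: A centrally symmetric convex body is a compact convex set $K\subset\mathbb{R}^n$ with non-empty interior and $K=-K$. Its polar body is $K^\circ=\{\vec{y}\in\mathbb{R}^n : \vec{x}\cdot\vec{y}\le1 \text{ for all } \vec{x}\in K\}$. The Mahler volume is $v(K)=(\mathrm{Vol}\, K)(\mathrm{Vol}\, K^\circ)$, with $\mathrm{Vol}$ Lebesgue measure on $\mathbb{R}^n$. $C_n=[-1,1]^n$ is the cube, for which $v(C_n)=4^n/n!$. For half-integers, $(n/2)!$ means $\Gamma(\frac n2+1)$. *)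

theory Defs
  imports "HOL-Analysis.Analysis"
begin

definition centrally_symmetric_convex_body :: "(real ^ 'n) set \<Rightarrow> bool" where
  "centrally_symmetric_convex_body K \<longleftrightarrow>
     compact K \<and> convex K \<and> interior K \<noteq> {} \<and> K = uminus ` K"

definition polar_body :: "(real ^ 'n) set \<Rightarrow> (real ^ 'n) set" where
  "polar_body K = {y. \<forall>x\<in>K. x \<bullet> y \<le> 1}"

(* measure is 0 on sets of infinite Lebesgue measure; this never matters for a centrally
   symmetric convex body, since both K and its polar body are then compact. *)
definition mahler_volume :: "(real ^ 'n) set \<Rightarrow> real" where
  "mahler_volume K = measure lebesgue K * measure lebesgue (polar_body K)"

definition cube :: "(real ^ 'n) set" where
  "cube = {x. \<forall>i. x $ i \<in> {-1..1}}"

definition half_fact :: "nat \<Rightarrow> real" where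
  "half_fact n = Gamma (real n / 2 + 1)"

definition gamma_const :: "nat \<Rightarrow> real" where
  "gamma_const n = (fact n) ^ 3 * 2 ^ n / (fact (2 * n) * (half_fact n)\<^sup>2)"

end

(*
  Let N be a smooth norm with N^2/2 having gradient p, and A the derivative of p. By convexity
  F(s,t) = (s + t, p s - p t) is a bijection of R^n x R^n with Jacobian |det (A s + A t)|; let M be the
  pullback of Lebesgue measure under F. Since |p s - p t| <= N s + N t in the dual norm, the volume product
  of the unit body is at least M {N s + N t <= 1}, which by homogeneity is (n!)^2/(2n)! times
  c = M {N s <= 1, N t <= 1}.

  To bound c from below, consider E(w), the M-integral of the entire Gaussian
  exp (i x.y/2 - eps (x.x + y.y)/2) evaluated at x = e^w s + e^-w t, y = e^w p(s) - e^-w p(t). For real w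
  this point is F(e^w s, e^-w t), and M is invariant under (s,t) -> (e^w s, e^-w t), so E(w) = E(0) is a
  Gaussian integral that does not depend on N. By analytic continuation E(i pi/4) = E(0). At w = i pi/4 the
  integrand has modulus exp (-(N s^2 + N t^2)/2) in the limit eps -> 0, with no cancellation if N is the
  Euclidean norm. Hence c is smallest for the Euclidean ball.

  A general body is approximated by the unit balls of 2k-norms of finitely many functionals.
*)
theory Submission
  imports Defs "HOL-Complex_Analysis.Complex_Analysis"
begin

section \<open>The change of variables attached to a smooth norm\<close>

text \<open>The function exp (i x.y/2) has modulus 1 on R^n x R^n, so without the eps term the
  Gaussian integral is not absolutely convergent. At w = i pi/4 it is, and only there is eps sent to
  0. On the way from 0 to i pi/4 the eps term keeps the integral convergent provided that eps is
  small compared with a constant depending on N (\<open>growth\<close>).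

  The form x.y is used because at (e^w s + e^-w t, e^w p s - e^-w p t) it equals e^(2w) (N s)^2 -
  e^(-2w) (N t)^2 plus a mixed term free of w. At e^(2w) = i both squares acquire a negative real
  coefficient in i x.y/2 and the mixed term stays a pure phase. The triangle inequality discards
  this phase, which is 0 when p is the identity. Since both norms share the same Gaussian integral,
  its value is never computed.

  Working with N^2/2 makes p homogeneous of degree 1 and its derivative homogeneous of degree 0,
  which is why M scales like Lebesgue measure in s and t separately. The price is the origin: there
  a map of degree 1 is differentiable only if it is linear, so differentiability is demanded only
  elsewhere.\<close>

locale smooth_norm =
  fixes N :: "real ^ 'n::{finite,wellorder} \<Rightarrow> real"
    and p :: "real ^ 'n::_ \<Rightarrow> real ^ 'n::_"
  assumes N_minus: "N (- x) = N x"
    and N_lower: "\<exists>c>0. \<forall>x. c * norm x \<le> N x"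
    and p_scale: "r > 0 \<Longrightarrow> p (r *\<^sub>R x) = r *\<^sub>R p x"
    and p_self: "p x \<bullet> x = (N x)\<^sup>2"
    and p_le: "p x \<bullet> y \<le> N x * N y"
    and p_mono: "x \<noteq> y \<Longrightarrow> (p x - p y) \<bullet> (x - y) > 0"
    and p_cont: "continuous_on UNIV p"
    and p_diff: "x \<noteq> 0 \<Longrightarrow> p differentiable (at x)"
begin

lemma N_nonneg: "N x \<ge> 0"
proof -
  obtain c where "c > 0" "c * norm x \<le> N x" using N_lower by blast
  then show ?thesis by (smt (verit) mult_nonneg_nonneg norm_ge_zero)
qed

lemma p_measurable [measurable]: "p \<in> borel_measurable borel"
  by (simp add: p_cont borel_measurable_continuous_onI)

lemma N_eq_sqrt: "N x = sqrt (p x \<bullet> x)"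
  using p_self N_nonneg by simp

lemma N_cont: "continuous_on UNIV N"
proof -
  have "continuous_on UNIV (\<lambda>x. sqrt (p x \<bullet> x))"
    by (intro continuous_intros p_cont)
  moreover have "N = (\<lambda>x. sqrt (p x \<bullet> x))" by (rule ext) (rule N_eq_sqrt)
  ultimately show ?thesis by simp
qed

lemma N_measurable [measurable]: "N \<in> borel_measurable borel"
  by (simp add: N_cont borel_measurable_continuous_onI)

lemma p_zero: "p 0 = 0"
proof -
  have "p 0 = 2 *\<^sub>R p 0" using p_scale[of 2 0] by simp
  then show ?thesis by (simp add: scaleR_2)
qed

lemma N_zero: "N 0 = 0"
  using N_eq_sqrt p_zero by simp

lemma N_scale: assumes "r > 0" shows "N (r *\<^sub>R x) = r * N x"
proof -
  have "(N (r *\<^sub>R x))\<^sup>2 = (r * N x)\<^sup>2"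
    using assms p_self[of "r *\<^sub>R x"] p_self[of x] p_scale[of r x]
    by (simp add: power_mult_distrib power2_eq_square mult_ac)
  then show ?thesis using assms N_nonneg by simp
qed

lemma N_triangle: "N (x + y) \<le> N x + N y"
proof (cases "N (x + y) = 0")
  case False
  then have pos: "N (x + y) > 0" using N_nonneg by (simp add: less_le)
  have "N (x+y) * N (x+y) = p (x + y) \<bullet> x + p (x + y) \<bullet> y"
    using p_self[of "x + y"] by (simp add: power2_eq_square inner_add_right)
  also have "\<dots> \<le> N (x + y) * (N x + N y)"
    using p_le[of "x+y" x] p_le[of "x+y" y] by (simp add: algebra_simps)
  finally show ?thesis using pos by simp
qed (use N_nonneg in \<open>simp add: add_nonneg_nonneg\<close>)

lemma p_bound: "\<exists>C>0. \<forall>x. norm (p x) \<le> C * norm x"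
proof -
  have "compact (p ` sphere 0 1)"
    by (intro compact_continuous_image continuous_on_subset[OF p_cont]) auto
  then have "bounded (p ` sphere 0 1)" by (rule compact_imp_bounded)
  then obtain C where C: "C > 0" "\<And>x. x \<in> sphere 0 1 \<Longrightarrow> norm (p x) \<le> C"
    unfolding bounded_pos by auto
  have "norm (p x) \<le> C * norm x" for x
  proof (cases "x = 0")
    case False
    have "p x = norm x *\<^sub>R p (x /\<^sub>R norm x)"
      using p_scale[of "norm x" "x /\<^sub>R norm x"] False by simp
    then have "norm (p x) = norm x * norm (p (x /\<^sub>R norm x))"
      by (metis abs_norm_cancel norm_scaleR)
    then show ?thesis
      using C(2)[of "x /\<^sub>R norm x"] False by (simp add: mult.commute mult_right_mono)
  qed (simp add: p_zero)
  then show ?thesis using C by blast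
qed

text \<open>Follows from \<open>p_le\<close> and N x N y \<le> (N x^2 + N y^2)/2. Convexity of N^2/2
  enters in this form, which avoids differentiating N.\<close>

lemma p_subgradient: "(N y)\<^sup>2 / 2 \<ge> (N x)\<^sup>2 / 2 + p x \<bullet> (y - x)"
proof -
  have "N x * N y \<le> ((N x)\<^sup>2 + (N y)\<^sup>2) / 2"
    using sum_squares_bound[of "N x" "N y"] by simp
  then show ?thesis using p_le[of x y] p_self[of x] by (simp add: inner_diff_right)
qed

text \<open>The value 0 at the origin, where \<open>p\<close> may fail to be differentiable, keeps
  \<open>dp\<close> total, measurable and invariant under positive scaling; the origin is a null
  set.\<close>

definition dp :: "real ^ 'n::_ \<Rightarrow> real ^ 'n::_ \<Rightarrow> real ^ 'n::_" where
  "dp x = (if x = 0 then (\<lambda>_. 0) else frechet_derivative p (at x))"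

lemma dp_deriv: "x \<noteq> 0 \<Longrightarrow> (p has_derivative dp x) (at x)"
  using p_diff by (simp add: dp_def flip: frechet_derivative_works)

text \<open>Differentiating r p(y/r) = p(y) at y = r x: the derivative of a map of degree 1 has
  degree 0.\<close>

lemma dp_scale: assumes "r > 0" shows "dp (r *\<^sub>R x) = dp x"
proof (cases "x = 0")
  case False
  have "((\<lambda>y. r *\<^sub>R p (y /\<^sub>R r)) has_derivative (\<lambda>h. r *\<^sub>R dp x (h /\<^sub>R r))) (at (r *\<^sub>R x))"
    using assms False
    by (auto intro!: derivative_eq_intros has_derivative_compose[OF _ dp_deriv, of "\<lambda>y. y /\<^sub>R r"])
  moreover have "r *\<^sub>R p (y /\<^sub>R r) = p y" for y
    using p_scale[of r "y /\<^sub>R r"] assms by simp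
  moreover have "linear (dp x)" using dp_deriv[OF False] has_derivative_linear by blast
  then have "r *\<^sub>R dp x (h /\<^sub>R r) = dp x h" for h
    using assms by (simp add: linear_scale)
  ultimately have "(p has_derivative dp x) (at (r *\<^sub>R x))" by simp
  moreover have "r *\<^sub>R x \<noteq> 0" using assms False by simp
  ultimately show ?thesis using has_derivative_unique dp_deriv by blast
qed (simp add: dp_def)

lemma dp_measurable [measurable]: "(\<lambda>x. dp x h) \<in> borel_measurable borel"
proof -
  \<comment> \<open>Difference quotients in direction \<open>h\<close> with step 1/(i+1): measurable
    in \<open>x\<close>, and convergent to \<open>dp x h\<close> at every point, the origin included
    by the case distinction.\<close>
  define f where "f = (\<lambda>i x. if x = 0 then 0 else real (Suc i) *\<^sub>R (p (x + inverse (real (Suc i)) *\<^sub>R h) - p x))"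
  have lim: "(\<lambda>i. f i x) \<longlonglongrightarrow> dp x h" for x
  proof (cases "x = 0")
    case False
    have "((\<lambda>t. p (x + t *\<^sub>R h)) has_derivative (\<lambda>t. dp x (t *\<^sub>R h))) (at 0)"
      by (rule has_derivative_compose[where g = p and f = "\<lambda>t. x + t *\<^sub>R h" and f' = "\<lambda>t. t *\<^sub>R h" and g' = "dp x"])
        (use dp_deriv[OF False] in \<open>auto intro!: derivative_eq_intros\<close>)
    moreover have "linear (dp x)" using dp_deriv[OF False] has_derivative_linear by blast
    ultimately have "((\<lambda>t. norm (p (x + t *\<^sub>R h) - p x - t *\<^sub>R dp x h) / norm t) \<longlongrightarrow> 0) (at 0)"
      by (simp add: has_derivative_at linear_scale)
    moreover have "norm (p (x + t *\<^sub>R h) - p x - t *\<^sub>R dp x h) / norm t = norm ((p (x + t *\<^sub>R h) - p x) /\<^sub>R t - dp x h)"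
      if "t \<noteq> 0" for t
    proof -
      have *: "(p (x + t *\<^sub>R h) - p x) /\<^sub>R t - dp x h = (p (x + t *\<^sub>R h) - p x - t *\<^sub>R dp x h) /\<^sub>R t"
        using that by (simp add: scaleR_right_diff_distrib)
      show ?thesis unfolding * by (simp add: divide_inverse mult.commute)
    qed
    then have "\<forall>\<^sub>F t in at 0. norm (p (x + t *\<^sub>R h) - p x - t *\<^sub>R dp x h) / norm t = norm ((p (x + t *\<^sub>R h) - p x) /\<^sub>R t - dp x h)"
      by (auto simp: eventually_at_filter)
    ultimately have "((\<lambda>t. norm ((p (x + t *\<^sub>R h) - p x) /\<^sub>R t - dp x h)) \<longlongrightarrow> 0) (at 0)"
      by (rule Lim_transform_eventually)
    then have "((\<lambda>t. (p (x + t *\<^sub>R h) - p x) /\<^sub>R t) \<longlongrightarrow> dp x h) (at 0)"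
      by (rule LIM_zero_cancel[OF tendsto_norm_zero_cancel])
    moreover have "filterlim (\<lambda>i. inverse (real (Suc i))) (at 0) sequentially"
      by (rule filterlim_atI) (use LIMSEQ_inverse_real_of_nat in auto)
    ultimately have "(\<lambda>i. (p (x + inverse (real (Suc i)) *\<^sub>R h) - p x) /\<^sub>R inverse (real (Suc i))) \<longlonglongrightarrow> dp x h"
      by (rule filterlim_compose)
    then show ?thesis using False by (simp add: f_def)
  next
    case True
    then show ?thesis by (simp add: f_def dp_def)
  qed
  have "f i \<in> borel_measurable borel" for i unfolding f_def by measurable
  then show ?thesis using lim by (rule borel_measurable_LIMSEQ_metric)
qed

text \<open>The derivative of (s, t) -> (s + t, p s - p t) has block rows (1, 1) and (A s, -A t).
  Subtracting the first block column from the second leaves the determinant of -(A s + A t), hence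
  this absolute value.\<close>

definition jac :: "(real ^ 'n::_) \<times> (real ^ 'n::_) \<Rightarrow> real" where
  "jac = (\<lambda>(s, t). \<bar>det (matrix (\<lambda>h. dp s h + dp t h))\<bar>)"

lemma jac_nonneg: "jac z \<ge> 0" by (simp add: jac_def split_beta)

lemma jac_scale: "a > 0 \<Longrightarrow> b > 0 \<Longrightarrow> jac (a *\<^sub>R s, b *\<^sub>R t) = jac (s, t)"
  by (simp add: jac_def dp_scale)

lemma dp_component_measurable [measurable]: "(\<lambda>x. dp x h $ i) \<in> borel_measurable borel"
  unfolding cart_eq_inner_axis by measurable

lemma jac_measurable [measurable]: "jac \<in> borel_measurable (borel \<Otimes>\<^sub>M borel)"
  unfolding jac_def det_def matrix_def split_beta
  by (intro borel_measurable_abs borel_measurable_sum borel_measurable_times borel_measurable_const borel_measurable_prod)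
    (simp, measurable)

text \<open>Both s -> p s and s -> - p (x - s) are strictly monotone in the sense of
  \<open>p_mono\<close>, hence so is their sum.\<close>

lemma p_diff_inj: "inj (\<lambda>s. p s - p (x - s))"
proof (rule injI, rule ccontr)
  fix u v assume eq: "p u - p (x - u) = p v - p (x - v)" and "u \<noteq> v"
  then have "(p u - p v) \<bullet> (u - v) > 0" "(p (x-v) - p (x-u)) \<bullet> (u - v) > 0"
    using p_mono[of u v] p_mono[of "x-v" "x-u"] by (auto simp: algebra_simps)
  moreover have "(p u - p v) + (p (x-v) - p (x-u)) = 0" using eq by (simp add: algebra_simps)
  ultimately show False by (metis add_pos_pos inner_add_left inner_zero_left less_irrefl)
qed

text \<open>The preimage of y minimises the convex function N(u)^2/2 + N(x - u)^2/2 - y u.\<close>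
lemma p_diff_surj: "\<exists>s. p s - p (x - s) = y"
proof -
  obtain c where c: "c > 0" "\<And>x. c * norm x \<le> N x" using N_lower by blast
  define f where "f u = (N u)\<^sup>2 / 2 + (N (x - u))\<^sup>2 / 2 - y \<bullet> u" for u
  have "continuous_on UNIV f"
    unfolding f_def
    by (intro continuous_intros N_cont continuous_on_compose2[OF N_cont]) auto
  \<comment> \<open>Outside this ball N(v)^2/2 \<ge> c^2 |v|^2/2 outweighs the linear term and
    \<open>f 0\<close>, so the minimum over the ball is global. The final 1 makes |v| \<ge> 1 there,
    which turns \<open>f 0\<close> into a bound for |v| \<open>f 0\<close>.\<close>
  define R where "R = 2 * (norm y + f 0 + 1) / c\<^sup>2 + 1"
  have f0: "f 0 \<ge> 0" by (simp add: f_def)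
  then have R1: "R \<ge> 1" using c by (simp add: R_def)
  obtain u where u: "u \<in> cball 0 R" "\<And>v. v \<in> cball 0 R \<Longrightarrow> f u \<le> f v"
    using continuous_attains_inf[of "cball 0 R" f] continuous_on_subset[OF \<open>continuous_on UNIV f\<close>] R1
    by (auto simp del: mem_cball)
  have min: "f u \<le> f v" for v
  proof (cases "norm v \<le> R")
    case False
    have nv: "norm v \<ge> 1" using R1 False by simp
    have "c\<^sup>2 / 2 * norm v \<ge> norm y + f 0"
    proof -
      have "c\<^sup>2 / 2 * R = (norm y + f 0 + 1) + c\<^sup>2 / 2" using c by (simp add: R_def field_simps)
      moreover have "c\<^sup>2 / 2 * R \<le> c\<^sup>2 / 2 * norm v" using False by (intro mult_left_mono) auto
      moreover have "c\<^sup>2 / 2 \<ge> 0" by simp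
      ultimately show ?thesis by linarith
    qed
    then have "norm v * (c\<^sup>2 / 2 * norm v) \<ge> norm v * (norm y + f 0)"
      by (intro mult_left_mono) auto
    moreover have "norm v * f 0 \<ge> f 0" using nv f0 by (simp add: mult_le_cancel_right1)
    moreover have "(N v)\<^sup>2 \<ge> (c * norm v)\<^sup>2" using c by (intro power_mono) auto
    moreover have "(c * norm v)\<^sup>2 = 2 * (norm v * (c\<^sup>2 / 2 * norm v))"
      by (simp add: power2_eq_square)
    moreover have "norm v * (norm y + f 0) = norm v * norm y + norm v * f 0"
      by (rule distrib_left)
    moreover have "y \<bullet> v \<le> norm v * norm y" using norm_cauchy_schwarz[of y v] by (simp add: mult.commute)
    moreover have "(N (x - v))\<^sup>2 / 2 \<ge> 0" by simp
    ultimately have "f v \<ge> f 0" unfolding f_def[of v] by linarith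
    then show ?thesis using u(2)[of 0] R1 by simp
  qed (use u in auto)
  \<comment> \<open>The first order condition without a derivative of \<open>f\<close>: subgradients
    are taken at the displaced point u + r v, where minimality gives the sign after division by r >
    0. Continuity of \<open>p\<close> then allows r -> 0.\<close>
  have ge: "(p u - p (x - u) - y) \<bullet> v \<ge> 0" for v
  proof -
    have *: "(p (u + r *\<^sub>R v) - p (x - u - r *\<^sub>R v) - y) \<bullet> v \<ge> 0" if "r > 0" for r
    proof -
      have "f u \<le> f (u + r *\<^sub>R v)" by (rule min)
      moreover have "(N u)\<^sup>2 / 2 \<ge> (N (u + r *\<^sub>R v))\<^sup>2 / 2 + p (u + r *\<^sub>R v) \<bullet> (- (r *\<^sub>R v))"
        using p_subgradient[of "u + r *\<^sub>R v" u] by simp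
      moreover have "(N (x - u))\<^sup>2 / 2 \<ge> (N (x - u - r *\<^sub>R v))\<^sup>2 / 2 + p (x - u - r *\<^sub>R v) \<bullet> (r *\<^sub>R v)"
        using p_subgradient[of "x - u - r *\<^sub>R v" "x - u"] by simp
      ultimately have "0 \<le> r * ((p (u + r *\<^sub>R v) - p (x - u - r *\<^sub>R v) - y) \<bullet> v)"
        by (simp add: f_def algebra_simps inner_simps)
      then show ?thesis using that by (simp add: zero_le_mult_iff)
    qed
    have "continuous_on UNIV (\<lambda>r::real. (p (u + r *\<^sub>R v) - p (x - u - r *\<^sub>R v) - y) \<bullet> v)"
      by (intro continuous_intros continuous_on_compose2[OF p_cont]) auto
    then have "((\<lambda>r. (p (u + r *\<^sub>R v) - p (x - u - r *\<^sub>R v) - y) \<bullet> v) \<longlongrightarrow> (p (u + 0 *\<^sub>R v) - p (x - u - 0 *\<^sub>R v) - y) \<bullet> v) (at_right 0)"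
      by (meson UNIV_I continuous_on tendsto_within_subset subset_UNIV)
    then have "(p (u + 0 *\<^sub>R v) - p (x - u - 0 *\<^sub>R v) - y) \<bullet> v \<ge> 0"
      by (rule tendsto_lowerbound) (auto intro: * eventually_at_right_less[THEN eventually_mono])
    then show ?thesis by simp
  qed
  have "p u - p (x - u) - y = 0"
    using ge[of "- (p u - p (x - u) - y)"] inner_gt_zero_iff[of "p u - p (x - u) - y"]
    unfolding inner_minus_right by linarith
  then show ?thesis by (intro exI[of _ u]) simp
qed

text \<open>For fixed x = s + t the second component of \<open>F\<close> is the bijection s -> p s -
  p (x - s), with derivative \<open>dp s\<close> + \<open>dp (x - s)\<close>. The change of
  variables in dimension 2n is thereby reduced to one in dimension n on each fibre; checking it on
  boxes determines the measure.\<close>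

lemma emeasure_fibre:
  assumes [measurable]: "X \<in> sets borel"
  shows "(\<integral>\<^sup>+s. ennreal (jac (s, x - s)) * indicator X (p s - p (x - s)) \<partial>lborel) = emeasure lborel X"
proof -
  define g where "g s = p s - p (x - s)" for s
  have [measurable]: "g \<in> borel_measurable borel" unfolding g_def by measurable
  have [measurable]: "(\<lambda>s. jac (s, x - s)) \<in> borel_measurable borel" by measurable
  let ?M = "distr (density lborel (\<lambda>s. ennreal (jac (s, x - s)))) lborel g"
  have "lborel = ?M"
  proof (rule lborel_eqI)
    fix l u :: "real ^ 'n::_" assume le: "\<And>b. b \<in> Basis \<Longrightarrow> l \<bullet> b \<le> u \<bullet> b"
    \<comment> \<open>The points 0 and x are where \<open>p s\<close> or \<open>p (x - s)\<close>
      may fail to be differentiable. They and their two images are null sets.\<close>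
    define S where "S = g -` box l u - {0, x}"
    have [measurable]: "g -` box l u \<in> sets borel" by (rule measurable_sets_borel[of g borel]) auto
    have S: "S \<in> sets borel" unfolding S_def by (intro sets.Diff) auto
    have "(g has_derivative (\<lambda>h. dp s h + dp (x - s) h)) (at s within S)" if "s \<in> S" for s
    proof -
      have "s \<noteq> 0" "x - s \<noteq> 0" using that by (auto simp: S_def)
      have "linear (dp (x - s))" using dp_deriv[OF \<open>x - s \<noteq> 0\<close>] has_derivative_linear by blast
      moreover have "((\<lambda>s. p s - p (x - s)) has_derivative (\<lambda>h. dp s h - dp (x - s) (- h))) (at s)"
        by (auto intro!: derivative_eq_intros dp_deriv \<open>s \<noteq> 0\<close>
            has_derivative_compose[of "\<lambda>s. x - s" uminus s UNIV p "dp (x - s)"] dp_deriv[OF \<open>x - s \<noteq> 0\<close>])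
      ultimately show ?thesis unfolding g_def
        by (simp add: linear_neg has_derivative_at_withinI)
    qed
    moreover have "inj_on g S" using p_diff_inj[of x] unfolding g_def[abs_def] by (rule inj_on_subset) auto
    moreover have gS: "g ` S = box l u - {g 0, g x}"
    proof -
      have "surj g" using p_diff_surj[of x] unfolding g_def surj_def by metis
      moreover have "inj g" using p_diff_inj[of x] unfolding g_def[abs_def] .
      ultimately show ?thesis unfolding S_def
        by (simp add: image_set_diff)
    qed
    moreover have "g ` S \<in> lmeasurable \<and> measure lebesgue (g ` S) = measure lebesgue (box l u)"
      unfolding gS
      by (simp add: measure_Diff_null_set negligible_finite fmeasurable_Diff flip: negligible_iff_null_sets)
    ultimately have "((\<lambda>s. jac (s, x - s)) has_integral measure lebesgue (box l u)) S"
      using has_measure_differentiable_image[of S g "\<lambda>s h. dp s h + dp (x - s) h" "measure lebesgue (box l u)"] S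
      by (simp add: jac_def)
    then have *: "(\<integral>\<^sup>+s. ennreal (jac (s, x - s)) * indicator S s \<partial>lborel) = measure lebesgue (box l u)"
      by (intro nn_integral_has_integral_lebesgue') (auto simp: jac_nonneg)
    have "emeasure ?M (box l u) = (\<integral>\<^sup>+s. ennreal (jac (s, x - s)) * indicator (g -` box l u) s \<partial>lborel)"
      by (subst emeasure_distr) (auto simp: emeasure_density)
    also have "\<dots> = (\<integral>\<^sup>+s. ennreal (jac (s, x - s)) * indicator S s \<partial>lborel)"
    proof (rule nn_integral_cong_AE)
      have "AE s in lborel. s \<noteq> 0 \<and> s \<noteq> x" by (auto intro: AE_lborel_singleton)
      then show "AE s in lborel. ennreal (jac (s, x - s)) * indicator (g -` box l u) s = ennreal (jac (s, x - s)) * indicator S s"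
        by eventually_elim (auto simp: S_def indicator_def)
    qed
    finally show "emeasure ?M (box l u) = (\<Prod>b\<in>Basis. (u - l) \<bullet> b)"
      using * le by simp
  qed simp
  then have "emeasure lborel X = emeasure ?M X" by simp
  also have "\<dots> = (\<integral>\<^sup>+s. ennreal (jac (s, x - s)) * indicator (g -` X) s \<partial>lborel)"
    using measurable_sets_borel[of g borel X]
    by (subst emeasure_distr) (auto simp: emeasure_density)
  finally show ?thesis by (simp add: g_def indicator_def)
qed

section \<open>The pullback of Lebesgue measure under F\<close>

definition M :: "((real ^ 'n::_) \<times> (real ^ 'n::_)) measure" where
  "M = density (lborel \<Otimes>\<^sub>M lborel) (\<lambda>z. ennreal (jac z))"

definition F :: "(real ^ 'n::_) \<times> (real ^ 'n::_) \<Rightarrow> (real ^ 'n::_) \<times> (real ^ 'n::_)" where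
  "F = (\<lambda>(s, t). (s + t, p s - p t))"

lemma space_M [simp]: "space M = UNIV" by (simp add: M_def space_pair_measure)

lemma sets_M [measurable_cong]: "sets M = sets (borel \<Otimes>\<^sub>M borel)"
  unfolding M_def by (simp cong: sets_pair_measure_cong)

lemma F_measurable [measurable]: "F \<in> borel \<Otimes>\<^sub>M borel \<rightarrow>\<^sub>M borel \<Otimes>\<^sub>M borel"
  unfolding F_def by measurable

text \<open>For fixed s the substitution t = x - s is a translation. After exchanging the integrals,
  the inner one over s is the fibre computation \<open>emeasure_fibre\<close>, and integrating the
  measures of the slices of X over x gives the measure of X.\<close>

lemma distr_M_F: "distr M (lborel \<Otimes>\<^sub>M lborel) F = lborel \<Otimes>\<^sub>M lborel"
proof (rule measure_eqI)
  fix X assume "X \<in> sets (distr M (lborel \<Otimes>\<^sub>M lborel) F)"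
  then have X[measurable]: "X \<in> sets (borel \<Otimes>\<^sub>M borel)" by (simp cong: sets_pair_measure_cong)
  have XL: "X \<in> sets (lborel \<Otimes>\<^sub>M lborel)" using X by (simp cong: sets_pair_measure_cong)
  define f where "f s t = ennreal (jac (s, t)) * indicator X (s + t, p s - p t)" for s t
  have [measurable]: "(\<lambda>(s, t). f s t) \<in> borel_measurable (borel \<Otimes>\<^sub>M borel)"
    unfolding f_def by measurable
  have "emeasure (distr M (lborel \<Otimes>\<^sub>M lborel) F) X = emeasure M (F -` X)"
    using XL by (subst emeasure_distr) auto
  also have "\<dots> = (\<integral>\<^sup>+z. ennreal (jac z) * indicator (F -` X) z \<partial>(lborel \<Otimes>\<^sub>M lborel))"
    unfolding M_def
    by (subst emeasure_density) (use measurable_sets[OF F_measurable X] in \<open>auto simp: space_pair_measure cong: sets_pair_measure_cong\<close>)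
  also have "\<dots> = (\<integral>\<^sup>+z. (case z of (s, t) \<Rightarrow> f s t) \<partial>(lborel \<Otimes>\<^sub>M lborel))"
    by (intro nn_integral_cong) (auto simp: f_def F_def indicator_def)
  also have "\<dots> = (\<integral>\<^sup>+s. \<integral>\<^sup>+t. f s t \<partial>lborel \<partial>lborel)"
    by (subst lborel.nn_integral_fst[symmetric]) auto
  also have "\<dots> = (\<integral>\<^sup>+s. \<integral>\<^sup>+x. f s (x - s) \<partial>lborel \<partial>lborel)"
  proof (rule nn_integral_cong)
    fix s :: "real ^ 'n::_"
    have "(\<integral>\<^sup>+t. f s t \<partial>lborel) = (\<integral>\<^sup>+t. f s t \<partial>(distr lborel borel ((+) (-s))))"
      by (simp only: lborel_distr_plus)
    also have "\<dots> = (\<integral>\<^sup>+x. f s (x - s) \<partial>lborel)"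
      by (subst nn_integral_distr) auto
    finally show "(\<integral>\<^sup>+t. f s t \<partial>lborel) = (\<integral>\<^sup>+x. f s (x - s) \<partial>lborel)" .
  qed
  also have "\<dots> = (\<integral>\<^sup>+x. \<integral>\<^sup>+s. f s (x - s) \<partial>lborel \<partial>lborel)"
    by (rule lborel_pair.Fubini') measurable
  also have "\<dots> = (\<integral>\<^sup>+x. emeasure lborel (Pair x -` X) \<partial>lborel)"
  proof (rule nn_integral_cong)
    fix x :: "real ^ 'n::_"
    have "(\<integral>\<^sup>+s. f s (x - s) \<partial>lborel) = (\<integral>\<^sup>+s. ennreal (jac (s, x - s)) * indicator (Pair x -` X) (p s - p (x - s)) \<partial>lborel)"
      by (intro nn_integral_cong) (auto simp: f_def indicator_def)
    also have "\<dots> = emeasure lborel (Pair x -` X)"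
      by (intro emeasure_fibre sets_Pair1[OF X])
    finally show "(\<integral>\<^sup>+s. f s (x - s) \<partial>lborel) = emeasure lborel (Pair x -` X)" .
  qed
  also have "\<dots> = emeasure (lborel \<Otimes>\<^sub>M lborel) X"
    using XL by (rule lborel.emeasure_pair_measure_alt[symmetric])
  finally show "emeasure (distr M (lborel \<Otimes>\<^sub>M lborel) F) X = emeasure (lborel \<Otimes>\<^sub>M lborel) X" .
qed simp

end

section \<open>Homogeneity and the volume product\<close>

lemma nn_integral_lborel_scale:
  fixes f :: "'a::euclidean_space \<Rightarrow> ennreal"
  assumes [measurable]: "f \<in> borel_measurable borel" and "a > 0"
  shows "(\<integral>\<^sup>+x. f x \<partial>lborel) = ennreal (a ^ DIM('a)) * (\<integral>\<^sup>+x. f (a *\<^sub>R x) \<partial>lborel)"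
proof -
  have "(\<integral>\<^sup>+x. f x \<partial>lborel) = (\<integral>\<^sup>+x. f x \<partial>density (distr lborel borel (\<lambda>x. 0 + a *\<^sub>R x)) (\<lambda>_. \<bar>a\<bar>^DIM('a)))"
    using assms(2) lborel_affine[of a "0::'a"] by simp
  also have "\<dots> = ennreal (a ^ DIM('a)) * (\<integral>\<^sup>+x. f (a *\<^sub>R x) \<partial>lborel)"
    using assms(2) by (simp add: nn_integral_density nn_integral_distr nn_integral_cmult)
  finally show ?thesis .
qed

text \<open>The distribution of N under Lebesgue measure on n-space, up to a constant.\<close>
definition radial :: "nat \<Rightarrow> real measure" where
  "radial n = density lborel (\<lambda>a. ennreal (if a \<le> 0 then 0 else real n * a ^ (n - 1)))"

lemma space_radial [simp]: "space (radial n) = UNIV" by (simp add: radial_def)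

lemma sets_radial [simp, measurable_cong]: "sets (radial n) = sets borel" by (simp add: radial_def)

lemma nn_integral_radial:
  assumes [measurable]: "f \<in> borel_measurable borel"
  shows "(\<integral>\<^sup>+a. f a \<partial>radial n) = (\<integral>\<^sup>+a. ennreal (real n * a ^ (n - 1)) * f a * indicator {0<..} a \<partial>lborel)"
  unfolding radial_def by (subst nn_integral_density) (auto intro!: nn_integral_cong simp: indicator_def)

lemma emeasure_radial_atMost:
  assumes "n \<ge> 1"
  shows "emeasure (radial n) {..b} = (if b \<le> 0 then 0 else ennreal (b ^ n))"
proof -
  have "emeasure (radial n) {..b} = (\<integral>\<^sup>+a. indicator {..b} a \<partial>radial n)"
    by (simp add: nn_integral_indicator)
  also have "\<dots> = (\<integral>\<^sup>+a. ennreal (real n * a ^ (n - 1)) * indicator {0<..b} a \<partial>lborel)"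
    by (subst nn_integral_radial) (auto intro!: nn_integral_cong simp: indicator_def)
  also have "\<dots> = (if b \<le> 0 then 0 else ennreal (b ^ n))"
  proof (cases "b \<le> 0")
    case False
    have "(\<integral>\<^sup>+a. ennreal (real n * a ^ (n - 1)) * indicator {0<..b} a \<partial>lborel)
        = (\<integral>\<^sup>+a. ennreal (real n * a ^ (n - 1)) * indicator {0..b} a \<partial>lborel)"
    proof (rule nn_integral_cong_AE)
      have "AE a in lborel. a \<noteq> (0::real)" by (rule AE_lborel_singleton)
      then show "AE a in lborel. ennreal (real n * a ^ (n - 1)) * indicator {0<..b} a = ennreal (real n * a ^ (n - 1)) * indicator {0..b} a"
        by eventually_elim (auto simp: indicator_def)
    qed
    also have "\<dots> = ennreal (b ^ n - 0 ^ n)"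
      using False by (intro nn_integral_FTC_Icc) (auto intro!: derivative_eq_intros)
    finally show ?thesis using False assms by simp
  qed simp
  finally show ?thesis .
qed

lemma sigma_finite_radial: assumes "n \<ge> 1" shows "sigma_finite_measure (radial n)"
proof
  show "\<exists>A. countable A \<and> A \<subseteq> sets (radial n) \<and> \<Union> A = space (radial n) \<and> (\<forall>a\<in>A. emeasure (radial n) a \<noteq> \<infinity>)"
  proof (intro exI conjI)
    show "countable (range (\<lambda>k. {..real k}))" by simp
    show "\<Union> (range (\<lambda>k. {..real k})) = space (radial n)"
      by (auto intro: real_arch_simple)
    show "\<forall>a\<in>range (\<lambda>k. {..real k}). emeasure (radial n) a \<noteq> \<infinity>"
      using assms by (auto simp: emeasure_radial_atMost)
  qed auto
qed

text \<open>Source of the factor (n!)^2/(2n)!: slicing at a leaves the integral of n a^(n-1) (1 -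
  a)^n over [0,1], which is n B(n, n+1).\<close>

lemma radial_simplex:
  assumes "n \<ge> 1"
  shows "emeasure (radial n \<Otimes>\<^sub>M radial n) {(a, b). a + b \<le> 1} = ennreal ((fact n)\<^sup>2 / fact (2 * n))"
proof -
  interpret R: sigma_finite_measure "radial n" using assms by (rule sigma_finite_radial)
  have meas: "{(a, b). a + b \<le> (1::real)} \<in> sets (borel \<Otimes>\<^sub>M borel)"
  proof -
    have "{z \<in> space (borel \<Otimes>\<^sub>M borel). fst z + snd z \<le> (1::real)} \<in> sets (borel \<Otimes>\<^sub>M borel)" by measurable
    then show ?thesis by (simp add: space_pair_measure case_prod_beta')
  qed
  have "emeasure (radial n \<Otimes>\<^sub>M radial n) {(a, b). a + b \<le> 1} = (\<integral>\<^sup>+a. emeasure (radial n) (Pair a -` {(a, b). a + b \<le> 1}) \<partial>radial n)"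
    using meas by (intro R.emeasure_pair_measure_alt) (simp cong: sets_pair_measure_cong)
  also have "\<dots> = (\<integral>\<^sup>+a. emeasure (radial n) {..1 - a} \<partial>radial n)"
    by (intro nn_integral_cong arg_cong2[where f = emeasure]) auto
  also have "\<dots> = (\<integral>\<^sup>+a. (if 1 \<le> a then 0 else ennreal ((1 - a) ^ n)) \<partial>radial n)"
    using assms by (simp add: emeasure_radial_atMost)
  also have "\<dots> = (\<integral>\<^sup>+a. ennreal (real n * a ^ (n - 1)) * (if 1 \<le> a then 0 else ennreal ((1 - a) ^ n)) * indicator {0<..} a \<partial>lborel)"
    by (subst nn_integral_radial) auto
  also have "\<dots> = (\<integral>\<^sup>+a. ennreal (real n * (a powr (real n - 1) * (1 - a) powr (real (Suc n) - 1))) * indicator {0<..<1} a \<partial>lborel)"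
  proof (intro nn_integral_cong)
    fix a :: real
    have "a powr (real n - 1) = a ^ (n - 1)" if "a > 0"
      using that assms by (simp add: of_nat_diff flip: powr_realpow)
    moreover have "(1 - a) powr (real (Suc n) - 1) = (1 - a) ^ n" if "a < 1"
      using that powr_realpow[of "1 - a" n] by simp
    ultimately show "ennreal (real n * a ^ (n - 1)) * (if 1 \<le> a then 0 else ennreal ((1 - a) ^ n)) * indicator {0<..} a
        = ennreal (real n * (a powr (real n - 1) * (1 - a) powr (real (Suc n) - 1))) * indicator {0<..<1} a"
      by (auto simp: indicator_def mult.assoc simp flip: ennreal_mult')
  qed
  also have "\<dots> = ennreal (real n * Beta n (Suc n))"
  proof (intro nn_integral_has_integral_lebesgue' has_integral_mult_right)
    show "((\<lambda>t. t powr (real n - 1) * (1 - t) powr (real (Suc n) - 1)) has_integral Beta n (Suc n)) {0<..<1}"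
      using has_integral_Beta_real[of "real n" "real (Suc n)"] assms by (simp add: has_integral_Icc_iff_Ioo)
  qed auto
  also have "real n * Beta n (Suc n) = (fact n)\<^sup>2 / fact (2 * n)"
  proof -
    have "Gamma (real n + 1) = fact n" "Gamma (real (2 * n) + 1) = fact (2 * n)"
      using Gamma_fact[of n, where ?'a = real] Gamma_fact[of "2 * n", where ?'a = real] by (simp_all add: add_ac)
    moreover have "real n * Gamma (real n) = Gamma (real n + 1)"
      using assms Gamma_plus1[of "real n"] by (simp add: nonpos_Ints_def)
    ultimately show ?thesis
      by (simp add: Beta_def power2_eq_square add_ac flip: mult.assoc)
  qed
  finally show ?thesis .
qed

lemma radial_gauss_finite:
  assumes "n \<ge> 1" "\<eta> > 0"
  shows "(\<integral>\<^sup>+a. ennreal (exp (- \<eta> * a\<^sup>2)) \<partial>radial n) < \<infinity>"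
proof -
  have "(\<integral>\<^sup>+a. ennreal (exp (- \<eta> * a\<^sup>2)) \<partial>radial n)
     = (\<integral>\<^sup>+a. ennreal (real n * a ^ (n - 1)) * ennreal (exp (- \<eta> * a\<^sup>2)) * indicator {0<..} a \<partial>lborel)"
    by (subst nn_integral_radial) auto
  also have "\<dots> \<le> (\<integral>\<^sup>+a. ennreal (real n * exp (1 / (4 * \<eta>)) * (a powr (real n - 1) / exp a)) * indicator {0..} a \<partial>lborel)"
  proof (intro nn_integral_mono)
    fix a :: real
    have "a powr (real n - 1) = a ^ (n - 1)" if "a > 0"
      using that assms by (simp add: of_nat_diff flip: powr_realpow)
    moreover have "exp (- \<eta> * a\<^sup>2) \<le> exp (1 / (4 * \<eta>)) / exp a"
    proof -
      \<comment> \<open>Completing the square dominates the Gaussian by a multiple of exp (-a), so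
        that a Gamma integral suffices.\<close>
      have "0 \<le> (2 * \<eta> * a - 1)\<^sup>2 / (4 * \<eta>)" using assms by simp
      also have "\<dots> = \<eta> * a\<^sup>2 - a + 1 / (4 * \<eta>)" using assms by (simp add: power2_eq_square field_simps)
      finally show ?thesis by (simp flip: exp_diff)
    qed
    then have "real n * a ^ (n - 1) * exp (- \<eta> * a\<^sup>2) \<le> real n * a ^ (n - 1) * (exp (1 / (4 * \<eta>)) / exp a)" if "a > 0"
      using that by (intro mult_left_mono) auto
    ultimately show "ennreal (real n * a ^ (n - 1)) * ennreal (exp (- \<eta> * a\<^sup>2)) * indicator {0<..} a \<le>
      ennreal (real n * exp (1 / (4 * \<eta>)) * (a powr (real n - 1) / exp a)) * indicator {0..} a"
      by (auto simp: indicator_def mult_ac simp flip: ennreal_mult'' intro!: ennreal_leI)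
  qed
  also have "\<dots> = ennreal (real n * exp (1 / (4 * \<eta>)) * Gamma n)"
    using assms Gamma_integral_real[of "real n"]
    by (intro nn_integral_has_integral_lebesgue' has_integral_mult_right) auto
  also have "\<dots> < \<infinity>" by simp
  finally show ?thesis .
qed

section \<open>Scaling of M and the joint distribution of N s and N t\<close>

context smooth_norm
begin

lemma nn_integral_M:
  assumes [measurable]: "f \<in> borel_measurable (borel \<Otimes>\<^sub>M borel)"
  shows "(\<integral>\<^sup>+z. f z \<partial>M) = (\<integral>\<^sup>+s. \<integral>\<^sup>+t. ennreal (jac (s, t)) * f (s, t) \<partial>lborel \<partial>lborel)"
proof -
  have "(\<integral>\<^sup>+z. f z \<partial>M) = (\<integral>\<^sup>+z. ennreal (jac z) * f z \<partial>(lborel \<Otimes>\<^sub>M lborel))"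
    unfolding M_def by (intro nn_integral_density) (auto cong: measurable_cong_sets sets_pair_measure_cong)
  then show ?thesis by (simp add: lborel.nn_integral_fst[symmetric])
qed

text \<open>\<open>jac\<close> has degree 0 in each argument, so s and t may be scaled
  independently. Unequal factors matter twice: for the product form of the distribution of (N s, N
  t), and for the invariance of \<open>M\<close> under (s, t) -> (e^r s, e^-r t).\<close>

lemma nn_integral_M_scale:
  assumes [measurable]: "f \<in> borel_measurable (borel \<Otimes>\<^sub>M borel)" and "a > 0" "b > 0"
  shows "(\<integral>\<^sup>+z. f z \<partial>M) = ennreal (a ^ CARD('n) * b ^ CARD('n)) * (\<integral>\<^sup>+z. f (a *\<^sub>R fst z, b *\<^sub>R snd z) \<partial>M)"
proof -
  have "(\<integral>\<^sup>+z. f z \<partial>M) = (\<integral>\<^sup>+s. \<integral>\<^sup>+t. ennreal (jac (s, t)) * f (s, t) \<partial>lborel \<partial>lborel)"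
    by (rule nn_integral_M) measurable
  also have "\<dots> = ennreal (a ^ CARD('n)) * (\<integral>\<^sup>+s. \<integral>\<^sup>+t. ennreal (jac (a *\<^sub>R s, t)) * f (a *\<^sub>R s, t) \<partial>lborel \<partial>lborel)"
    using assms(2) by (subst nn_integral_lborel_scale[of _ a]) auto
  also have "(\<integral>\<^sup>+s. \<integral>\<^sup>+t. ennreal (jac (a *\<^sub>R s, t)) * f (a *\<^sub>R s, t) \<partial>lborel \<partial>lborel)
     = (\<integral>\<^sup>+s. ennreal (b ^ CARD('n)) * (\<integral>\<^sup>+t. ennreal (jac (s, t)) * f (a *\<^sub>R s, b *\<^sub>R t) \<partial>lborel) \<partial>lborel)"
  proof (intro nn_integral_cong)
    fix s
    show "(\<integral>\<^sup>+t. ennreal (jac (a *\<^sub>R s, t)) * f (a *\<^sub>R s, t) \<partial>lborel)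
      = ennreal (b ^ CARD('n)) * (\<integral>\<^sup>+t. ennreal (jac (s, t)) * f (a *\<^sub>R s, b *\<^sub>R t) \<partial>lborel)"
      using assms(2,3) by (subst nn_integral_lborel_scale[of _ b]) (auto simp: jac_scale)
  qed
  also have "\<dots> = ennreal (b ^ CARD('n)) * (\<integral>\<^sup>+z. f (a *\<^sub>R fst z, b *\<^sub>R snd z) \<partial>M)"
    by (subst nn_integral_M) (auto intro: nn_integral_cmult)
  finally show ?thesis using assms(2) by (simp add: ennreal_mult' mult.assoc)
qed

definition polyball :: "((real ^ 'n::_) \<times> (real ^ 'n::_)) set" where
  "polyball = {(s, t). N s \<le> 1 \<and> N t \<le> 1}"

text \<open>No bound on \<open>jac\<close> is at hand, as \<open>p\<close> is merely differentiable
  off the origin. Finiteness is read off on the other side of \<open>F\<close>, which maps bounded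
  sets to bounded sets because \<open>p\<close> grows at most linearly.\<close>

lemma emeasure_M_finite:
  assumes "X \<in> sets (borel \<Otimes>\<^sub>M borel)" "\<And>s t. (s, t) \<in> X \<Longrightarrow> norm s \<le> R \<and> norm t \<le> R"
  shows "emeasure M X < \<infinity>"
proof -
  obtain C where C: "C > 0" "\<And>x. norm (p x) \<le> C * norm x" using p_bound by blast
  let ?B = "cball 0 (2 * R) \<times> cball 0 (2 * C * R) :: ((real ^ 'n::_) \<times> (real ^ 'n::_)) set"
  have "X \<subseteq> F -` ?B"
  proof
    fix z assume "z \<in> X"
    then obtain s t where z: "z = (s, t)" and b: "norm s \<le> R" "norm t \<le> R" using assms(2) by (metis surj_pair)
    have "norm (p s) \<le> C * R" "norm (p t) \<le> C * R"
      using C b by (meson mult_left_mono less_imp_le order_trans)+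
    then have "norm (p s - p t) \<le> 2 * C * R" by (intro order_trans[OF norm_triangle_ineq4]) simp
    moreover have "norm (s + t) \<le> 2 * R" using b by (intro order_trans[OF norm_triangle_ineq]) simp
    ultimately show "z \<in> F -` ?B" by (auto simp: F_def z)
  qed
  have B: "?B \<in> sets (borel \<Otimes>\<^sub>M borel)" by simp
  have "emeasure M X \<le> emeasure M (F -` ?B)"
    using measurable_sets[OF F_measurable B] \<open>X \<subseteq> _\<close>
    by (intro emeasure_mono) (auto simp: sets_M space_pair_measure)
  also have "\<dots> = emeasure (distr M (lborel \<Otimes>\<^sub>M lborel) F) ?B"
    by (subst emeasure_distr) (auto cong: measurable_cong_sets sets_pair_measure_cong)
  also have "\<dots> = emeasure lborel (cball 0 (2 * R) :: (real ^ 'n::_) set) * emeasure lborel (cball 0 (2 * C * R) :: (real ^ 'n::_) set)"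
    unfolding distr_M_F by (intro lborel.emeasure_pair_measure_Times) auto
  also have "\<dots> < \<infinity>"
    by (simp add: ennreal_mult_less_top emeasure_lborel_cball_finite[unfolded infinity_ennreal_def])
  finally show ?thesis .
qed

lemma polyball_measurable [measurable]: "polyball \<in> sets (borel \<Otimes>\<^sub>M borel)"
  unfolding polyball_def by (measurable; simp)

lemma emeasure_polyball: "emeasure M polyball < \<infinity>"
proof -
  obtain c where c: "c > 0" "\<And>x. c * norm x \<le> N x" using N_lower by blast
  show ?thesis
  proof (rule emeasure_M_finite)
    fix s t assume "(s, t) \<in> polyball"
    then show "norm s \<le> 1 / c \<and> norm t \<le> 1 / c"
      using c(2)[of s] c(2)[of t] c(1) by (auto simp: polyball_def field_simps)
  qed measurable
qed

lemma N_null: "N x \<le> 0 \<longleftrightarrow> x = 0"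
proof -
  obtain c where c: "c > 0" "\<And>x. c * norm x \<le> N x" using N_lower by blast
  show ?thesis using c(2)[of x] c(1) by (auto simp: mult_le_0_iff N_zero dest: order_trans)
qed

lemma emeasure_M_box:
  "emeasure M {(s, t). N s \<le> a \<and> N t \<le> b} = emeasure M polyball * (emeasure (radial CARD('n)) {..a} * emeasure (radial CARD('n)) {..b})"
proof (cases "a \<le> 0 \<or> b \<le> 0")
  case False
  then have ab: "a > 0" "b > 0" by auto
  have m: "{(s, t). N s \<le> a \<and> N t \<le> b} \<in> sets (borel \<Otimes>\<^sub>M borel)" by (measurable; simp)
  have "emeasure M {(s, t). N s \<le> a \<and> N t \<le> b} = (\<integral>\<^sup>+z. indicator {(s, t). N s \<le> a \<and> N t \<le> b} z \<partial>M)"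
    using m by (simp add: sets_M)
  also have "\<dots> = ennreal (a ^ CARD('n) * b ^ CARD('n)) * (\<integral>\<^sup>+z. indicator {(s, t). N s \<le> a \<and> N t \<le> b} (a *\<^sub>R fst z, b *\<^sub>R snd z) \<partial>M)"
    using ab m by (intro nn_integral_M_scale) auto
  also have "(\<integral>\<^sup>+z. indicator {(s, t). N s \<le> a \<and> N t \<le> b} (a *\<^sub>R fst z, b *\<^sub>R snd z) \<partial>M) = (\<integral>\<^sup>+z. indicator polyball z \<partial>M)"
    using ab by (intro nn_integral_cong) (auto simp: polyball_def indicator_def N_scale)
  also have "\<dots> = emeasure M polyball" by (simp add: sets_M)
  finally show ?thesis using ab by (simp add: emeasure_radial_atMost ennreal_mult' mult_ac)
next
  case True
  have m: "{(s, t). N s \<le> a \<and> N t \<le> b} \<in> sets (borel \<Otimes>\<^sub>M borel)" by (measurable; simp)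
  have "emeasure M {(s, t). N s \<le> a \<and> N t \<le> b} = (\<integral>\<^sup>+z. indicator {(s, t). N s \<le> a \<and> N t \<le> b} z \<partial>M)"
    using m by (simp add: sets_M)
  also have "\<dots> = (\<integral>\<^sup>+s. \<integral>\<^sup>+t. ennreal (jac (s, t)) * indicator {(s, t). N s \<le> a \<and> N t \<le> b} (s, t) \<partial>lborel \<partial>lborel)"
    using m by (intro nn_integral_M) auto
  \<comment> \<open>With a nonpositive bound the set forces s = 0 or t = 0, so it is negligible;
    this matches the radial measures, which give no mass to the nonpositive half-line.\<close>
  also have "\<dots> = (\<integral>\<^sup>+s. 0 \<partial>(lborel :: (real^'n::_) measure))"
  proof (rule nn_integral_cong_AE)
    have "AE s in lborel. s \<noteq> (0::real^'n::_)" by (rule AE_lborel_singleton)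
    then show "AE s in lborel. (\<integral>\<^sup>+t. ennreal (jac (s, t)) * indicator {(s, t). N s \<le> a \<and> N t \<le> b} (s, t) \<partial>lborel) = 0"
    proof eventually_elim
      fix s :: "real ^ 'n::_" assume "s \<noteq> 0"
      have "AE t in lborel. t \<noteq> (0::real^'n::_)" by (rule AE_lborel_singleton)
      moreover have "t \<noteq> 0 \<Longrightarrow> (s, t) \<notin> {(s, t). N s \<le> a \<and> N t \<le> b}" for t
        using True \<open>s \<noteq> 0\<close> N_null[of s] N_null[of t] by auto
      moreover have "(\<lambda>t. ennreal (jac (s, t)) * indicator {(s, t). N s \<le> a \<and> N t \<le> b} (s, t)) \<in> borel_measurable lborel"
        using m by measurable
      ultimately show "(\<integral>\<^sup>+t. ennreal (jac (s, t)) * indicator {(s, t). N s \<le> a \<and> N t \<le> b} (s, t) \<partial>lborel) = 0"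
        by (subst nn_integral_0_iff_AE) (auto elim!: eventually_mono)
    qed
  qed
  finally show ?thesis using True by (auto simp: emeasure_radial_atMost)
qed

text \<open>Integrals over \<open>M\<close> of functions of (N s, N t) therefore depend on N only
  through the constant \<open>emeasure M polyball\<close>. Both sides agree on quadrants by
  \<open>emeasure_M_box\<close>, and these generate the Borel sets of the plane.\<close>

lemma distr_M_N:
  "distr M (borel \<Otimes>\<^sub>M borel) (\<lambda>z. (N (fst z), N (snd z))) =
   scale_measure (emeasure M polyball) (radial CARD('n) \<Otimes>\<^sub>M radial CARD('n))"
proof -
  let ?R = "radial CARD('n)"
  interpret R: sigma_finite_measure ?R by (rule sigma_finite_radial) (simp add: Suc_le_eq)
  let ?E = "{A \<times> B |A B. A \<in> range (\<lambda>a::real. {..a}) \<and> B \<in> range (\<lambda>a::real. {..a})}"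
  have gen: "sets (borel :: real measure) = sigma_sets (space borel) (range (\<lambda>a. {..a}))"
    by (subst borel_eq_atMost) (auto simp: sets_measure_of)
  have cov: "\<Union> (range (\<lambda>k. {..real k})) = space borel" by (auto intro: real_arch_simple)
  have sets: "sets (borel \<Otimes>\<^sub>M borel :: (real \<times> real) measure) = sigma_sets UNIV ?E"
    by (subst sets_pair_eq[OF _ gen _ _ cov _ gen _ _ cov])
      (auto simp: sets_measure_of)
  show ?thesis
  proof (rule measure_eqI_generator_eq[where E = ?E and \<Omega> = UNIV and A = "\<lambda>k. {..real k} \<times> {..real k}"])
    show "Int_stable ?E"
    proof (intro Int_stableI)
      fix X Y assume "X \<in> ?E" "Y \<in> ?E"
      then obtain a b c d :: real where "X = {..a} \<times> {..b}" "Y = {..c} \<times> {..d}" by auto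
      then have "X \<inter> Y = {..min a c} \<times> {..min b d}" by auto
      then show "X \<inter> Y \<in> ?E" by auto
    qed
    fix X assume "X \<in> ?E"
    then obtain a b :: real where X: "X = {..a} \<times> {..b}" by auto
    have "emeasure (distr M (borel \<Otimes>\<^sub>M borel) (\<lambda>z. (N (fst z), N (snd z)))) X = emeasure M {(s, t). N s \<le> a \<and> N t \<le> b}"
      unfolding X by (subst emeasure_distr) (auto intro!: arg_cong2[where f = emeasure])
    also have "\<dots> = emeasure (scale_measure (emeasure M polyball) (?R \<Otimes>\<^sub>M ?R)) X"
      unfolding X emeasure_M_box by (simp add: R.emeasure_pair_measure_Times)
    finally show "emeasure (distr M (borel \<Otimes>\<^sub>M borel) (\<lambda>z. (N (fst z), N (snd z)))) X =
      emeasure (scale_measure (emeasure M polyball) (?R \<Otimes>\<^sub>M ?R)) X" .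
  next
    fix k
    have "emeasure M {(s, t). N s \<le> real k \<and> N t \<le> real k} \<noteq> \<infinity>"
      unfolding emeasure_M_box using emeasure_polyball
      by (auto simp: emeasure_radial_atMost ennreal_mult_eq_top_iff Suc_le_eq)
    moreover have "(\<lambda>z. (N (fst z), N (snd z))) -` ({..real k} \<times> {..real k}) = {(s, t). N s \<le> real k \<and> N t \<le> real k}"
      by auto
    ultimately show "emeasure (distr M (borel \<Otimes>\<^sub>M borel) (\<lambda>z. (N (fst z), N (snd z)))) ({..real k} \<times> {..real k}) \<noteq> \<infinity>"
      by (subst emeasure_distr) simp_all
  next
    show "(\<Union>k. {..real k} \<times> {..real k}) = UNIV"
    proof (intro equalityI subsetI UNIV_I)
      fix z :: "real \<times> real"
      obtain k where "max (fst z) (snd z) \<le> real k" using real_arch_simple by blast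
      then show "z \<in> (\<Union>k. {..real k} \<times> {..real k})" by (cases z) auto
    qed
  qed (auto simp: sets cong: sets_pair_measure_cong)
qed

lemma nn_integral_M_N:
  assumes [measurable]: "f \<in> borel_measurable (borel \<Otimes>\<^sub>M borel)"
  shows "(\<integral>\<^sup>+z. f (N (fst z), N (snd z)) \<partial>M) = emeasure M polyball * (\<integral>\<^sup>+r. f r \<partial>(radial CARD('n) \<Otimes>\<^sub>M radial CARD('n)))"
proof -
  have "(\<integral>\<^sup>+z. f (N (fst z), N (snd z)) \<partial>M) = (\<integral>\<^sup>+r. f r \<partial>distr M (borel \<Otimes>\<^sub>M borel) (\<lambda>z. (N (fst z), N (snd z))))"
    by (subst nn_integral_distr) auto
  then show ?thesis unfolding distr_M_N
    by (subst (asm) nn_integral_scale_measure) (auto cong: measurable_cong_sets sets_pair_measure_cong)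
qed

definition q2 :: "(real ^ 'n::_) \<times> (real ^ 'n::_) \<Rightarrow> real" where
  "q2 z = (N (fst z))\<^sup>2 + (N (snd z))\<^sup>2"

lemma q2_measurable [measurable]: "q2 \<in> borel_measurable (borel \<Otimes>\<^sub>M borel)"
  unfolding q2_def by measurable

text \<open>This transfers estimates between the Gaussian integral and the constant
  \<open>emeasure M polyball\<close>: the other factor depends on the dimension alone.\<close>

lemma nn_integral_gauss:
  "(\<integral>\<^sup>+z. ennreal (exp (- \<eta> * q2 z)) \<partial>M) = emeasure M polyball * (\<integral>\<^sup>+a. ennreal (exp (- \<eta> * a\<^sup>2)) \<partial>radial CARD('n))\<^sup>2"
proof -
  interpret R: sigma_finite_measure "radial CARD('n)" by (rule sigma_finite_radial) (simp add: Suc_le_eq)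
  have "(\<integral>\<^sup>+z. ennreal (exp (- \<eta> * q2 z)) \<partial>M) = (\<integral>\<^sup>+z. (\<lambda>r. ennreal (exp (- \<eta> * (fst r)\<^sup>2) * exp (- \<eta> * (snd r)\<^sup>2))) (N (fst z), N (snd z)) \<partial>M)"
    by (intro nn_integral_cong) (simp add: q2_def algebra_simps flip: exp_add)
  also have "\<dots> = emeasure M polyball * (\<integral>\<^sup>+r. ennreal (exp (- \<eta> * (fst r)\<^sup>2) * exp (- \<eta> * (snd r)\<^sup>2)) \<partial>(radial CARD('n) \<Otimes>\<^sub>M radial CARD('n)))"
    by (rule nn_integral_M_N) measurable
  also have "(\<integral>\<^sup>+r. ennreal (exp (- \<eta> * (fst r)\<^sup>2) * exp (- \<eta> * (snd r)\<^sup>2)) \<partial>(radial CARD('n) \<Otimes>\<^sub>M radial CARD('n)))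
    = (\<integral>\<^sup>+a. \<integral>\<^sup>+b. ennreal (exp (- \<eta> * a\<^sup>2)) * ennreal (exp (- \<eta> * b\<^sup>2)) \<partial>radial CARD('n) \<partial>radial CARD('n))"
    by (subst R.nn_integral_fst[symmetric]) (auto simp: ennreal_mult' cong: measurable_cong_sets sets_pair_measure_cong)
  also have "\<dots> = (\<integral>\<^sup>+a. ennreal (exp (- \<eta> * a\<^sup>2)) \<partial>radial CARD('n))\<^sup>2"
    by (simp add: nn_integral_cmult nn_integral_multc power2_eq_square)
  finally show ?thesis .
qed

lemma gauss_integrable: assumes "\<eta> > 0" shows "integrable M (\<lambda>z. exp (- \<eta> * q2 z))"
proof (rule integrableI_bounded)
  show "(\<integral>\<^sup>+z. ennreal (norm (exp (- \<eta> * q2 z))) \<partial>M) < \<infinity>"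
    using radial_gauss_finite[of "CARD('n)" \<eta>] assms emeasure_polyball nn_integral_gauss[of \<eta>]
    by (auto simp: ennreal_mult_less_top power2_eq_square Suc_le_eq)
qed measurable

lemma emeasure_join: "emeasure M {(s, t). N s + N t \<le> 1} = emeasure M polyball * ennreal ((fact CARD('n))\<^sup>2 / fact (2 * CARD('n)))"
proof -
  have m: "{(s, t). N s + N t \<le> 1} \<in> sets (borel \<Otimes>\<^sub>M borel)"
  proof -
    have "{z \<in> space (borel \<Otimes>\<^sub>M borel). N (fst z) + N (snd z) \<le> 1} \<in> sets (borel \<Otimes>\<^sub>M borel)" by measurable
    then show ?thesis by (simp add: space_pair_measure case_prod_beta')
  qed
  have m2: "{(a, b). a + b \<le> (1::real)} \<in> sets (borel \<Otimes>\<^sub>M borel)"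
  proof -
    have "{z \<in> space (borel \<Otimes>\<^sub>M borel). fst z + snd z \<le> (1::real)} \<in> sets (borel \<Otimes>\<^sub>M borel)" by measurable
    then show ?thesis by (simp add: space_pair_measure case_prod_beta')
  qed
  have "emeasure M {(s, t). N s + N t \<le> 1} = (\<integral>\<^sup>+z. indicator {(s, t). N s + N t \<le> 1} z \<partial>M)"
    using m by (simp add: sets_M)
  also have "\<dots> = (\<integral>\<^sup>+z. indicator {(a, b). a + b \<le> 1} (N (fst z), N (snd z)) \<partial>M)"
    by (intro nn_integral_cong) (auto simp: indicator_def)
  also have "\<dots> = emeasure M polyball * (\<integral>\<^sup>+r. indicator {(a, b). a + b \<le> 1} r \<partial>(radial CARD('n) \<Otimes>\<^sub>M radial CARD('n)))"
    using m2 by (intro nn_integral_M_N) auto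
  also have "(\<integral>\<^sup>+r. indicator {(a, b). a + b \<le> 1} r \<partial>(radial CARD('n) \<Otimes>\<^sub>M radial CARD('n))) = emeasure (radial CARD('n) \<Otimes>\<^sub>M radial CARD('n)) {(a, b). a + b \<le> 1}"
    using m2 by (intro nn_integral_indicator) (simp cong: sets_pair_measure_cong)
  finally show ?thesis by (simp add: radial_simplex Suc_le_eq)
qed

definition unit_body :: "(real ^ 'n::_) set" where "unit_body = {x. N x \<le> 1}"

text \<open>This is Kuperberg's inclusion: F maps the set N s + N t <= 1 into the product of the unit body and
  its polar body.\<close>
lemma mahler_lower:
  "emeasure M polyball * ennreal ((fact CARD('n))\<^sup>2 / fact (2 * CARD('n)))
    \<le> emeasure lborel unit_body * emeasure lborel (polar_body unit_body)"
proof -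
  have cl: "closed unit_body" unfolding unit_body_def
    by (intro closed_Collect_le N_cont continuous_intros)
  have "polar_body unit_body = (\<Inter>x\<in>unit_body. {y. x \<bullet> y \<le> 1})" by (auto simp: polar_body_def)
  also have "closed \<dots>" by (intro closed_INT ballI closed_halfspace_le)
  finally have clp: "closed (polar_body unit_body)" .
  have B: "unit_body \<times> polar_body unit_body \<in> sets (borel \<Otimes>\<^sub>M borel)" using cl clp by simp
  have "{(s, t). N s + N t \<le> 1} \<subseteq> F -` (unit_body \<times> polar_body unit_body)"
  proof clarify
    fix s t assume st: "N s + N t \<le> 1"
    have "x \<bullet> (p s - p t) \<le> 1" if "N x \<le> 1" for x
    proof -
      have "x \<bullet> (p s - p t) = p s \<bullet> x + p t \<bullet> (- x)" by (simp add: inner_diff_right inner_commute)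
      also have "\<dots> \<le> N s * N x + N t * N x" using p_le[of s x] p_le[of t "-x"] by (simp add: N_minus)
      also have "\<dots> = (N s + N t) * N x" by (simp add: algebra_simps)
      also have "\<dots> \<le> 1" using st that N_nonneg by (intro mult_le_one) auto
      finally show ?thesis .
    qed
    moreover have "N (s + t) \<le> 1" using N_triangle[of s t] st by simp
    ultimately show "(s, t) \<in> F -` (unit_body \<times> polar_body unit_body)"
      by (auto simp: F_def unit_body_def polar_body_def)
  qed
  then have "emeasure M {(s, t). N s + N t \<le> 1} \<le> emeasure M (F -` (unit_body \<times> polar_body unit_body))"
    using measurable_sets[OF F_measurable B]
    by (intro emeasure_mono) (auto simp: sets_M space_pair_measure)
  also have "\<dots> = emeasure (distr M (lborel \<Otimes>\<^sub>M lborel) F) (unit_body \<times> polar_body unit_body)"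
    using B by (subst emeasure_distr) (auto cong: measurable_cong_sets sets_pair_measure_cong)
  also have "\<dots> = emeasure lborel unit_body * emeasure lborel (polar_body unit_body)"
    unfolding distr_M_F using cl clp by (intro lborel.emeasure_pair_measure_Times) auto
  finally show ?thesis by (simp add: emeasure_join)
qed

end

section \<open>Analytic continuation of the Gaussian integral\<close>

text \<open>Differentiation under the integral sign: dominated convergence applied to difference
  quotients along an arbitrary sequence tending to \<open>w0\<close>.\<close>

lemma integral_field_differentiable:
  fixes f f' :: "complex \<Rightarrow> 'a \<Rightarrow> complex"
  assumes r: "r > 0"
    and deriv: "\<And>w z. w \<in> ball w0 r \<Longrightarrow> ((\<lambda>w. f w z) has_field_derivative f' w z) (at w)"
    and bound: "\<And>w z. w \<in> ball w0 r \<Longrightarrow> norm (f' w z) \<le> B z"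
    and B: "integrable M B"
    and meas [measurable]: "f' w0 \<in> borel_measurable M"
    and int: "\<And>w. w \<in> ball w0 r \<Longrightarrow> integrable M (f w)"
  shows "(\<lambda>w. \<integral>z. f w z \<partial>M) field_differentiable (at w0)"
proof -
  have "((\<lambda>w. \<integral>z. f w z \<partial>M) has_field_derivative (\<integral>z. f' w0 z \<partial>M)) (at w0)"
    unfolding has_field_derivative_iff
  proof (subst tendsto_at_iff_sequentially, intro allI impI)
    fix X assume X: "\<forall>i. X i \<in> UNIV - {w0}" "X \<longlonglongrightarrow> w0"
    define q where "q i z = (f (X i) z - f w0 z) / (X i - w0)" for i z
    obtain K where K: "\<And>i. i \<ge> K \<Longrightarrow> X i \<in> ball w0 r"
      using X(2) r by (metis LIMSEQ_def dist_commute mem_ball)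
    have "w0 \<in> ball w0 r" using r by simp
    have "(\<lambda>i. \<integral>z. q (i + K) z \<partial>M) \<longlonglongrightarrow> (\<integral>z. f' w0 z \<partial>M)"
    proof (rule integral_dominated_convergence[where w = B])
      show "q (i + K) \<in> borel_measurable M" for i
        using int[of "X (i + K)"] int[of w0] K[of "i + K"] \<open>w0 \<in> ball w0 r\<close>
        unfolding q_def by (intro borel_measurable_divide borel_measurable_diff) auto
      have "(\<lambda>i. q i z) \<longlonglongrightarrow> f' w0 z" for z
      proof -
        have "((\<lambda>w. (f w z - f w0 z) / (w - w0)) \<longlongrightarrow> f' w0 z) (at w0)"
          using deriv[OF \<open>w0 \<in> ball w0 r\<close>] unfolding has_field_derivative_iff .
        then have "((\<lambda>w. (f w z - f w0 z) / (w - w0)) \<circ> X) \<longlonglongrightarrow> f' w0 z"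
          using X tendsto_at_iff_sequentially[of "\<lambda>w. (f w z - f w0 z) / (w - w0)" "f' w0 z" w0 UNIV] by blast
        then show ?thesis by (simp add: q_def[abs_def] o_def)
      qed
      then have "(\<lambda>i. q (i + K) z) \<longlonglongrightarrow> f' w0 z" for z
        by (rule LIMSEQ_ignore_initial_segment)
      then show "AE z in M. (\<lambda>i. q (i + K) z) \<longlonglongrightarrow> f' w0 z" by simp
      show "AE z in M. norm (q (i + K) z) \<le> B z" for i
      proof (rule AE_I2)
        fix z
        \<comment> \<open>The mean value inequality on the convex ball: the bound on
          \<open>f'\<close> there also bounds the difference quotients.\<close>
        have "norm (f (X (i + K)) z - f w0 z) \<le> B z * norm (X (i + K) - w0)"
          using K[of "i + K"] \<open>w0 \<in> ball w0 r\<close>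
          by (intro field_differentiable_bound[of "ball w0 r" "\<lambda>w. f w z" "\<lambda>w. f' w z"])
            (auto intro: has_field_derivative_at_within[OF deriv] bound)
        then show "norm (q (i + K) z) \<le> B z"
          using X(1)[rule_format, of "i + K"] by (simp add: q_def norm_divide field_simps)
      qed
    qed (use B in auto)
    moreover have "(\<integral>z. q (i + K) z \<partial>M) = ((\<integral>z. f (X (i + K)) z \<partial>M) - (\<integral>z. f w0 z \<partial>M)) / (X (i + K) - w0)" for i
      using int[of "X (i + K)"] int[of w0] K[of "i + K"] \<open>w0 \<in> ball w0 r\<close> by (simp add: q_def)
    ultimately have "(\<lambda>i. ((\<integral>z. f (X (i + K)) z \<partial>M) - (\<integral>z. f w0 z \<partial>M)) / (X (i + K) - w0)) \<longlonglongrightarrow> (\<integral>z. f' w0 z \<partial>M)"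
      by simp
    then show "((\<lambda>w. ((\<integral>z. f w z \<partial>M) - (\<integral>z. f w0 z \<partial>M)) / (w - w0)) \<circ> X) \<longlonglongrightarrow> (\<integral>z. f' w0 z \<partial>M)"
      unfolding o_def by (rule LIMSEQ_offset)
  qed
  then show ?thesis unfolding field_differentiable_def by blast
qed

definition gauss :: "real \<Rightarrow> (real ^ 'n) \<times> (real ^ 'n) \<Rightarrow> complex" where
  "gauss \<epsilon> z = exp (Complex (- \<epsilon> * ((norm (fst z))\<^sup>2 + (norm (snd z))\<^sup>2) / 2) (fst z \<bullet> snd z / 2))"

lemma gauss_measurable [measurable]: "gauss \<epsilon> \<in> borel_measurable (borel \<Otimes>\<^sub>M borel)"
  unfolding gauss_def Complex_eq by measurable

section \<open>The Gaussian exponent at a complex parameter\<close>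

context smooth_norm
begin

text \<open>Contribution of s alone. That of t alone is the conjugate, because t enters |x|^2 +
  |y|^2 with a plus sign and x.y with a minus sign.\<close>

definition xa :: "real \<Rightarrow> real ^ 'n::_ \<Rightarrow> complex" where
  "xa \<epsilon> s = Complex (- \<epsilon> * ((norm s)\<^sup>2 + (norm (p s))\<^sup>2) / 2) ((N s)\<^sup>2 / 2)"

text \<open>The mixed terms, in which the factors e^w and e^-w cancel.\<close>

definition xk :: "real \<Rightarrow> (real ^ 'n::_) \<times> (real ^ 'n::_) \<Rightarrow> complex" where
  "xk \<epsilon> z = Complex (- \<epsilon> * (fst z \<bullet> snd z - p (fst z) \<bullet> p (snd z)))
     ((p (fst z) \<bullet> snd z - fst z \<bullet> p (snd z)) / 2)"

text \<open>The exponent of the Gaussian at (e^w s + e^-w t, e^w p s - e^-w p t), for complex w.\<close>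
definition expo :: "real \<Rightarrow> complex \<Rightarrow> (real ^ 'n::_) \<times> (real ^ 'n::_) \<Rightarrow> complex" where
  "expo \<epsilon> w z = exp (2 * w) * xa \<epsilon> (fst z) + exp (- (2 * w)) * cnj (xa \<epsilon> (snd z)) + xk \<epsilon> z"

lemma xa_measurable [measurable]: "xa \<epsilon> \<in> borel_measurable borel"
  unfolding xa_def Complex_eq by measurable

lemma cnj_measurable: "cnj \<in> borel_measurable borel"
  by (intro borel_measurable_continuous_onI continuous_intros)

lemma xk_measurable [measurable]: "xk \<epsilon> \<in> borel_measurable (borel \<Otimes>\<^sub>M borel)"
  unfolding xk_def Complex_eq by measurable

lemma expo_measurable [measurable]: "expo \<epsilon> w \<in> borel_measurable (borel \<Otimes>\<^sub>M borel)"
  using cnj_measurable unfolding expo_def by measurable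

lemma expo_real:
  "expo \<epsilon> (of_real \<rho>) (s, t) = expo \<epsilon> 0 (exp \<rho> *\<^sub>R s, exp (- \<rho>) *\<^sub>R t)"
proof -
  have sq: "(exp \<rho>)\<^sup>2 = exp (2 * \<rho>)" for \<rho> :: real by (simp add: exp_double)
  have "xa \<epsilon> (exp \<rho> *\<^sub>R s) = of_real (exp (2 * \<rho>)) * xa \<epsilon> s" for s \<rho>
    by (simp add: xa_def p_scale N_scale power_mult_distrib sq complex_eq_iff algebra_simps add_divide_distrib)
  moreover have "xk \<epsilon> (exp \<rho> *\<^sub>R s, exp (- \<rho>) *\<^sub>R t) = xk \<epsilon> (s, t)"
    by (simp add: xk_def p_scale flip: mult.assoc exp_add)
  moreover have "exp (2 * complex_of_real \<rho>) = of_real (exp (2 * \<rho>))" for \<rho>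
    by (simp flip: exp_of_real)
  moreover have "exp (- (2 * complex_of_real \<rho>)) = of_real (exp (2 * - \<rho>))"
    by (simp flip: exp_of_real)
  ultimately show ?thesis by (simp add: expo_def)
qed

lemma expo_0: "exp (expo \<epsilon> 0 z) = gauss \<epsilon> (F z)"
proof -
  obtain s t where z: "z = (s, t)" by (cases z)
  have "(s + t) \<bullet> (p s - p t) = (N s)\<^sup>2 - (N t)\<^sup>2 + p s \<bullet> t - s \<bullet> p t"
    using p_self[of s] p_self[of t] inner_commute[of "p s" s] inner_commute[of "p t" t] inner_commute[of "p s" t]
    by (simp add: inner_add_left inner_diff_right)
  moreover have "(norm (s + t))\<^sup>2 + (norm (p s - p t))\<^sup>2 =
    (norm s)\<^sup>2 + (norm (p s))\<^sup>2 + ((norm t)\<^sup>2 + (norm (p t))\<^sup>2) + 2 * (s \<bullet> t - p s \<bullet> p t)"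
    by (simp add: power2_norm_eq_inner inner_add_left inner_diff_left inner_add_right inner_diff_right inner_commute)
  ultimately have "expo \<epsilon> 0 z = Complex (- \<epsilon> * ((norm (s + t))\<^sup>2 + (norm (p s - p t))\<^sup>2) / 2) ((s + t) \<bullet> (p s - p t) / 2)"
    by (simp only: z expo_def xa_def xk_def)
      (simp add: complex_eq_iff algebra_simps add_divide_distrib diff_divide_distrib)
  then show ?thesis by (simp add: gauss_def z F_def)
qed

lemma q2_nonneg: "q2 z \<ge> 0" by (simp add: q2_def)

text \<open>Compares the eps terms of the exponent, which are measured in Euclidean norms, with N^2.
  The constant determines how small eps has to be for a given norm.\<close>

definition growth :: "real \<Rightarrow> bool" where
  "growth C \<longleftrightarrow> C > 0 \<and> (\<forall>x. (norm x)\<^sup>2 + (norm (p x))\<^sup>2 \<le> C * (N x)\<^sup>2)"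

lemma growth_exists: "\<exists>C. growth C"
proof -
  obtain c where c: "c > 0" "\<And>x. c * norm x \<le> N x" using N_lower by blast
  obtain C where C: "C > 0" "\<And>x. norm (p x) \<le> C * norm x" using p_bound by blast
  have "(norm x)\<^sup>2 + (norm (p x))\<^sup>2 \<le> ((1 + C\<^sup>2) / c\<^sup>2) * (N x)\<^sup>2" for x
  proof -
    have "(norm (p x))\<^sup>2 \<le> (C * norm x)\<^sup>2" using C by (intro power_mono) auto
    then have "(norm x)\<^sup>2 + (norm (p x))\<^sup>2 \<le> (1 + C\<^sup>2) * (norm x)\<^sup>2"
      by (simp add: power_mult_distrib distrib_right)
    also have "\<dots> = ((1 + C\<^sup>2) / c\<^sup>2) * (c * norm x)\<^sup>2"
      using c(1) by (simp add: power_mult_distrib)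
    also have "\<dots> \<le> ((1 + C\<^sup>2) / c\<^sup>2) * (N x)\<^sup>2"
      using c by (intro mult_left_mono power_mono) auto
    finally show ?thesis .
  qed
  moreover have "(1 + C\<^sup>2) / c\<^sup>2 > 0" using c by (simp add: add_pos_nonneg)
  ultimately show ?thesis unfolding growth_def by blast
qed

lemma growth_cross:
  assumes "growth C"
  shows "2 * \<bar>s \<bullet> t - p s \<bullet> p t\<bar> \<le> C * q2 (s, t)"
proof -
  have *: "2 * \<bar>x \<bullet> y\<bar> \<le> (norm x)\<^sup>2 + (norm y)\<^sup>2" for x y :: "real ^ 'n::_"
    using Cauchy_Schwarz_ineq2[of x y] sum_squares_bound[of "norm x" "norm y"] by simp
  have "2 * \<bar>s \<bullet> t - p s \<bullet> p t\<bar> \<le> (norm s)\<^sup>2 + (norm t)\<^sup>2 + ((norm (p s))\<^sup>2 + (norm (p t))\<^sup>2)"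
    by (rule order_trans[OF mult_left_mono[OF abs_triangle_ineq4]]) (use *[of s t] *[of "p s" "p t"] in \<open>simp_all\<close>)
  moreover have "(norm s)\<^sup>2 + (norm (p s))\<^sup>2 \<le> C * (N s)\<^sup>2" "(norm t)\<^sup>2 + (norm (p t))\<^sup>2 \<le> C * (N t)\<^sup>2"
    using assms by (auto simp: growth_def)
  ultimately show ?thesis by (simp add: q2_def distrib_left)
qed

lemma norm_xa_le:
  assumes "growth C" "0 \<le> \<epsilon>" "\<epsilon> \<le> 1"
  shows "norm (xa \<epsilon> s) \<le> (C + 1) * (N s)\<^sup>2"
proof -
  have "norm (xa \<epsilon> s) \<le> \<bar>Re (xa \<epsilon> s)\<bar> + \<bar>Im (xa \<epsilon> s)\<bar>" by (rule cmod_le)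
  also have "\<dots> = \<epsilon> * ((norm s)\<^sup>2 + (norm (p s))\<^sup>2) / 2 + (N s)\<^sup>2 / 2"
    using assms by (simp add: xa_def abs_mult)
  also have "\<dots> \<le> 1 * (C * (N s)\<^sup>2) + (N s)\<^sup>2"
  proof -
    have "(norm s)\<^sup>2 + (norm (p s))\<^sup>2 \<le> C * (N s)\<^sup>2" using assms by (auto simp: growth_def)
    then have "\<epsilon> * ((norm s)\<^sup>2 + (norm (p s))\<^sup>2) \<le> 1 * (C * (N s)\<^sup>2)"
      using assms by (intro mult_mono) auto
    moreover have "0 \<le> \<epsilon> * ((norm s)\<^sup>2 + (norm (p s))\<^sup>2)" "0 \<le> (N s)\<^sup>2" using assms by auto
    ultimately show ?thesis by linarith
  qed
  also have "\<dots> = (C + 1) * (N s)\<^sup>2" by (simp add: algebra_simps)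
  finally show ?thesis .
qed

text \<open>Gaussian domination with rate \<open>\<eta>\<close>. The parameters \<open>w\<close>
  admitting a positive rate form an open set on which \<open>E\<close> is holomorphic.\<close>

definition decays :: "real \<Rightarrow> real \<Rightarrow> complex \<Rightarrow> bool" where
  "decays \<epsilon> \<eta> w \<longleftrightarrow> (\<forall>z. Re (expo \<epsilon> w z) \<le> - \<eta> * q2 z)"

lemma decays_integrable:
  assumes "decays \<epsilon> \<eta> w" "\<eta> > 0"
  shows "integrable M (\<lambda>z. exp (expo \<epsilon> w z))"
  by (rule Bochner_Integration.integrable_bound[OF gauss_integrable[OF assms(2)]])
     (use assms(1) in \<open>auto simp: decays_def norm_exp_eq_Re\<close>)

lemma decays_ball:
  assumes "decays \<epsilon> \<eta> w0" "\<eta> > 0" "0 \<le> \<epsilon>" "\<epsilon> \<le> 1"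
  shows "\<exists>r>0. \<forall>w\<in>ball w0 r. decays \<epsilon> (\<eta> / 2) w"
proof -
  obtain C where C: "growth C" using growth_exists by blast
  have C0: "C > 0" using C by (simp add: growth_def)
  \<comment> \<open>If both exponential coefficients move by at most \<open>d\<close>, the exponent
    moves by at most d (C + 1) \<open>q2 z\<close>, that is, by half of the available decay. The
    mixed term does not depend on \<open>w\<close>.\<close>
  define d where "d = \<eta> / (2 * (C + 1))"
  have d: "d > 0" using assms C0 by (simp add: d_def)
  have "isCont (\<lambda>w::complex. exp (2 * w)) w0" "isCont (\<lambda>w::complex. exp (- (2 * w))) w0"
    by (intro continuous_intros)+
  then obtain r1 r2 where r: "r1 > 0" "r2 > 0"
    "\<And>w. dist w w0 < r1 \<Longrightarrow> dist (exp (2 * w)) (exp (2 * w0)) < d"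
    "\<And>w. dist w w0 < r2 \<Longrightarrow> dist (exp (- (2 * w))) (exp (- (2 * w0))) < d"
    using d unfolding continuous_at_eps_delta by (metis (no_types, lifting))
  have "decays \<epsilon> (\<eta> / 2) w" if w: "w \<in> ball w0 (min r1 r2)" for w
    unfolding decays_def
  proof
    fix z :: "(real ^ 'n::_) \<times> (real ^ 'n::_)"
    have a: "norm (exp (2 * w) - exp (2 * w0)) \<le> d" "norm (exp (- (2 * w)) - exp (- (2 * w0))) \<le> d"
      using r(3,4)[of w] w by (auto simp: dist_norm norm_minus_commute less_imp_le)
    have "expo \<epsilon> w z - expo \<epsilon> w0 z = (exp (2 * w) - exp (2 * w0)) * xa \<epsilon> (fst z) + (exp (- (2 * w)) - exp (- (2 * w0))) * cnj (xa \<epsilon> (snd z))"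
      by (simp add: expo_def algebra_simps)
    then have "norm (expo \<epsilon> w z - expo \<epsilon> w0 z) \<le> norm (exp (2 * w) - exp (2 * w0)) * norm (xa \<epsilon> (fst z)) + norm (exp (- (2 * w)) - exp (- (2 * w0))) * norm (xa \<epsilon> (snd z))"
      by (metis norm_triangle_ineq norm_mult complex_mod_cnj)
    also have "\<dots> \<le> d * ((C + 1) * (N (fst z))\<^sup>2) + d * ((C + 1) * (N (snd z))\<^sup>2)"
      using a norm_xa_le[OF C assms(3,4)] d by (intro add_mono mult_mono) auto
    also have "\<dots> = d * (C + 1) * q2 z" by (simp add: q2_def algebra_simps)
    also have "d * (C + 1) = \<eta> / 2" using C0 by (simp add: d_def field_simps)
    finally have "Re (expo \<epsilon> w z) - Re (expo \<epsilon> w0 z) \<le> \<eta> / 2 * q2 z"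
      using complex_Re_le_cmod[of "expo \<epsilon> w z - expo \<epsilon> w0 z"] by simp
    moreover have "Re (expo \<epsilon> w0 z) \<le> - \<eta> * q2 z" using assms(1) unfolding decays_def by blast
    ultimately show "Re (expo \<epsilon> w z) \<le> - (\<eta> / 2) * q2 z" by (simp add: field_simps)
  qed
  then show ?thesis using r by (intro exI[of _ "min r1 r2"]) auto
qed

section \<open>Holomorphy of the Gaussian integral and its continuation to i pi/4\<close>

definition E :: "real \<Rightarrow> complex \<Rightarrow> complex" where
  "E \<epsilon> w = (\<integral>z. exp (expo \<epsilon> w z) \<partial>M)"

lemma E_differentiable:
  assumes "decays \<epsilon> \<eta> w0" "\<eta> > 0" "0 \<le> \<epsilon>" "\<epsilon> \<le> 1"
  shows "E \<epsilon> field_differentiable (at w0)"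
proof -
  obtain r0 where r0: "r0 > 0" "\<And>w. w \<in> ball w0 r0 \<Longrightarrow> decays \<epsilon> (\<eta> / 2) w"
    using decays_ball[OF assms] by blast
  obtain C where C: "growth C" using growth_exists by blast
  have C0: "C > 0" using C by (simp add: growth_def)
  \<comment> \<open>A radius of at most 1 bounds |w| by |w0| + 1, which makes \<open>K\<close>
    uniform on the ball.\<close>
  define r where "r = min r0 1"
  have r: "r > 0" "\<And>w. w \<in> ball w0 r \<Longrightarrow> decays \<epsilon> (\<eta> / 2) w" using r0 by (auto simp: r_def)
  define f' where "f' w z = (2 * exp (2 * w) * xa \<epsilon> (fst z) - 2 * exp (- (2 * w)) * cnj (xa \<epsilon> (snd z))) * exp (expo \<epsilon> w z)" for w z
  define K where "K = 2 * exp (2 * (norm w0 + 1)) * (C + 1)"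
  define B where "B z = K * (4 / \<eta>) * exp (- (\<eta> / 4) * q2 z)" for z
  have K: "K > 0" using C0 by (simp add: K_def)
  show ?thesis unfolding E_def[abs_def]
  proof (rule integral_field_differentiable[where f' = f' and B = B])
    show "r > 0" by fact
    show "((\<lambda>w. exp (expo \<epsilon> w z)) has_field_derivative f' w z) (at w)" for w z
      unfolding expo_def f'_def by (auto intro!: derivative_eq_intros simp: algebra_simps)
    show "integrable M B" unfolding B_def using assms(2) gauss_integrable[of "\<eta> / 4"] by simp
    show "f' w0 \<in> borel_measurable M"
      using cnj_measurable unfolding f'_def by measurable
    show "integrable M (\<lambda>z. exp (expo \<epsilon> w z))" if "w \<in> ball w0 r" for w
      using decays_integrable[OF r(2)[OF that]] assms(2) by simp
    fix w and z :: "(real ^ 'n::_) \<times> (real ^ 'n::_)" assume w: "w \<in> ball w0 r"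
    have nw: "norm w \<le> norm w0 + 1"
      using w norm_triangle_sub[of w w0] by (auto simp: r_def dist_norm norm_minus_commute)
    have ex: "norm (exp (2 * w)) \<le> exp (2 * (norm w0 + 1))" "norm (exp (- (2 * w))) \<le> exp (2 * (norm w0 + 1))"
      using nw abs_Re_le_cmod[of w] by (auto simp: norm_exp_eq_Re)
    have "norm (2 * exp (2 * w) * xa \<epsilon> (fst z) - 2 * exp (- (2 * w)) * cnj (xa \<epsilon> (snd z)))
      \<le> norm (2 * exp (2 * w) * xa \<epsilon> (fst z)) + norm (2 * exp (- (2 * w)) * cnj (xa \<epsilon> (snd z)))"
      by (rule norm_triangle_ineq4)
    also have "\<dots> = 2 * norm (exp (2 * w)) * norm (xa \<epsilon> (fst z)) + 2 * norm (exp (- (2 * w))) * norm (xa \<epsilon> (snd z))"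
      by (simp add: norm_mult)
    also have "\<dots> \<le> 2 * exp (2 * (norm w0 + 1)) * ((C + 1) * (N (fst z))\<^sup>2) + 2 * exp (2 * (norm w0 + 1)) * ((C + 1) * (N (snd z))\<^sup>2)"
      using ex norm_xa_le[OF C assms(3,4)] by (intro add_mono mult_mono) auto
    also have "\<dots> = K * q2 z" by (simp add: K_def q2_def algebra_simps)
    finally have 1: "norm (2 * exp (2 * w) * xa \<epsilon> (fst z) - 2 * exp (- (2 * w)) * cnj (xa \<epsilon> (snd z))) \<le> K * q2 z" .
    have "norm (exp (expo \<epsilon> w z)) \<le> exp (- (\<eta> / 2) * q2 z)"
      using r(2)[OF w] unfolding decays_def norm_exp_eq_Re exp_le_cancel_iff by blast
    then have "norm (f' w z) \<le> K * q2 z * exp (- (\<eta> / 2) * q2 z)"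
      unfolding f'_def norm_mult using 1 K q2_nonneg[of z] by (intro mult_mono) auto
    also have "\<dots> = K * (4 / \<eta>) * (\<eta> / 4 * q2 z) * exp (- (\<eta> / 2) * q2 z)" using assms(2) by simp
    also have "\<dots> \<le> K * (4 / \<eta>) * exp (\<eta> / 4 * q2 z) * exp (- (\<eta> / 2) * q2 z)"
    proof -
      \<comment> \<open>Half of the decay rate is spent on absorbing the factor \<open>q2 z\<close>
        produced by the differentiation.\<close>
      have "\<eta> / 4 * q2 z \<le> exp (\<eta> / 4 * q2 z)"
        using exp_ge_add_one_self[of "\<eta> / 4 * q2 z"] by linarith
      then show ?thesis using K assms(2) by (intro mult_right_mono mult_left_mono) auto
    qed
    also have "\<dots> = B z" by (simp add: B_def mult.assoc flip: exp_add)
    finally show "norm (f' w z) \<le> B z" .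
  qed
qed

text \<open>\<open>F\<close> is coercive. This matters near w = 0, where the squares of N contribute
  only a phase and all decay has to come from the eps term, that is, from the squared length of
  \<open>F (s, t)\<close>.\<close>

lemma lower_quadratic: "\<exists>\<delta>>0. \<forall>s t. \<delta> * q2 (s, t) \<le> (norm (s + t))\<^sup>2 + (norm (p s - p t))\<^sup>2"
proof -
  obtain C where C: "growth C" using growth_exists by blast
  have C0: "C > 0" using C by (simp add: growth_def)
  have "1 / (4 * C) * q2 (s, t) \<le> (norm (s + t))\<^sup>2 + (norm (p s - p t))\<^sup>2" for s t
  proof -
    have gs: "(norm s)\<^sup>2 + (norm (p s))\<^sup>2 \<le> C * (N s)\<^sup>2" "(norm t)\<^sup>2 + (norm (p t))\<^sup>2 \<le> C * (N t)\<^sup>2"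
      using C by (auto simp: growth_def)
    \<comment> \<open>The weight is chosen so that the leftover terms |p s|^2/(4C) and |t|^2/(4C)
      add up to at most a quarter of \<open>q2 (s, t)\<close> and can be moved to the left.\<close>
    have young: "x \<bullet> y \<le> C * (norm x)\<^sup>2 + (norm y)\<^sup>2 / (4 * C)" for x y :: "real ^ 'n::_"
    proof -
      have "0 \<le> (norm (2 * C) * norm x - norm y)\<^sup>2 / (4 * C)" using C0 by simp
      also have "\<dots> = C * (norm x)\<^sup>2 + (norm y)\<^sup>2 / (4 * C) - norm x * norm y"
        using C0 by (simp add: power2_eq_square field_simps)
      finally show ?thesis using norm_cauchy_schwarz[of x y] by linarith
    qed
    \<comment> \<open>Both p s.s and p t.t are expressed through s + t and p s - p t; the two copies
      of p s.t cancel.\<close>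
    have "q2 (s, t) = (s + t) \<bullet> p s - (p s - p t) \<bullet> t"
      using p_self[of s] p_self[of t] inner_commute[of "p s" s] inner_commute[of "p s" t]
      by (simp add: q2_def inner_add_left inner_diff_left)
    also have "\<dots> = (s + t) \<bullet> p s + (p s - p t) \<bullet> (- t)" by simp
    also have "\<dots> \<le> (C * (norm (s + t))\<^sup>2 + (norm (p s))\<^sup>2 / (4 * C)) + (C * (norm (p s - p t))\<^sup>2 + (norm (- t))\<^sup>2 / (4 * C))"
      by (intro add_mono young)
    also have "\<dots> \<le> C * ((norm (s + t))\<^sup>2 + (norm (p s - p t))\<^sup>2) + q2 (s, t) / 4"
    proof -
      have "(norm (p s))\<^sup>2 \<le> C * (N s)\<^sup>2" "(norm t)\<^sup>2 \<le> C * (N t)\<^sup>2"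
        using gs zero_le_power2[of "norm s"] zero_le_power2[of "norm (p t)"] by linarith+
      then have "(norm (p s))\<^sup>2 / (4 * C) \<le> (N s)\<^sup>2 / 4" "(norm t)\<^sup>2 / (4 * C) \<le> (N t)\<^sup>2 / 4"
        using C0 by (simp_all add: field_simps)
      then show ?thesis by (simp add: q2_def distrib_left)
    qed
    finally have "q2 (s, t) * (3 / 4) \<le> C * ((norm (s + t))\<^sup>2 + (norm (p s - p t))\<^sup>2)" by simp
    moreover have "q2 (s, t) * (1 / 4) \<le> q2 (s, t) * (3 / 4)" using q2_nonneg by (intro mult_left_mono) auto
    ultimately have "q2 (s, t) / 4 \<le> C * ((norm (s + t))\<^sup>2 + (norm (p s - p t))\<^sup>2)" by simp
    then show ?thesis using C0 by (simp add: field_simps)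
  qed
  then show ?thesis using C0 by (intro exI[of _ "1 / (4 * C)"]) auto
qed

text \<open>Two sources of decay have to be balanced: sin(2\<theta>) times \<open>q2\<close>, absent
  at \<theta> = 0, and the squared length of \<open>F\<close> times eps/2. The rotation damages only
  the second, by (1 - cos(2\<theta>)) eps P/2, and since 1 - cos \<le> sin on the first quadrant and
  eps P \<le> \<open>q2\<close>, the first pays for it. The rate is uniform in \<theta>.\<close>

lemma decays_imaginary:
  assumes C: "growth C" and eps: "0 < \<epsilon>" "\<epsilon> * C \<le> 1"
  shows "\<exists>\<eta>>0. \<forall>\<theta>\<in>{0..pi/4}. decays \<epsilon> \<eta> (\<i> * of_real \<theta>)"
proof -
  obtain d where d: "d > 0" "\<And>s t. d * q2 (s, t) \<le> (norm (s + t))\<^sup>2 + (norm (p s - p t))\<^sup>2"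
    using lower_quadratic by blast
  have "decays \<epsilon> (\<epsilon> * d / 2) (\<i> * of_real \<theta>)" if th: "\<theta> \<in> {0..pi/4}" for \<theta>
    unfolding decays_def
  proof
    fix z :: "(real ^ 'n::_) \<times> (real ^ 'n::_)"
    obtain s t where z: "z = (s, t)" by (cases z)
    define P where "P = (norm s)\<^sup>2 + (norm (p s))\<^sup>2 + ((norm t)\<^sup>2 + (norm (p t))\<^sup>2)"
    have sc: "sin (2 * \<theta>) \<ge> 0" "cos (2 * \<theta>) \<ge> 0"
      using th by (auto intro!: sin_ge_zero cos_ge_zero)
    have sc1: "1 - cos (2 * \<theta>) \<le> sin (2 * \<theta>)"
    proof -
      have "1 \<le> (sin (2 * \<theta>) + cos (2 * \<theta>))\<^sup>2"
        using sc sin_cos_squared_add[of "2 * \<theta>"] by (simp add: power2_sum)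
      then show ?thesis using sc power2_le_imp_le[of 1 "sin (2 * \<theta>) + cos (2 * \<theta>)"] by simp
    qed
    have "(norm s)\<^sup>2 + (norm (p s))\<^sup>2 \<le> C * (N s)\<^sup>2" "(norm t)\<^sup>2 + (norm (p t))\<^sup>2 \<le> C * (N t)\<^sup>2"
      using C by (auto simp: growth_def)
    then have "P \<le> C * q2 z" by (simp add: P_def z q2_def distrib_left)
    then have "\<epsilon> * P \<le> \<epsilon> * (C * q2 z)" using eps by (intro mult_left_mono) auto
    also have "\<dots> \<le> q2 z" using mult_right_mono[OF eps(2) q2_nonneg[of z]] by (simp add: mult_ac)
    finally have P: "\<epsilon> * P \<le> q2 z" .
    have P0: "\<epsilon> * P \<ge> 0" using eps by (simp add: P_def)
    have e1: "exp (2 * (\<i> * of_real \<theta>)) = Complex (cos (2 * \<theta>)) (sin (2 * \<theta>))"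
      using cis_conv_exp[of "2 * \<theta>"] by (simp add: cis.ctr mult_ac complex_eq_iff)
    have e2: "exp (- (2 * (\<i> * of_real \<theta>))) = Complex (cos (2 * \<theta>)) (- sin (2 * \<theta>))"
      using cis_conv_exp[of "- 2 * \<theta>"] by (simp add: cis.ctr mult_ac complex_eq_iff)
    have nn: "(norm (s + t))\<^sup>2 + (norm (p s - p t))\<^sup>2 = P + 2 * (s \<bullet> t - p s \<bullet> p t)"
      by (simp add: P_def power2_norm_eq_inner inner_add_left inner_diff_left inner_add_right inner_diff_right inner_commute)
    have "Re (expo \<epsilon> (\<i> * of_real \<theta>) z) = - sin (2 * \<theta>) * q2 z / 2 - \<epsilon> / 2 * (cos (2 * \<theta>) * P + 2 * (s \<bullet> t - p s \<bullet> p t))"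
      unfolding expo_def e1 e2 by (simp add: xa_def xk_def z P_def q2_def field_simps)
    \<comment> \<open>The full square length of \<open>F (s, t)\<close> is completed by adding and
      subtracting (1 - cos(2\<theta>)) P, so that \<open>lower_quadratic\<close> applies.\<close>
    also have "\<dots> = - sin (2 * \<theta>) * q2 z / 2 - \<epsilon> / 2 * ((norm (s + t))\<^sup>2 + (norm (p s - p t))\<^sup>2) + (1 - cos (2 * \<theta>)) * (\<epsilon> * P) / 2"
      unfolding nn by (simp add: algebra_simps diff_divide_distrib add_divide_distrib)
    also have "\<dots> \<le> - sin (2 * \<theta>) * q2 z / 2 - \<epsilon> / 2 * (d * q2 z) + sin (2 * \<theta>) * q2 z / 2"
    proof -
      have "(1 - cos (2 * \<theta>)) * (\<epsilon> * P) \<le> sin (2 * \<theta>) * q2 z"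
        using sc sc1 P P0 by (intro mult_mono) auto
      moreover have "\<epsilon> / 2 * (d * q2 z) \<le> \<epsilon> / 2 * ((norm (s + t))\<^sup>2 + (norm (p s - p t))\<^sup>2)"
        using eps d(2)[of s t] by (intro mult_left_mono) (auto simp: z)
      ultimately show ?thesis by linarith
    qed
    finally show "Re (expo \<epsilon> (\<i> * of_real \<theta>) z) \<le> - (\<epsilon> * d / 2) * q2 z" by simp
  qed
  then show ?thesis using eps d(1) by (intro exI[of _ "\<epsilon> * d / 2"]) auto
qed

lemma distr_M_hyperbolic:
  "distr M (borel \<Otimes>\<^sub>M borel) (\<lambda>z. (exp \<rho> *\<^sub>R fst z, exp (- \<rho>) *\<^sub>R snd z)) = M"
proof (rule measure_eqI)
  fix X assume "X \<in> sets (distr M (borel \<Otimes>\<^sub>M borel) (\<lambda>z. (exp \<rho> *\<^sub>R fst z, exp (- \<rho>) *\<^sub>R snd z)))"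
  then have X [measurable]: "X \<in> sets (borel \<Otimes>\<^sub>M borel)" by simp
  have 1: "exp \<rho> ^ k * exp (- \<rho>) ^ k = 1" for k :: nat by (simp flip: power_mult_distrib exp_add)
  have "emeasure (distr M (borel \<Otimes>\<^sub>M borel) (\<lambda>z. (exp \<rho> *\<^sub>R fst z, exp (- \<rho>) *\<^sub>R snd z))) X
     = (\<integral>\<^sup>+z. indicator X z \<partial>distr M (borel \<Otimes>\<^sub>M borel) (\<lambda>z. (exp \<rho> *\<^sub>R fst z, exp (- \<rho>) *\<^sub>R snd z)))"
    by simp
  also have "\<dots> = (\<integral>\<^sup>+z. indicator X (exp \<rho> *\<^sub>R fst z, exp (- \<rho>) *\<^sub>R snd z) \<partial>M)"
    by (subst nn_integral_distr) auto
  also have "\<dots> = (\<integral>\<^sup>+z. indicator X z \<partial>M)"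
    by (subst nn_integral_M_scale[of "indicator X" "exp \<rho>" "exp (- \<rho>)"]) (auto simp: 1)
  also have "\<dots> = emeasure M X" by (simp add: sets_M)
  finally show "emeasure (distr M (borel \<Otimes>\<^sub>M borel) (\<lambda>z. (exp \<rho> *\<^sub>R fst z, exp (- \<rho>) *\<^sub>R snd z))) X = emeasure M X" .
qed (simp add: sets_M)

text \<open>By homogeneity of \<open>p\<close> a real parameter can be moved into the arguments
  (\<open>expo_real\<close>), and that rescaling preserves \<open>M\<close> since its factors
  e^(\<rho> n) and e^(-\<rho> n) cancel.\<close>

lemma E_real: "E \<epsilon> (of_real \<rho>) = E \<epsilon> 0"
proof -
  have "E \<epsilon> 0 = (\<integral>z. exp (expo \<epsilon> 0 z) \<partial>distr M (borel \<Otimes>\<^sub>M borel) (\<lambda>z. (exp \<rho> *\<^sub>R fst z, exp (- \<rho>) *\<^sub>R snd z)))"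
    unfolding E_def distr_M_hyperbolic ..
  also have "\<dots> = (\<integral>z. exp (expo \<epsilon> 0 (exp \<rho> *\<^sub>R fst z, exp (- \<rho>) *\<^sub>R snd z)) \<partial>M)"
    by (rule integral_distr) measurable
  also have "\<dots> = E \<epsilon> (of_real \<rho>)" unfolding E_def
    by (intro Bochner_Integration.integral_cong) (auto simp: expo_real)
  finally show ?thesis ..
qed

lemma E_0: "E \<epsilon> 0 = (\<integral>z. gauss \<epsilon> (z :: (real ^ 'n::_) \<times> (real ^ 'n::_)) \<partial>(lborel \<Otimes>\<^sub>M lborel))"
proof -
  have "(\<integral>z. gauss \<epsilon> (z :: (real ^ 'n::_) \<times> (real ^ 'n::_)) \<partial>(lborel \<Otimes>\<^sub>M lborel)) = (\<integral>z. gauss \<epsilon> (z :: (real ^ 'n::_) \<times> (real ^ 'n::_)) \<partial>distr M (lborel \<Otimes>\<^sub>M lborel) F)"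
    unfolding distr_M_F ..
  also have "\<dots> = (\<integral>z. gauss \<epsilon> (F z) \<partial>M)"
    by (rule integral_distr) (auto cong: measurable_cong_sets sets_pair_measure_cong)
  finally show ?thesis by (simp add: E_def expo_0)
qed

text \<open>The identity theorem: \<open>E\<close> is constant on a real interval around 0, hence on
  the connected domain containing the segment from 0 to i pi/4.\<close>

lemma E_rotate:
  assumes C: "growth C" and eps: "0 < \<epsilon>" "\<epsilon> \<le> 1" "\<epsilon> * C \<le> 1"
  shows "E \<epsilon> (\<i> * of_real (pi / 4)) = E \<epsilon> 0"
proof -
  obtain \<eta> where \<eta>: "\<eta> > 0" "\<And>\<theta>. \<theta> \<in> {0..pi/4} \<Longrightarrow> decays \<epsilon> \<eta> (\<i> * of_real \<theta>)"
    using decays_imaginary[OF C eps(1,3)] by blast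
  define U where "U = {w. \<exists>\<eta>>0. decays \<epsilon> \<eta> w}"
  \<comment> \<open>The shape of the domain \<open>U\<close> is left undetermined; its component of
    0 is open and connected, and it contains the segment, which is connected and lies in
    \<open>U\<close> by \<open>decays_imaginary\<close>.\<close>
  define S where "S = connected_component_set U 0"
  have "open U"
    unfolding open_contains_ball
  proof
    fix w assume "w \<in> U"
    then obtain e where "e > 0" "decays \<epsilon> e w" by (auto simp: U_def)
    then obtain r where "r > 0" "\<forall>v\<in>ball w r. decays \<epsilon> (e / 2) v" using decays_ball eps by force
    then show "\<exists>r>0. ball w r \<subseteq> U" using \<open>e > 0\<close> unfolding U_def by (intro exI[of _ r]) (auto intro!: exI[of _ "e / 2"])
  qed
  then have S: "open S" "connected S" by (auto simp: S_def intro: open_connected_component)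
  have SU: "S \<subseteq> U" by (simp add: S_def connected_component_subset)
  have seg: "(\<lambda>\<theta>. \<i> * of_real \<theta>) ` {0..pi/4} \<subseteq> S"
    unfolding S_def
  proof (rule connected_component_maximal)
    show "connected ((\<lambda>\<theta>. \<i> * complex_of_real \<theta>) ` {0..pi/4})"
      by (intro connected_continuous_image continuous_intros) auto
    show "0 \<in> (\<lambda>\<theta>. \<i> * complex_of_real \<theta>) ` {0..pi/4}" by (auto intro!: image_eqI[of _ _ 0])
    show "(\<lambda>\<theta>. \<i> * complex_of_real \<theta>) ` {0..pi/4} \<subseteq> U" using \<eta> by (auto simp: U_def)
  qed
  have "\<i> * complex_of_real 0 \<in> S" by (rule subsetD[OF seg]) (intro imageI; simp)
  then have "0 \<in> S" by simp
  have hol: "(\<lambda>w. E \<epsilon> w - E \<epsilon> 0) holomorphic_on S"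
  proof -
    have "E \<epsilon> holomorphic_on S"
      unfolding holomorphic_on_def
    proof
      fix w assume "w \<in> S"
      then obtain e where "e > 0" "decays \<epsilon> e w" using SU by (auto simp: U_def)
      then show "E \<epsilon> field_differentiable at w within S"
        using eps by (intro field_differentiable_at_within[OF E_differentiable[of \<epsilon> e]]) auto
    qed
    then show ?thesis by (intro holomorphic_on_diff holomorphic_on_const)
  qed
  obtain e where e: "e > 0" "ball 0 e \<subseteq> S" using S(1) \<open>0 \<in> S\<close> open_contains_ball by blast
  define T where "T = complex_of_real ` {-e<..<e}"
  have "E \<epsilon> (\<i> * of_real (pi / 4)) - E \<epsilon> 0 = 0"
  proof (rule analytic_continuation[OF hol S, of T 0])
    show "T \<subseteq> S" using e(2) by (force simp: T_def)
    show "0 \<in> S" by fact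
    show "0 islimpt T"
      unfolding islimpt_approachable
    proof (intro allI impI)
      fix d :: real assume "d > 0"
      then have "min d e / 2 \<in> {-e<..<e}" using e(1) by auto
      then have "complex_of_real (min d e / 2) \<in> T" unfolding T_def by (rule imageI)
      moreover have "complex_of_real (min d e / 2) \<noteq> 0" "dist (complex_of_real (min d e / 2)) 0 < d"
        using \<open>d > 0\<close> e(1) by (auto simp: norm_of_real simp del: of_real_divide)
      ultimately show "\<exists>x'\<in>T. x' \<noteq> 0 \<and> dist x' 0 < d" by blast
    qed
    show "E \<epsilon> z - E \<epsilon> 0 = 0" if "z \<in> T" for z using that E_real by (auto simp: T_def)
    show "\<i> * of_real (pi / 4) \<in> S" by (rule subsetD[OF seg]) (intro imageI; simp)
  qed
  then show ?thesis by simp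
qed

text \<open>Multiplication by i and -i exchanges the roles: the squares of N become real damping,
  while the pure eps terms become phases. Of the eps terms only the mixed one is left in the real
  part.\<close>

lemma expo_rotated:
  "expo \<epsilon> (\<i> * of_real (pi / 4)) (s, t) =
    Complex (- q2 (s, t) / 2 - \<epsilon> * (s \<bullet> t - p s \<bullet> p t))
     ((p s \<bullet> t - s \<bullet> p t) / 2 - \<epsilon> * ((norm s)\<^sup>2 + (norm (p s))\<^sup>2 - (norm t)\<^sup>2 - (norm (p t))\<^sup>2) / 2)"
proof -
  have e1: "exp (2 * (\<i> * of_real (pi / 4))) = \<i>"
    using cis_conv_exp[of "pi / 2"] by (simp add: mult_ac)
  have e2: "exp (- (2 * (\<i> * of_real (pi / 4)))) = - \<i>"
    using e1 by (simp add: exp_minus)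
  show ?thesis unfolding expo_def e1 e2
    by (simp add: xa_def xk_def q2_def complex_eq_iff algebra_simps add_divide_distrib diff_divide_distrib)
qed

text \<open>The left side does not mention the norm, and its sequence of eps is the same for all
  norms, so the limits for two norms can be equated. Only the index from which the rotation is
  available depends on N.\<close>

lemma gauss_limit:
  "(\<lambda>k. \<integral>z. gauss (1 / real (Suc k)) (z :: (real ^ 'n::_) \<times> (real ^ 'n::_)) \<partial>(lborel \<Otimes>\<^sub>M lborel))
     \<longlonglongrightarrow> (\<integral>z. exp (expo 0 (\<i> * of_real (pi / 4)) z) \<partial>M)"
proof -
  obtain C where C: "growth C" using growth_exists by blast
  have C0: "C > 0" using C by (simp add: growth_def)
  define e where "e k = 1 / real (Suc k)" for k
  \<comment> \<open>From this index on eps C \<le> 1/2. That permits the rotation, and it keeps the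
    mixed eps term below \<open>q2\<close>/4, half of the damping, which supplies the dominating
    function.\<close>
  obtain K where K: "2 * C + 1 \<le> real K" using real_arch_simple by blast
  have e: "e k > 0" "e k \<le> 1" "k \<ge> K \<Longrightarrow> e k * C \<le> 1 / 2" for k
    using K by (auto simp: e_def field_simps)
  have "(\<lambda>k. \<integral>z. exp (expo (e (k + K)) (\<i> * of_real (pi / 4)) z) \<partial>M) \<longlonglongrightarrow> (\<integral>z. exp (expo 0 (\<i> * of_real (pi / 4)) z) \<partial>M)"
  proof (rule integral_dominated_convergence[where w = "\<lambda>z. exp (- (1 / 4) * q2 z)"])
    show "integrable M (\<lambda>z. exp (- (1 / 4) * q2 z))" by (rule gauss_integrable) simp
    have e0: "(\<lambda>k. e (k + K)) \<longlonglongrightarrow> 0"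
      unfolding e_def by (rule LIMSEQ_ignore_initial_segment) (rule LIMSEQ_Suc[OF lim_1_over_n])
    have "(\<lambda>k. exp (expo (e (k + K)) (\<i> * of_real (pi / 4)) (s, t))) \<longlonglongrightarrow> exp (expo 0 (\<i> * of_real (pi / 4)) (s, t))" for s t
      unfolding expo_rotated using e0
      by (intro tendsto_exp tendsto_Complex) (auto intro!: tendsto_eq_intros)
    then show "AE z in M. (\<lambda>k. exp (expo (e (k + K)) (\<i> * of_real (pi / 4)) z)) \<longlonglongrightarrow> exp (expo 0 (\<i> * of_real (pi / 4)) z)"
      by auto
    show "AE z in M. norm (exp (expo (e (k + K)) (\<i> * of_real (pi / 4)) z)) \<le> exp (- (1 / 4) * q2 z)" for k
    proof (rule AE_I2)
      fix z :: "(real ^ 'n::_) \<times> (real ^ 'n::_)"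
    obtain s t where z: "z = (s, t)" by (cases z)
      have "- (e (k + K) * (s \<bullet> t - p s \<bullet> p t)) \<le> e (k + K) * \<bar>s \<bullet> t - p s \<bullet> p t\<bar>"
        using e(1)[of "k + K"] by (metis abs_ge_minus_self less_imp_le mult_left_mono mult_minus_right)
      also have "\<dots> \<le> e (k + K) * (C * q2 z / 2)"
        using growth_cross[OF C, of s t] e(1)[of "k + K"] by (intro mult_left_mono) (auto simp: z)
      also have "\<dots> = e (k + K) * C * (q2 z / 2)" by simp
      also have "\<dots> \<le> 1 / 2 * (q2 z / 2)" using e(3)[of "k + K"] q2_nonneg[of z] by (intro mult_right_mono) auto
      finally show "norm (exp (expo (e (k + K)) (\<i> * of_real (pi / 4)) z)) \<le> exp (- (1 / 4) * q2 z)"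
        unfolding z expo_rotated norm_exp_eq_Re by simp
    qed
  qed measurable
  moreover have "(\<integral>z. exp (expo (e (k + K)) (\<i> * of_real (pi / 4)) z) \<partial>M) = (\<integral>z. gauss (e (k + K)) (z :: (real ^ 'n::_) \<times> (real ^ 'n::_)) \<partial>(lborel \<Otimes>\<^sub>M lborel))" for k
    using E_rotate[OF C e(1,2), of "k + K"] e(3)[of "k + K"] by (simp add: E_0 flip: E_def)
  ultimately have "(\<lambda>k. \<integral>z. gauss (e (k + K)) (z :: (real ^ 'n::_) \<times> (real ^ 'n::_)) \<partial>(lborel \<Otimes>\<^sub>M lborel))
     \<longlonglongrightarrow> (\<integral>z. exp (expo 0 (\<i> * of_real (pi / 4)) z) \<partial>M)" by simp
  then show ?thesis unfolding e_def[symmetric] by (rule LIMSEQ_offset)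
qed

text \<open>The triangle inequality for integrals, where the phase exp (i (p s.t - s.p t)/2) is
  dropped. This is the only loss in the comparison of norms.\<close>

lemma rotated_le:
  "ennreal (norm (\<integral>z. exp (expo 0 (\<i> * of_real (pi / 4)) z) \<partial>M))
     \<le> emeasure M polyball * (\<integral>\<^sup>+a. ennreal (exp (- (1 / 2) * a\<^sup>2)) \<partial>radial CARD('n))\<^sup>2"
proof -
  have n: "norm (exp (expo 0 (\<i> * of_real (pi / 4)) z)) = exp (- (1 / 2) * q2 z)" for z
    unfolding norm_exp_eq_Re by (cases z) (simp only: expo_rotated complex.sel, simp)
  have "norm (\<integral>z. exp (expo 0 (\<i> * of_real (pi / 4)) z) \<partial>M) \<le> (\<integral>z. exp (- (1 / 2) * q2 z) \<partial>M)"
    using integral_norm_bound[of M "\<lambda>z. exp (expo 0 (\<i> * of_real (pi / 4)) z)"] unfolding n .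
  also have "ennreal (\<integral>z. exp (- (1 / 2) * q2 z) \<partial>M) = (\<integral>\<^sup>+z. ennreal (exp (- (1 / 2) * q2 z)) \<partial>M)"
    by (rule nn_integral_eq_integral[symmetric]) (use gauss_integrable[of "1/2"] in auto)
  finally show ?thesis unfolding nn_integral_gauss by (simp add: ennreal_leI)
qed

end

section \<open>Comparison with the Euclidean ball\<close>

text \<open>Together with \<open>radial_gauss_finite\<close> this makes the one-dimensional Gaussian
  factor cancellable in \<open>ennreal\<close>.\<close>

lemma radial_gauss_pos:
  assumes "n \<ge> 1"
  shows "(\<integral>\<^sup>+a. ennreal (exp (- \<eta> * a\<^sup>2)) \<partial>radial n) > 0"
proof (rule ccontr)
  assume "\<not> ?thesis"
  then have "(\<integral>\<^sup>+a. ennreal (exp (- \<eta> * a\<^sup>2)) \<partial>radial n) = 0" by simp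
  then have "AE a in radial n. False"
    by (subst (asm) nn_integral_0_iff_AE) auto
  then have "emeasure (radial n) (space (radial n)) = 0"
    by (subst (asm) AE_iff_measurable[OF _ refl]) auto
  then have "emeasure (radial n) {..1} = 0"
    using emeasure_mono[of "{..1}" "space (radial n)" "radial n"] by simp
  then show False using emeasure_radial_atMost[OF assms, of 1] by simp
qed

lemma smooth_norm_euclidean: "smooth_norm (norm :: real ^ 'n::{finite,wellorder} \<Rightarrow> real) (\<lambda>x. x)"
proof
  show "\<exists>c>0. \<forall>x::real^'n::_. c * norm x \<le> norm x" by (intro exI[of _ 1]) auto
qed (auto simp: power2_norm_eq_inner norm_cauchy_schwarz)

text \<open>Fixing an index of type 'n only serves to fix this type for the interpretation.\<close>
context
  fixes index :: "'n::{finite,wellorder}"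
begin

interpretation euclid: smooth_norm "norm :: real ^ 'n::_ \<Rightarrow> real" "\<lambda>x. x"
  by (rule smooth_norm_euclidean)

lemma euclidean_jac:
  assumes "s \<noteq> 0" "t \<noteq> 0"
  shows "euclid.jac (s, t) = 2 ^ CARD('n)"
proof -
  have "euclid.dp x = (\<lambda>h. h)" if "x \<noteq> 0" for x
    using that by (auto simp: euclid.dp_def)
  then have "euclid.jac (s, t) = \<bar>det (matrix (\<lambda>h::real^'n::_. 2 *\<^sub>R h))\<bar>"
    using assms by (simp add: euclid.jac_def scaleR_2)
  also have "\<dots> = 2 ^ CARD('n)"
    unfolding matrix_scaleR by (subst det_diagonal) (simp_all add: mat_def)
  finally show ?thesis .
qed

lemma euclidean_polyball:
  "emeasure euclid.M euclid.polyball = ennreal (2 ^ CARD('n) * (unit_ball_vol CARD('n))\<^sup>2)"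
proof -
  have b: "emeasure lborel {x::real^'n::_. norm x \<le> 1} = ennreal (unit_ball_vol CARD('n))"
    using emeasure_cball[of 1 "0::real^'n::_"] by (simp add: cball_def)
  have m: "{x::real^'n::_. norm x \<le> 1} \<in> sets borel"
    using borel_closed[OF closed_cball[of "0::real^'n::_" 1]] by (simp add: cball_def)
  have "emeasure euclid.M euclid.polyball = (\<integral>\<^sup>+z. indicator euclid.polyball z \<partial>euclid.M)" by (simp add: euclid.sets_M)
  also have "\<dots> = (\<integral>\<^sup>+s. \<integral>\<^sup>+t. ennreal (euclid.jac (s, t)) * indicator euclid.polyball (s, t) \<partial>lborel \<partial>lborel)"
    by (rule euclid.nn_integral_M) measurable
  also have "\<dots> = (\<integral>\<^sup>+s. \<integral>\<^sup>+t. 2 ^ CARD('n) * (indicator {x::real^'n::_. norm x \<le> 1} s * indicator {x::real^'n::_. norm x \<le> 1} t) \<partial>lborel \<partial>lborel)"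
  proof (rule nn_integral_cong_AE)
    have "AE s in lborel. s \<noteq> (0::real^'n::_)" by (rule AE_lborel_singleton)
    then show "AE s in lborel. (\<integral>\<^sup>+t. ennreal (euclid.jac (s, t)) * indicator euclid.polyball (s, t) \<partial>lborel)
      = (\<integral>\<^sup>+t. 2 ^ CARD('n) * (indicator {x::real^'n::_. norm x \<le> 1} s * indicator {x::real^'n::_. norm x \<le> 1} t) \<partial>lborel)"
    proof eventually_elim
      fix s :: "real ^ 'n::_" assume "s \<noteq> 0"
      have "AE t in lborel. t \<noteq> (0::real^'n::_)" by (rule AE_lborel_singleton)
      then show "(\<integral>\<^sup>+t. ennreal (euclid.jac (s, t)) * indicator euclid.polyball (s, t) \<partial>lborel)
        = (\<integral>\<^sup>+t. 2 ^ CARD('n) * (indicator {x::real^'n::_. norm x \<le> 1} s * indicator {x::real^'n::_. norm x \<le> 1} t) \<partial>lborel)"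
        using \<open>s \<noteq> 0\<close>
        by (intro nn_integral_cong_AE)
          (auto elim!: eventually_mono simp: euclidean_jac euclid.polyball_def indicator_def ennreal_power[symmetric])
    qed
  qed
  also have "\<dots> = 2 ^ CARD('n) * (emeasure lborel {x::real^'n::_. norm x \<le> 1} * emeasure lborel {x::real^'n::_. norm x \<le> 1})"
    using m by (simp add: nn_integral_cmult nn_integral_multc)
  also have "\<dots> = ennreal (2 ^ CARD('n) * (unit_ball_vol CARD('n))\<^sup>2)"
    unfolding b by (simp add: ennreal_mult' ennreal_power[symmetric] power2_eq_square)
  finally show ?thesis .
qed

text \<open>When \<open>p\<close> is the identity the phase p s.t - s.p t is 0, so
  \<open>rotated_le\<close> holds with equality.\<close>

lemma euclidean_rotated:
  "ennreal (norm (\<integral>z. exp (euclid.expo 0 (\<i> * of_real (pi / 4)) z) \<partial>euclid.M))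
     = emeasure euclid.M euclid.polyball * (\<integral>\<^sup>+a. ennreal (exp (- (1 / 2) * a\<^sup>2)) \<partial>radial CARD('n))\<^sup>2"
proof -
  have "exp (euclid.expo 0 (\<i> * of_real (pi / 4)) z) = of_real (exp (- (1 / 2) * euclid.q2 z))" for z
  proof -
    have "euclid.expo 0 (\<i> * of_real (pi / 4)) z = of_real (- (1 / 2) * euclid.q2 z)"
      by (cases z) (simp only: euclid.expo_rotated, simp add: complex_eq_iff inner_commute)
    then show ?thesis by (simp only: exp_of_real)
  qed
  then have "(\<integral>z. exp (euclid.expo 0 (\<i> * of_real (pi / 4)) z) \<partial>euclid.M) = of_real (\<integral>z. exp (- (1 / 2) * euclid.q2 z) \<partial>euclid.M)"
    by (simp only: integral_complex_of_real)
  then have "ennreal (norm (\<integral>z. exp (euclid.expo 0 (\<i> * of_real (pi / 4)) z) \<partial>euclid.M)) = ennreal (\<integral>z. exp (- (1 / 2) * euclid.q2 z) \<partial>euclid.M)"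
    by (simp only: norm_of_real) (simp add: integral_nonneg_AE)
  also have "\<dots> = (\<integral>\<^sup>+z. ennreal (exp (- (1 / 2) * euclid.q2 z)) \<partial>euclid.M)"
    by (rule nn_integral_eq_integral[symmetric]) (use euclid.gauss_integrable[of "1/2"] in auto)
  finally show ?thesis unfolding euclid.nn_integral_gauss .
qed

text \<open>By uniqueness of limits the rotated integrals of both norms coincide. For the ball it
  equals its constant times \<open>\<kappa>\<close>, for N it is at most the constant times the same
  \<open>\<kappa>\<close>.\<close>

lemma polyball_ge:
  fixes N :: "real ^ 'n::_ \<Rightarrow> real"
  assumes "smooth_norm N p"
  shows "ennreal (2 ^ CARD('n) * (unit_ball_vol CARD('n))\<^sup>2) \<le> emeasure (smooth_norm.M p) (smooth_norm.polyball N)"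
proof -
  interpret K: smooth_norm N p by fact
  define \<kappa> where "\<kappa> = (\<integral>\<^sup>+a. ennreal (exp (- (1 / 2) * a\<^sup>2)) \<partial>radial CARD('n))\<^sup>2"
  have c1: "CARD('n) \<ge> 1" by (simp add: Suc_le_eq)
  have \<kappa>: "\<kappa> \<noteq> 0" "\<kappa> \<noteq> \<infinity>"
    using radial_gauss_pos[OF c1, of "1/2"] radial_gauss_finite[OF c1, of "1/2"]
    by (auto simp: \<kappa>_def power2_eq_square ennreal_mult_eq_top_iff)
  have "(\<integral>z. exp (euclid.expo 0 (\<i> * of_real (pi / 4)) z) \<partial>euclid.M) = (\<integral>z. exp (K.expo 0 (\<i> * of_real (pi / 4)) z) \<partial>K.M)"
    by (rule LIMSEQ_unique[OF euclid.gauss_limit K.gauss_limit])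
  then have "emeasure euclid.M euclid.polyball * \<kappa> \<le> emeasure K.M K.polyball * \<kappa>"
    using euclidean_rotated K.rotated_le by (simp add: \<kappa>_def)
  then have "emeasure euclid.M euclid.polyball \<le> emeasure K.M K.polyball"
    using \<kappa> by (simp add: mult.commute[of _ \<kappa>] ennreal_mult_le_mult_iff)
  then show ?thesis by (simp only: euclidean_polyball)
qed

end

lemma smooth_mahler:
  fixes N :: "real ^ 'n::{finite,wellorder} \<Rightarrow> real"
  assumes "smooth_norm N p"
  shows "ennreal (2 ^ CARD('n) * (unit_ball_vol CARD('n))\<^sup>2 * ((fact CARD('n))\<^sup>2 / fact (2 * CARD('n))))
    \<le> emeasure lborel {x. N x \<le> 1} * emeasure lborel (polar_body {x. N x \<le> 1})"
proof -
  interpret K: smooth_norm N p by fact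
  have "ennreal (2 ^ CARD('n) * (unit_ball_vol CARD('n))\<^sup>2 * ((fact CARD('n))\<^sup>2 / fact (2 * CARD('n))))
    = ennreal (2 ^ CARD('n) * (unit_ball_vol CARD('n))\<^sup>2) * ennreal ((fact CARD('n))\<^sup>2 / fact (2 * CARD('n)))"
    by (rule ennreal_mult') simp
  also have "\<dots> \<le> emeasure K.M K.polyball * ennreal ((fact CARD('n))\<^sup>2 / fact (2 * CARD('n)))"
    using polyball_ge[OF assms] by (intro mult_right_mono) auto
  also have "\<dots> \<le> emeasure lborel {x. N x \<le> 1} * emeasure lborel (polar_body {x. N x \<le> 1})"
    using K.mahler_lower by (simp add: K.unit_body_def)
  finally show ?thesis .
qed

section \<open>Smooth norms from finitely many functionals\<close>

text \<open>Young's inequality for the conjugate exponents (2j+2)/(2j+1) and 2j+2. It is Bernoulli's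
  inequality for b/a, which for an even exponent holds for all signs.\<close>

lemma power_mult_le_Young:
  fixes a b :: real
  shows "real (2 * j + 2) * (a ^ (2 * j + 1) * b) \<le> real (2 * j + 1) * a ^ (2 * j + 2) + b ^ (2 * j + 2)"
proof (cases "a = 0")
  case False
  have "1 + real (2 * j + 2) * (b / a - 1) \<le> (b / a) ^ (2 * j + 2)"
    using Bernoulli_inequality_even[of "2 * j + 2" "b / a - 1"] by simp
  moreover have "a ^ (2 * j + 2) > 0" using False by (intro zero_less_power_eq[THEN iffD2]) auto
  ultimately have "(1 + real (2 * j + 2) * (b / a - 1)) * a ^ (2 * j + 2) \<le> (b / a) ^ (2 * j + 2) * a ^ (2 * j + 2)"
    by (intro mult_right_mono) auto
  also have "(b / a) ^ (2 * j + 2) * a ^ (2 * j + 2) = b ^ (2 * j + 2)"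
    using False by (simp add: power_divide)
  also have "(1 + real (2 * j + 2) * (b / a - 1)) * a ^ (2 * j + 2) = real (2 * j + 2) * (a ^ (2 * j + 1) * b) - real (2 * j + 1) * a ^ (2 * j + 2)"
    using False by (simp add: field_simps)
  finally show ?thesis by simp
qed (use zero_le_even_power[of "2 * j + 2" b] in simp)

text \<open>An even exponent makes the power sum a polynomial. The assumption \<open>span\<close>
  keeps it positive off the origin, where its root is then differentiable. The Euclidean term with
  weight \<open>\<delta>\<close> makes the gradient strictly monotone and bounds the norm from
  below.\<close>

locale smoothing =
  fixes V :: "(real ^ 'n::{finite,wellorder}) set" and j :: nat and \<delta> :: real
  assumes fin: "finite V" and span: "x \<noteq> 0 \<Longrightarrow> \<exists>v\<in>V. x \<bullet> v \<noteq> 0" and \<delta>: "\<delta> > 0"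
begin

definition S :: "real ^ 'n::_ \<Rightarrow> real" where "S x = (\<Sum>v\<in>V. (x \<bullet> v) ^ (2 * j + 2))"

definition f :: "real ^ 'n::_ \<Rightarrow> real" where "f x = root (2 * j + 2) (S x)"

text \<open>The gradient of f^2/2, where f is the root of \<open>S\<close> of order 2j+2. At the
  origin the numerator is 0, which gives the right value for every j.\<close>

definition p1 :: "real ^ 'n::_ \<Rightarrow> real ^ 'n::_" where
  "p1 x = (\<Sum>v\<in>V. (x \<bullet> v) ^ (2 * j + 1) *\<^sub>R v) /\<^sub>R f x ^ (2 * j)"

definition sN :: "real ^ 'n::_ \<Rightarrow> real" where "sN x = sqrt ((f x)\<^sup>2 + \<delta> * (norm x)\<^sup>2)"

definition sp :: "real ^ 'n::_ \<Rightarrow> real ^ 'n::_" where "sp x = p1 x + \<delta> *\<^sub>R x"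

lemma S_nonneg: "S x \<ge> 0"
  unfolding S_def by (intro sum_nonneg zero_le_even_power) simp

lemma S_pos: assumes "x \<noteq> 0" shows "S x > 0"
proof -
  obtain v where v: "v \<in> V" "x \<bullet> v \<noteq> 0" using span[OF assms] by blast
  show ?thesis unfolding S_def
  proof (rule sum_pos2[OF fin v(1)])
    show "0 < (x \<bullet> v) ^ (2 * j + 2)" using v(2) by (intro zero_less_power_eq[THEN iffD2]) auto
    show "0 \<le> (x \<bullet> w) ^ (2 * j + 2)" for w by (rule zero_le_even_power) simp
  qed
qed

lemma S_zero [simp]: "S 0 = 0" by (simp add: S_def)

lemma f_zero [simp]: "f 0 = 0" by (simp add: f_def)

lemma f_nonneg: "f x \<ge> 0" unfolding f_def using S_nonneg by simp

lemma f_pos: "x \<noteq> 0 \<Longrightarrow> f x > 0" unfolding f_def using S_pos by simp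

lemma f_power: "f x ^ (2 * j + 2) = S x"
  unfolding f_def using S_nonneg by (intro real_root_pow_pos2) auto

lemma p1_zero [simp]: "p1 0 = 0" by (simp add: p1_def)

lemma Hoelder: "(\<Sum>v\<in>V. (x \<bullet> v) ^ (2 * j + 1) * (y \<bullet> v)) \<le> f x ^ (2 * j + 1) * f y"
proof (cases "x = 0 \<or> y = 0")
  case False
  \<comment> \<open>Hoelder's inequality by normalization: after dividing by the norms, the sum of
    the Young inequalities has right side (2j+1) + 1.\<close>
  define a b where "a = f x" and "b = f y"
  have ab: "a > 0" "b > 0" using False f_pos by (auto simp: a_def b_def)
  have "real (2 * j + 2) * (\<Sum>v\<in>V. (x \<bullet> v / a) ^ (2 * j + 1) * (y \<bullet> v / b))
    \<le> (\<Sum>v\<in>V. real (2 * j + 1) * (x \<bullet> v / a) ^ (2 * j + 2) + (y \<bullet> v / b) ^ (2 * j + 2))"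
    unfolding sum_distrib_left by (intro sum_mono power_mult_le_Young)
  also have "\<dots> = real (2 * j + 1) * (S x / a ^ (2 * j + 2)) + S y / b ^ (2 * j + 2)"
    unfolding sum.distrib S_def power_divide sum_divide_distrib sum_distrib_left ..
  also have "\<dots> = real (2 * j + 2)"
    using ab unfolding f_power[symmetric] a_def b_def by (simp del: power_Suc)
  finally have "real (2 * j + 2) * (\<Sum>v\<in>V. (x \<bullet> v / a) ^ (2 * j + 1) * (y \<bullet> v / b)) \<le> real (2 * j + 2) * 1"
    by simp
  then have "(\<Sum>v\<in>V. (x \<bullet> v / a) ^ (2 * j + 1) * (y \<bullet> v / b)) \<le> 1"
    by (rule mult_left_le_imp_le) simp
  moreover have "(\<Sum>v\<in>V. (x \<bullet> v / a) ^ (2 * j + 1) * (y \<bullet> v / b)) = (\<Sum>v\<in>V. (x \<bullet> v) ^ (2 * j + 1) * (y \<bullet> v)) / (a ^ (2 * j + 1) * b)"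
    unfolding sum_divide_distrib power_divide by (intro sum.cong) auto
  ultimately show ?thesis using ab by (simp add: a_def b_def divide_le_eq)
qed auto

lemma p1_inner: "p1 x \<bullet> y = (\<Sum>v\<in>V. (x \<bullet> v) ^ (2 * j + 1) * (y \<bullet> v)) / f x ^ (2 * j)"
  by (simp add: p1_def inner_sum_left inner_commute[of y] divide_inverse mult.commute del: power_Suc)

lemma p1_le: "p1 x \<bullet> y \<le> f x * f y"
proof (cases "x = 0")
  case False
  then have fx: "f x > 0" by (rule f_pos)
  have "p1 x \<bullet> y \<le> f x ^ (2 * j + 1) * f y / f x ^ (2 * j)"
    unfolding p1_inner using fx Hoelder[of x y] by (intro divide_right_mono) auto
  also have "\<dots> = f x * f y" using fx by simp
  finally show ?thesis .
qed simp

lemma p1_self: "p1 x \<bullet> x = (f x)\<^sup>2"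
proof (cases "x = 0")
  case False
  then have fx: "f x > 0" by (rule f_pos)
  have "p1 x \<bullet> x = S x / f x ^ (2 * j)"
    unfolding p1_inner S_def by (simp add: mult.commute)
  also have "\<dots> = (f x)\<^sup>2" using fx by (simp add: power_add power2_eq_square flip: f_power)
  finally show ?thesis .
qed simp

lemma f_scale: "r > 0 \<Longrightarrow> f (r *\<^sub>R x) = r * f x"
proof -
  assume "r > 0"
  have "S (r *\<^sub>R x) = r ^ (2 * j + 2) * S x"
    unfolding S_def sum_distrib_left inner_scaleR_left power_mult_distrib ..
  then show ?thesis using \<open>r > 0\<close> unfolding f_def
    by (simp only: real_root_mult) (simp only: real_root_power_cancel less_imp_le zero_less_Suc add_2_eq_Suc')
qed

lemma p1_scale: "r > 0 \<Longrightarrow> p1 (r *\<^sub>R x) = r *\<^sub>R p1 x"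
proof -
  assume r: "r > 0"
  have "(\<Sum>v\<in>V. (r *\<^sub>R x \<bullet> v) ^ (2 * j + 1) *\<^sub>R v) = r ^ (2 * j + 1) *\<^sub>R (\<Sum>v\<in>V. (x \<bullet> v) ^ (2 * j + 1) *\<^sub>R v)"
    unfolding scaleR_sum_right scaleR_scaleR inner_scaleR_left power_mult_distrib ..
  then show ?thesis using r by (simp add: p1_def f_scale power_mult_distrib)
qed

lemma f_minus: "f (- x) = f x"
  by (simp add: f_def S_def)

lemma sN_sq: "(sN x)\<^sup>2 = (f x)\<^sup>2 + \<delta> * (norm x)\<^sup>2"
  using \<delta> by (simp add: sN_def add_nonneg_nonneg)

lemma sp_le: "sp x \<bullet> y \<le> sN x * sN y"
proof -
  have "sp x \<bullet> y \<le> f x * f y + \<delta> * (norm x * norm y)"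
    unfolding sp_def inner_add_left inner_scaleR_left
    using \<delta> by (intro add_mono p1_le mult_left_mono norm_cauchy_schwarz) auto
  \<comment> \<open>Cauchy-Schwarz in the plane combines the bounds for the two summands of the
    norm.\<close>
  also have "\<dots> = (f x, sqrt \<delta> * norm x) \<bullet> (f y, sqrt \<delta> * norm y)"
    using \<delta> by (simp add: mult_ac flip: mult.assoc[of "sqrt \<delta>" "sqrt \<delta>"])
  also have "\<dots> \<le> norm (f x, sqrt \<delta> * norm x) * norm (f y, sqrt \<delta> * norm y)"
    by (rule norm_cauchy_schwarz)
  also have "\<dots> = sN x * sN y"
    using \<delta> by (simp add: norm_Pair sN_def power_mult_distrib)
  finally show ?thesis .
qed

lemma S_diff: "S differentiable (at x)"
  unfolding S_def by (auto intro!: differentiable_sum fin differentiable_power)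

lemma f_diff: assumes "x \<noteq> 0" shows "f differentiable (at x)"
proof -
  have "(root (2 * j + 2) has_real_derivative inverse (real (2 * j + 2) * root (2 * j + 2) (S x) ^ (2 * j + 2 - Suc 0))) (at (S x))"
    using S_pos[OF assms] by (intro DERIV_real_root) auto
  then have "root (2 * j + 2) differentiable (at (S x))"
    using real_differentiable_def by blast
  then have "(root (2 * j + 2) \<circ> S) differentiable (at x)"
    by (rule differentiable_chain_at[OF S_diff])
  then show ?thesis by (simp add: f_def[abs_def] o_def)
qed

lemma sp_diff: assumes "x \<noteq> 0" shows "sp differentiable (at x)"
  unfolding sp_def p1_def
  using f_pos[OF assms]
  by (intro differentiable_add differentiable_scaleR differentiable_inverse differentiable_power f_diff[OF assms]
      differentiable_sum fin differentiable_const differentiable_ident ballI differentiable_inner) auto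

text \<open>Serves the continuity of \<open>sp\<close> at the origin, the one point that
  differentiability does not cover.\<close>

lemma sN_upper: "\<exists>C>0. \<forall>x. sN x \<le> C * norm x"
proof -
  obtain R where R: "R > 0" "\<And>v. v \<in> V \<Longrightarrow> norm v \<le> R"
    using finite_imp_bounded[OF fin] bounded_pos by blast
  define D where "D = (real (card V) + 1) * R ^ (2 * j + 2)"
  have D: "D > 0" using R by (simp add: D_def)
  have "S x \<le> D * norm x ^ (2 * j + 2)" for x
  proof -
    have "(x \<bullet> v) ^ (2 * j + 2) \<le> R ^ (2 * j + 2) * norm x ^ (2 * j + 2)" if "v \<in> V" for v
    proof -
      have "\<bar>x \<bullet> v\<bar> \<le> norm x * R"
        using Cauchy_Schwarz_ineq2[of x v] R(2)[OF that] by (meson mult_left_mono norm_ge_zero order_trans)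
      then have "\<bar>x \<bullet> v\<bar> ^ (2 * j + 2) \<le> (norm x * R) ^ (2 * j + 2)" by (intro power_mono) auto
      moreover have "\<bar>x \<bullet> v\<bar> ^ (2 * j + 2) = (x \<bullet> v) ^ (2 * j + 2)" by (intro power_even_abs) simp
      ultimately show ?thesis by (simp only: power_mult_distrib mult.commute)
    qed
    then have "S x \<le> real (card V) * (R ^ (2 * j + 2) * norm x ^ (2 * j + 2))"
      unfolding S_def by (rule sum_bounded_above)
    also have "\<dots> \<le> D * norm x ^ (2 * j + 2)" using R by (simp add: D_def algebra_simps)
    finally show ?thesis .
  qed
  then have "f x \<le> root (2 * j + 2) D * norm x" for x
  proof -
    have "f x \<le> root (2 * j + 2) (D * norm x ^ (2 * j + 2))"
      unfolding f_def using \<open>S x \<le> _\<close> by (intro real_root_le_mono) auto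
    also have "\<dots> = root (2 * j + 2) D * norm x"
      by (simp only: real_root_mult) (simp only: real_root_power_cancel norm_ge_zero zero_less_Suc add_2_eq_Suc')
    finally show ?thesis .
  qed
  then have f2: "(f x)\<^sup>2 \<le> (root (2 * j + 2) D)\<^sup>2 * (norm x)\<^sup>2" for x
    using f_nonneg by (metis power_mono power_mult_distrib)
  define C where "C = sqrt ((root (2 * j + 2) D)\<^sup>2 + \<delta>)"
  have C: "C > 0" "C\<^sup>2 = (root (2 * j + 2) D)\<^sup>2 + \<delta>" using \<delta> by (auto simp: C_def add_nonneg_pos)
  have "sN x \<le> C * norm x" for x
  proof (rule power2_le_imp_le)
    show "(sN x)\<^sup>2 \<le> (C * norm x)\<^sup>2"
      using f2[of x] by (simp add: sN_sq power_mult_distrib C algebra_simps)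
  qed (use C in auto)
  then show ?thesis using C by blast
qed

lemma sp_cont: "continuous_on UNIV sp"
proof (rule continuous_at_imp_continuous_on, intro ballI)
  fix x
  show "isCont sp x"
  proof (cases "x = 0")
    case False
    then show ?thesis using sp_diff differentiable_imp_continuous_within by blast
  next
    case True
    obtain C where C: "C > 0" "\<And>x. sN x \<le> C * norm x" using sN_upper by blast
    have sN0: "sN x \<ge> 0" for x using \<delta> by (simp add: sN_def add_nonneg_nonneg)
    \<comment> \<open>Testing \<open>sp_le\<close> against the vector \<open>sp y\<close> itself
      bounds its length.\<close>
    have "norm (sp y) \<le> C\<^sup>2 * norm y" for y
    proof (cases "sp y = 0")
      case False
      have "norm (sp y) * norm (sp y) \<le> sN y * sN (sp y)"
        using sp_le[of y "sp y"] by (simp add: power2_norm_eq_inner flip: power2_eq_square)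
      also have "\<dots> \<le> (C * norm y) * (C * norm (sp y))"
        using C sN0 by (intro mult_mono) auto
      finally have "norm (sp y) * norm (sp y) \<le> (C\<^sup>2 * norm y) * norm (sp y)"
        by (simp add: power2_eq_square mult_ac)
      then show ?thesis using False by simp
    qed (use C in auto)
    then have "(sp \<longlongrightarrow> 0) (at 0)"
      by (intro Lim_null_comparison[of sp "\<lambda>y. C\<^sup>2 * norm y"]) (auto intro!: tendsto_eq_intros always_eventually)
    then show ?thesis using True by (simp add: isCont_def sp_def)
  qed
qed

lemma smooth_norm: "smooth_norm sN sp"
proof
  show "sN (- x) = sN x" for x by (simp add: sN_def f_minus)
  show "\<exists>c>0. \<forall>x. c * norm x \<le> sN x"
  proof (intro exI conjI allI)
    show "sqrt \<delta> > 0" using \<delta> by simp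
    show "sqrt \<delta> * norm x \<le> sN x" for x
      using real_sqrt_le_mono[of "\<delta> * (norm x)\<^sup>2" "(f x)\<^sup>2 + \<delta> * (norm x)\<^sup>2"]
      by (simp add: sN_def real_sqrt_mult)
  qed
  show "sp (r *\<^sub>R x) = r *\<^sub>R sp x" if "r > 0" for r x
    using p1_scale[OF that] by (simp add: sp_def scaleR_add_right)
  show "sp x \<bullet> x = (sN x)\<^sup>2" for x
    by (simp add: sp_def sN_sq inner_add_left p1_self power2_norm_eq_inner)
  show "sp x \<bullet> y \<le> sN x * sN y" for x y by (rule sp_le)
  show "continuous_on UNIV sp" by (rule sp_cont)
  show "sp differentiable (at x)" if "x \<noteq> 0" for x using that by (rule sp_diff)
  show "(sp x - sp y) \<bullet> (x - y) > 0" if "x \<noteq> y" for x y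
  proof -
    \<comment> \<open>Hoelder and \<open>p1_self\<close> give monotonicity of \<open>p1\<close> only
      in the weak sense; strictness comes from the summand \<delta> |x - y|^2.\<close>
    have "0 \<le> (f x - f y)\<^sup>2" by simp
    also have "\<dots> \<le> (p1 x - p1 y) \<bullet> (x - y)"
      using p1_le[of x y] p1_le[of y x] p1_self[of x] p1_self[of y]
      by (simp add: power2_diff inner_diff_left inner_diff_right mult.commute[of "f y" "f x"])
    finally have "(p1 x - p1 y) \<bullet> (x - y) \<ge> 0" .
    moreover have "\<delta> * ((x - y) \<bullet> (x - y)) > 0" using that \<delta> by simp
    moreover have "(sp x - sp y) \<bullet> (x - y) = (p1 x - p1 y) \<bullet> (x - y) + \<delta> * ((x - y) \<bullet> (x - y))"
      by (simp add: sp_def algebra_simps inner_simps)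
    ultimately show ?thesis by linarith
  qed
qed

end

section \<open>Approximation of convex bodies\<close>

lemma csc_zero_interior:
  fixes K :: "(real ^ 'n) set"
  assumes "centrally_symmetric_convex_body K"
  shows "0 \<in> interior K"
proof -
  have K: "convex K" "K = uminus ` K" "interior K \<noteq> {}"
    using assms by (auto simp: centrally_symmetric_convex_body_def)
  obtain z where z: "z \<in> interior K" using K(3) by blast
  have "interior K = uminus ` interior K"
    using interior_negations[of K] K(2) by simp
  then have "- z \<in> interior K" using z by blast
  then have "(1/2) *\<^sub>R z + (1/2) *\<^sub>R (- z) \<in> interior K"
    using convex_interior[OF K(1)] z by (intro convexD) auto
  then show ?thesis by simp
qed

lemma compact_polar_body:
  fixes K :: "(real ^ 'n) set"
  assumes "0 \<in> interior K"
  shows "compact (polar_body K)"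
proof -
  obtain r where r: "r > 0" "cball 0 r \<subseteq> K"
    using assms mem_interior_cball by blast
  have "polar_body K = (\<Inter>x\<in>K. {y. x \<bullet> y \<le> 1})" by (auto simp: polar_body_def)
  also have "closed \<dots>" by (intro closed_INT ballI closed_halfspace_le)
  finally have "closed (polar_body K)" .
  moreover have "norm y \<le> 1 / r" if y: "y \<in> polar_body K" for y
  proof (cases "y = 0")
    case False
    have "(r / norm y) *\<^sub>R y \<in> K" using r False by (intro subsetD[OF r(2)]) simp
    then have "((r / norm y) *\<^sub>R y) \<bullet> y \<le> 1" using y by (simp only: polar_body_def) blast
    moreover have "((r / norm y) *\<^sub>R y) \<bullet> y = r * norm y"
      using False by (simp add: power2_norm_eq_inner[symmetric] power2_eq_square)
    ultimately have "r * norm y \<le> 1" by simp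
    then show ?thesis using r by (simp add: field_simps)
  qed (use r in auto)
  then have "bounded (polar_body K)" unfolding bounded_iff by blast
  ultimately show ?thesis by (simp add: compact_eq_bounded_closed)
qed

lemma polar_separation:
  fixes K :: "(real ^ 'n) set"
  assumes "convex K" "closed K" "0 \<in> K" "z \<notin> K"
  shows "\<exists>v\<in>polar_body K. z \<bullet> v > 1"
proof -
  obtain a b where ab: "a \<bullet> z < b" "\<And>x. x \<in> K \<Longrightarrow> a \<bullet> x > b"
    using separating_hyperplane_closed_point[OF assms(1,2,4)] by blast
  \<comment> \<open>Since 0 lies in K the separating value is negative. Dividing by it reverses both
    inequalities and normalizes the threshold to 1.\<close>
  have b: "b < 0" using ab(2)[OF assms(3)] by simp
  show ?thesis
  proof (intro bexI[of _ "a /\<^sub>R b"])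
    show "z \<bullet> (a /\<^sub>R b) > 1" using ab(1) b by (simp add: inner_commute field_simps)
    show "a /\<^sub>R b \<in> polar_body K"
      using ab(2) b by (force simp: polar_body_def inner_commute field_simps)
  qed
qed

lemma polar_body_abs:
  fixes K :: "(real ^ 'n) set"
  assumes "K = uminus ` K" "x \<in> K" "v \<in> polar_body K"
  shows "\<bar>x \<bullet> v\<bar> \<le> 1"
proof -
  have "- x \<in> K" using assms(1,2) by blast
  then have "(- x) \<bullet> v \<le> 1" "x \<bullet> v \<le> 1" using assms(2,3) by (auto simp only: polar_body_def mem_Collect_eq)
  then show ?thesis by simp
qed

text \<open>Compactness: points of a large box outside the open set (1 + \<eta>) int K lie outside
  K, so each is cut off by some half-space x.v > 1 with v in the polar body. Finitely many
  half-spaces do it for all of them.\<close>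

lemma polytope_approximation:
  fixes K :: "(real ^ 'n) set"
  assumes K: "centrally_symmetric_convex_body K" and "\<eta> > 0"
  shows "\<exists>V. finite V \<and> V \<subseteq> polar_body K \<and> (\<forall>x. x \<noteq> 0 \<longrightarrow> (\<exists>v\<in>V. x \<bullet> v \<noteq> 0)) \<and>
     (\<forall>x. (\<forall>v\<in>V. \<bar>x \<bullet> v\<bar> \<le> 1) \<longrightarrow> x \<in> (\<lambda>x. (1 + \<eta>) *\<^sub>R x) ` K)"
proof -
  have Kp: "convex K" "compact K" "K = uminus ` K" and z: "0 \<in> interior K"
    using K csc_zero_interior by (auto simp: centrally_symmetric_convex_body_def)
  have z0: "0 \<in> K" using z interior_subset by blast
  obtain B where B: "B > 0" "\<And>x. x \<in> K \<Longrightarrow> norm x \<le> B"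
    using Kp(2) compact_imp_bounded bounded_pos by metis
  define O' where "O' = (\<lambda>x. (1 + \<eta>) *\<^sub>R x) ` interior K"
  have op: "open O'" unfolding O'_def using assms(2) by (intro open_scaling) auto
  have sub: "O' \<subseteq> (\<lambda>x. (1 + \<eta>) *\<^sub>R x) ` K"
    unfolding O'_def using interior_subset by blast
  have KO: "K \<subseteq> O'"
  proof
    fix x assume x: "x \<in> K"
    \<comment> \<open>This vector is x/(1 + \<eta>), an interior point because it lies on the
      segment from x to the interior point 0, short of x.\<close>
    have "x - (\<eta> / (1 + \<eta>)) *\<^sub>R (x - 0) \<in> interior K"
      using assms(2) x z Kp(1) by (intro mem_interior_convex_shrink) auto
    moreover have "x = (1 + \<eta>) *\<^sub>R (x - (\<eta> / (1 + \<eta>)) *\<^sub>R (x - 0))"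
    proof -
      have "(1 + \<eta>) * (\<eta> / (1 + \<eta>)) = \<eta>" using assms(2) by simp
      then have "(1 + \<eta>) *\<^sub>R (x - (\<eta> / (1 + \<eta>)) *\<^sub>R (x - 0)) = (1 + \<eta>) *\<^sub>R x - \<eta> *\<^sub>R x"
        by (simp only: scaleR_right_diff_distrib scaleR_scaleR diff_0_right)
      then show ?thesis by (simp add: scaleR_left_distrib)
    qed
    ultimately show "x \<in> O'" unfolding O'_def by blast
  qed
  \<comment> \<open>Coordinate functionals scaled into the polar body. They confine the polytope to
    the box, which makes the compactness argument possible, and they span the space.\<close>
  define V0 where "V0 = (\<lambda>i. axis i (1 / B) :: real ^ 'n) ` UNIV"
  have comp: "x \<bullet> axis i (1 / B) = x $ i / B" for x :: "real ^ 'n" and i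
    by (simp add: inner_axis)
  have V0K: "V0 \<subseteq> polar_body K"
  proof -
    have "x $ i / B \<le> 1" if "x \<in> K" for x :: "real ^ 'n" and i
      using component_le_norm_cart[of x i] B(2)[OF that] B(1) by (simp add: field_simps)
    then show ?thesis by (auto simp: V0_def polar_body_def comp)
  qed
  define Z where "Z = cbox (\<chi> i. - B) (\<chi> i. B) - O'"
  have "compact Z" unfolding Z_def using op by (intro compact_diff) auto
  define \<C> where "\<C> = (\<lambda>v. {x. x \<bullet> v > 1}) ` polar_body K"
  have "Z \<subseteq> \<Union> \<C>"
  proof
    fix x assume "x \<in> Z"
    then have "x \<notin> K" using KO by (auto simp: Z_def)
    then show "x \<in> \<Union> \<C>"
      using polar_separation[OF Kp(1) compact_imp_closed[OF Kp(2)] z0] by (auto simp: \<C>_def)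
  qed
  moreover have "open c" if "c \<in> \<C>" for c
    using that open_halfspace_gt[of 1] by (auto simp: \<C>_def inner_commute)
  ultimately obtain D where D: "D \<subseteq> \<C>" "finite D" "Z \<subseteq> \<Union> D"
    using compactE[OF \<open>compact Z\<close>, of \<C>] by metis
  then obtain V1 where V1: "V1 \<subseteq> polar_body K" "finite V1" "D = (\<lambda>v. {x. x \<bullet> v > 1}) ` V1"
    unfolding \<C>_def using finite_subset_image[of D] by metis
  show ?thesis
  proof (intro exI[of _ "V0 \<union> V1"] conjI allI impI)
    show "finite (V0 \<union> V1)" using V1 by (simp add: V0_def)
    show "V0 \<union> V1 \<subseteq> polar_body K" using V0K V1 by simp
    show "\<exists>v\<in>V0 \<union> V1. x \<bullet> v \<noteq> 0" if x: "x \<noteq> 0" for x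
    proof -
      obtain i where "x $ i \<noteq> 0" using x by (metis vec_eq_iff zero_index)
      then have "x \<bullet> axis i (1 / B) \<noteq> 0" using B(1) by (simp add: comp)
      then show ?thesis by (auto simp: V0_def)
    qed
    fix x :: "real ^ 'n" assume *: "\<forall>v\<in>V0 \<union> V1. \<bar>x \<bullet> v\<bar> \<le> 1"
    have "\<bar>x $ i\<bar> \<le> B" for i
    proof -
      have "\<bar>x \<bullet> axis i (1 / B)\<bar> \<le> 1" using * by (auto simp: V0_def)
      then show ?thesis using B(1) by (simp add: comp field_simps)
    qed
    then have "x \<in> cbox (\<chi> i. - B) (\<chi> i. B)"
      by (auto simp: mem_box_cart abs_le_iff minus_le_iff)
    moreover have "x \<bullet> v \<le> 1" if "v \<in> V1" for v
    proof (rule abs_le_D1)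
      show "\<bar>x \<bullet> v\<bar> \<le> 1" using * that by blast
    qed
    then have "x \<notin> \<Union> D" by (auto simp: V1(3) not_less)
    ultimately have "x \<in> O'" using D(3) by (auto simp: Z_def)
    then show "x \<in> (\<lambda>x. (1 + \<eta>) *\<^sub>R x) ` K" using sub by blast
  qed
qed

text \<open>The 2k-norm of the functionals lies between their maximum and card(V)^(1/2k) times it.
  The lower bound gives the inclusion in (1 + \<eta>) K, the upper one, with k large, the bound on
  K.\<close>

lemma smooth_approximation:
  fixes K :: "(real ^ 'n::{finite,wellorder}) set"
  assumes K: "centrally_symmetric_convex_body K" and \<eta>: "\<eta> > 0"
  shows "\<exists>N p. smooth_norm N p \<and> (\<forall>x\<in>K. N x \<le> 1 + 2 * \<eta>) \<and> {x. N x \<le> 1} \<subseteq> (\<lambda>x. (1 + \<eta>) *\<^sub>R x) ` K"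
proof -
  obtain V where V: "finite V" "V \<subseteq> polar_body K" "\<And>x. x \<noteq> 0 \<Longrightarrow> \<exists>v\<in>V. x \<bullet> v \<noteq> 0"
    "\<And>x. (\<forall>v\<in>V. \<bar>x \<bullet> v\<bar> \<le> 1) \<Longrightarrow> x \<in> (\<lambda>x. (1 + \<eta>) *\<^sub>R x) ` K"
    using polytope_approximation[OF assms] by blast
  have Kp: "compact K" "K = uminus ` K" using K by (auto simp: centrally_symmetric_convex_body_def)
  obtain B where B: "B > 0" "\<And>x. x \<in> K \<Longrightarrow> norm x \<le> B"
    using Kp(1) compact_imp_bounded bounded_pos by metis
  define m where "m = real (card V) + 1"
  have "(\<lambda>n. root n m) \<longlonglongrightarrow> 1" by (rule LIMSEQ_root_const) (simp add: m_def)
  then have "eventually (\<lambda>n. root n m < 1 + \<eta>) sequentially"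
    by (rule order_tendstoD) (use \<eta> in simp)
  then obtain n0 where n0: "\<And>n. n \<ge> n0 \<Longrightarrow> root n m < 1 + \<eta>"
    unfolding eventually_sequentially by blast
  define j where "j = n0"
  \<comment> \<open>Chosen so that the Euclidean term contributes at most \<eta> to the square of
    the norm on K; (1 + \<eta>)^2 + \<eta> \<le> (1 + 2\<eta>)^2 then yields the bound.\<close>
  define \<delta> where "\<delta> = \<eta> / B\<^sup>2"
  have \<delta>: "\<delta> > 0" using \<eta> B by (simp add: \<delta>_def)
  interpret s: smoothing V j \<delta>
    by standard (use V \<delta> in auto)
  have "s.sN x \<le> 1 + 2 * \<eta>" if x: "x \<in> K" for x
  proof -
    have "(x \<bullet> v) ^ (2 * j + 2) \<le> 1" if "v \<in> V" for v
    proof -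
      have "\<bar>x \<bullet> v\<bar> \<le> 1" using polar_body_abs[OF Kp(2) x] V(2) that by blast
      then have "\<bar>x \<bullet> v\<bar> ^ (2 * j + 2) \<le> 1" by (intro power_le_one) auto
      moreover have "\<bar>x \<bullet> v\<bar> ^ (2 * j + 2) = (x \<bullet> v) ^ (2 * j + 2)" by (intro power_even_abs) simp
      ultimately show ?thesis by simp
    qed
    then have "s.S x \<le> real (card V) * 1" unfolding s.S_def by (rule sum_bounded_above)
    also have "\<dots> \<le> m" by (simp add: m_def)
    finally have "s.f x \<le> root (2 * j + 2) m" unfolding s.f_def by (intro real_root_le_mono) auto
    also have "\<dots> \<le> 1 + \<eta>" using n0[of "2 * j + 2"] by (simp add: j_def)
    finally have "(s.f x)\<^sup>2 \<le> (1 + \<eta>)\<^sup>2" using s.f_nonneg by (intro power_mono) auto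
    moreover have "\<delta> * (norm x)\<^sup>2 \<le> \<eta>"
    proof -
      have "(norm x)\<^sup>2 \<le> B\<^sup>2" using B(2)[OF x] by (intro power_mono) auto
      then have "\<delta> * (norm x)\<^sup>2 \<le> \<delta> * B\<^sup>2" using \<delta> by (intro mult_left_mono) auto
      then show ?thesis using B(1) by (simp add: \<delta>_def)
    qed
    ultimately have "(s.sN x)\<^sup>2 \<le> (1 + \<eta>)\<^sup>2 + \<eta>" unfolding s.sN_sq by linarith
    also have "\<dots> \<le> (1 + 2 * \<eta>)\<^sup>2" using \<eta> by (simp add: power2_eq_square algebra_simps)
    finally show ?thesis by (rule power2_le_imp_le) (use \<eta> in simp)
  qed
  moreover have "{x. s.sN x \<le> 1} \<subseteq> (\<lambda>x. (1 + \<eta>) *\<^sub>R x) ` K"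
  proof
    fix x assume "x \<in> {x. s.sN x \<le> 1}"
    then have "(s.sN x)\<^sup>2 \<le> 1" using s.sN_def by (simp add: power_le_one \<delta> less_imp_le)
    moreover have "(s.f x)\<^sup>2 \<le> (s.sN x)\<^sup>2" unfolding s.sN_sq using \<delta> by simp
    ultimately have "s.f x \<le> 1" using s.f_nonneg power2_le_imp_le[of "s.f x" 1] by simp
    then have S1: "s.S x \<le> 1" unfolding s.f_power[symmetric] using s.f_nonneg by (intro power_le_one) auto
    have "\<bar>x \<bullet> v\<bar> \<le> 1" if "v \<in> V" for v
    proof -
      have "(x \<bullet> v) ^ (2 * j + 2) \<le> s.S x"
        unfolding s.S_def using that V(1) by (intro member_le_sum zero_le_even_power) auto
      moreover have "\<bar>x \<bullet> v\<bar> ^ (2 * j + 2) = (x \<bullet> v) ^ (2 * j + 2)" by (intro power_even_abs) simp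
      ultimately have "\<bar>x \<bullet> v\<bar> ^ (2 * j + 2) \<le> 1" using S1 by linarith
      then show ?thesis using power_le_one_iff[of "\<bar>x \<bullet> v\<bar>" "2 * j + 2"] by simp
    qed
    then show "x \<in> (\<lambda>x. (1 + \<eta>) *\<^sub>R x) ` K" by (intro V(4)) blast
  qed
  ultimately show ?thesis using s.smooth_norm by blast
qed

section \<open>The bound for an arbitrary body\<close>

definition kuperberg_bound :: "nat \<Rightarrow> real" where
  "kuperberg_bound n = 2 ^ n * (fact n)\<^sup>2 * pi ^ n / (fact (2 * n) * (half_fact n)\<^sup>2)"

text \<open>Separates the two sources of the bound: 2^n vol(B)^2 is the constant of the Euclidean
  ball B, and (n!)^2/(2n)! comes from homogeneity.\<close>

lemma kuperberg_bound_altdef: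
  "kuperberg_bound n = 2 ^ n * (unit_ball_vol n)\<^sup>2 * ((fact n)\<^sup>2 / fact (2 * n))"
proof -
  have "(pi powr (real n / 2))\<^sup>2 = pi ^ n"
    by (simp add: powr_realpow[symmetric] powr_powr)
  then show ?thesis by (simp add: kuperberg_bound_def unit_ball_vol_def half_fact_def power_divide field_simps)
qed

text \<open>The smooth body L lies in (1 + \<eta>) K and contains K/(1 + 2\<eta>), so the polar of L
  lies in (1 + 2\<eta>) times that of K. The volume products differ by factors tending to 1 with
  \<eta> -> 0.\<close>

lemma mahler_ordered:
  fixes K :: "(real ^ 'n::{finite,wellorder}) set"
  assumes K: "centrally_symmetric_convex_body K"
  shows "mahler_volume K \<ge> kuperberg_bound CARD('n)"
proof -
  have cK: "compact K" "0 \<in> interior K" using K csc_zero_interior by (auto simp: centrally_symmetric_convex_body_def)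
  have cP: "compact (polar_body K)" using compact_polar_body[OF cK(2)] .
  define n where "n = CARD('n)"
  have *: "kuperberg_bound n \<le> (1 + \<eta>) ^ n * (1 + 2 * \<eta>) ^ n * mahler_volume K" if \<eta>: "\<eta> > 0" for \<eta>
  proof -
    obtain N p where Np: "smooth_norm N p" "\<And>x. x \<in> K \<Longrightarrow> N x \<le> 1 + 2 * \<eta>" "{x. N x \<le> 1} \<subseteq> (\<lambda>x. (1 + \<eta>) *\<^sub>R x) ` K"
      using smooth_approximation[OF K \<eta>] by blast
    interpret smooth_norm N p by fact
    define L where "L = {x. N x \<le> 1}"
    have scaled: "compact ((\<lambda>x. c *\<^sub>R x) ` A)" "measure lebesgue ((\<lambda>x. c *\<^sub>R x) ` A) = c ^ n * measure lebesgue A"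
      if "compact A" "c > 0" for A :: "(real ^ 'n::_) set" and c
      using compact_scaling[OF that(1)] measure_lebesgue_affine[of c 0 A] that by (simp_all add: n_def)
    have em: "emeasure lborel A = ennreal (measure lebesgue A)" if "compact A" for A :: "(real ^ 'n::_) set"
    proof -
      have "emeasure lborel A \<noteq> top" using emeasure_compact_finite[OF that] by simp
      then have "emeasure lborel A = ennreal (measure lborel A)" by (rule emeasure_eq_ennreal_measure)
      then show ?thesis using that by (simp add: measure_completion compact_imp_closed borel_closed)
    qed
    have 1: "emeasure lborel L \<le> ennreal ((1 + \<eta>) ^ n * measure lebesgue K)"
    proof -
      have "emeasure lborel L \<le> emeasure lborel ((\<lambda>x. (1 + \<eta>) *\<^sub>R x) ` K)"
        using Np(3) scaled(1)[OF cK(1), of "1 + \<eta>"] \<eta> by (intro emeasure_mono) (auto simp: L_def compact_imp_closed borel_closed)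
      also have "\<dots> = ennreal ((1 + \<eta>) ^ n * measure lebesgue K)"
        using scaled[OF cK(1), of "1 + \<eta>"] \<eta> by (simp add: em)
      finally show ?thesis .
    qed
    have 2: "emeasure lborel (polar_body L) \<le> ennreal ((1 + 2 * \<eta>) ^ n * measure lebesgue (polar_body K))"
    proof -
      have "polar_body L \<subseteq> (\<lambda>x. (1 + 2 * \<eta>) *\<^sub>R x) ` polar_body K"
      proof
        fix y assume y: "y \<in> polar_body L"
        have "x \<bullet> (y /\<^sub>R (1 + 2 * \<eta>)) \<le> 1" if x: "x \<in> K" for x
        proof -
          have "N (inverse (1 + 2 * \<eta>) *\<^sub>R x) \<le> 1"
            using mult_left_mono[OF Np(2)[OF x], of "inverse (1 + 2 * \<eta>)"] \<eta> N_scale[of "inverse (1 + 2 * \<eta>)" x] by simp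
          then have "(inverse (1 + 2 * \<eta>) *\<^sub>R x) \<bullet> y \<le> 1" using y by (simp only: polar_body_def L_def mem_Collect_eq)
          then show ?thesis by simp
        qed
        then have "y /\<^sub>R (1 + 2 * \<eta>) \<in> polar_body K" unfolding polar_body_def by blast
        moreover have "y = (1 + 2 * \<eta>) *\<^sub>R (y /\<^sub>R (1 + 2 * \<eta>))" using \<eta> by simp
        ultimately show "y \<in> (\<lambda>x. (1 + 2 * \<eta>) *\<^sub>R x) ` polar_body K" by blast
      qed
      then have "emeasure lborel (polar_body L) \<le> emeasure lborel ((\<lambda>x. (1 + 2 * \<eta>) *\<^sub>R x) ` polar_body K)"
        using scaled(1)[OF cP, of "1 + 2 * \<eta>"] \<eta> by (intro emeasure_mono) (auto simp: compact_imp_closed borel_closed)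
      also have "\<dots> = ennreal ((1 + 2 * \<eta>) ^ n * measure lebesgue (polar_body K))"
        using scaled[OF cP, of "1 + 2 * \<eta>"] \<eta> by (simp add: em)
      finally show ?thesis .
    qed
    have "ennreal (kuperberg_bound n) \<le> emeasure lborel L * emeasure lborel (polar_body L)"
      using smooth_mahler[OF Np(1)] by (simp add: kuperberg_bound_altdef n_def L_def)
    also have "\<dots> \<le> ennreal ((1 + \<eta>) ^ n * measure lebesgue K) * ennreal ((1 + 2 * \<eta>) ^ n * measure lebesgue (polar_body K))"
      by (intro mult_mono 1 2) auto
    also have "\<dots> = ennreal ((1 + \<eta>) ^ n * (1 + 2 * \<eta>) ^ n * mahler_volume K)"
      using \<eta> by (subst ennreal_mult[symmetric]) (auto simp: mahler_volume_def mult_ac)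
    finally show ?thesis
      using \<eta> by (subst (asm) ennreal_le_iff) (auto simp: mahler_volume_def)
  qed
  have "((\<lambda>\<eta>. (1 + \<eta>) ^ n * (1 + 2 * \<eta>) ^ n * mahler_volume K) \<longlongrightarrow> (1 + 0) ^ n * (1 + 2 * 0) ^ n * mahler_volume K) (at_right 0)"
    by (intro tendsto_intros)
  then have "kuperberg_bound n \<le> (1 + 0) ^ n * (1 + 2 * 0) ^ n * mahler_volume K"
    by (rule tendsto_lowerbound) (auto intro: * eventually_at_right_less[THEN eventually_mono])
  then show ?thesis by (simp add: n_def)
qed

text \<open>A well-ordered copy of a finite index type; the change of variables theorem of the library
  is only available for such index types.\<close>

typedef 'a enumerated = "UNIV :: 'a set" by simp

instance enumerated :: (finite) finite
proof
  have "(UNIV :: 'a enumerated set) = range Abs_enumerated"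
    using type_definition.Abs_image[OF type_definition_enumerated] by auto
  then show "finite (UNIV :: 'a enumerated set)" by (metis finite finite_imageI)
qed

definition enum_index :: "'a::finite enumerated \<Rightarrow> nat" where
  "enum_index = (SOME f. inj f)"

lemma inj_enum_index: "inj (enum_index :: 'a::finite enumerated \<Rightarrow> nat)"
  unfolding enum_index_def
  using finite_imp_inj_to_nat_seg[of "UNIV :: 'a enumerated set"] by (metis (mono_tags) finite someI_ex)

instantiation enumerated :: (finite) wellorder
begin

definition less_eq_enumerated :: "'a enumerated \<Rightarrow> 'a enumerated \<Rightarrow> bool" where
  "less_eq_enumerated x y \<longleftrightarrow> enum_index x \<le> enum_index y"

definition less_enumerated :: "'a enumerated \<Rightarrow> 'a enumerated \<Rightarrow> bool" where
  "less_enumerated x y \<longleftrightarrow> enum_index x < enum_index y"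

instance
proof
  fix P :: "'a enumerated \<Rightarrow> bool" and a
  assume *: "\<And>x. (\<And>y. y < x \<Longrightarrow> P y) \<Longrightarrow> P x"
  show "P a"
  proof (induction "enum_index a" arbitrary: a rule: less_induct)
    case less
    show ?case
    proof (rule *)
      fix y assume "y < a"
      then show "P y" using less by (simp add: less_enumerated_def)
    qed
  qed
qed (auto simp: less_eq_enumerated_def less_enumerated_def dest: injD[OF inj_enum_index])

end

lemma bij_Rep_enumerated: "bij (Rep_enumerated :: 'a enumerated \<Rightarrow> 'a)"
  by (metis Rep_enumerated_inject Abs_enumerated_inverse UNIV_I bijI' )

lemma card_enumerated: "CARD('a::finite enumerated) = CARD('a)"
  using bij_Rep_enumerated bij_betw_same_card by blast

section \<open>Invariance under relabelling the coordinates\<close>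

definition reindex :: "real ^ 'n \<Rightarrow> real ^ 'n enumerated" where
  "reindex x = (\<chi> i. x $ Rep_enumerated i)"

lemma linear_reindex: "linear (reindex :: real ^ 'n \<Rightarrow> real ^ 'n enumerated)"
  by (rule linearI) (simp_all add: reindex_def vec_eq_iff)

lemma bij_reindex: "bij (reindex :: real ^ 'n \<Rightarrow> real ^ 'n enumerated)"
proof (rule bij_betw_byWitness[of _ "\<lambda>y. \<chi> i. y $ Abs_enumerated i"])
qed (auto simp: reindex_def vec_eq_iff Rep_enumerated_inverse Abs_enumerated_inverse)

lemma reindex_inner: "reindex x \<bullet> reindex y = x \<bullet> (y :: real ^ 'n)"
  unfolding inner_vec_def reindex_def
  using sum.reindex_bij_betw[OF bij_Rep_enumerated, of "\<lambda>i. x $ i \<bullet> y $ i"] by simp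

lemma prod_Basis_cart:
  fixes g :: "real ^ 'n \<Rightarrow> 'b::comm_monoid_mult"
  shows "(\<Prod>b\<in>Basis. g b) = (\<Prod>i\<in>UNIV. g (axis i (1::real)))"
proof -
  have B: "(Basis :: (real ^ 'n) set) = range (\<lambda>i. axis i 1)" by (auto simp: Basis_vec_def)
  have I: "inj (\<lambda>i. axis i (1::real) :: real ^ 'n)" by (auto simp: inj_on_def axis_eq_axis)
  show ?thesis unfolding B by (subst prod.reindex[OF I]) (simp add: o_def)
qed

lemma distr_reindex: "distr lborel borel (reindex :: real ^ 'n \<Rightarrow> _) = lborel"
proof (rule lborel_eqI[symmetric])
  have meas [measurable]: "(reindex :: real ^ 'n \<Rightarrow> _) \<in> borel_measurable borel"
    by (intro borel_measurable_continuous_onI linear_continuous_on linear_reindex[unfolded linear_conv_bounded_linear])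
  fix l u :: "real ^ 'n enumerated"
  assume le: "\<And>b. b \<in> Basis \<Longrightarrow> l \<bullet> b \<le> u \<bullet> b"
  define l' u' :: "real ^ 'n" where "l' = (\<chi> i. l $ Abs_enumerated i)" and "u' = (\<chi> i. u $ Abs_enumerated i)"
  have le': "l $ i \<le> u $ i" for i
    using le[of "axis i 1"] by (simp add: cart_eq_inner_axis axis_in_Basis_iff)
  have pre: "reindex -` box l u = box l' u'"
  proof -
    have "(\<forall>i. l $ i < reindex x $ i \<and> reindex x $ i < u $ i) \<longleftrightarrow> (\<forall>i. l' $ i < x $ i \<and> x $ i < u' $ i)" for x
      unfolding l'_def u'_def reindex_def
      by (simp, metis Rep_enumerated_inverse Abs_enumerated_inverse UNIV_I)
    then show ?thesis by (auto simp: mem_box_cart)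
  qed
  have "emeasure (distr lborel borel reindex) (box l u) = emeasure lborel (box l' u')"
    by (subst emeasure_distr) (auto simp: pre)
  also have "\<dots> = ennreal (\<Prod>b\<in>Basis. (u' - l') \<bullet> b)"
    using le' by (intro emeasure_lborel_box) (auto simp: Basis_vec_def inner_axis l'_def u'_def)
  also have "(\<Prod>b\<in>Basis. (u' - l') \<bullet> b) = (\<Prod>i\<in>UNIV. (u' - l') $ i)"
    by (simp add: prod_Basis_cart inner_axis)
  also have "\<dots> = (\<Prod>i\<in>UNIV. (u - l) $ i)"
    using prod.reindex_bij_betw[OF bij_Rep_enumerated, of "\<lambda>i. (u' - l') $ i"]
    by (simp add: l'_def u'_def Rep_enumerated_inverse)
  also have "\<dots> = (\<Prod>b\<in>Basis. (u - l) \<bullet> b)"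
    by (simp add: prod_Basis_cart inner_axis)
  finally show "emeasure (distr lborel borel reindex) (box l u) = (\<Prod>b\<in>Basis. (u - l) \<bullet> b)" .
qed simp

lemma norm_reindex: "norm (reindex x) = norm (x :: real ^ 'n)"
  by (simp add: norm_eq_sqrt_inner reindex_inner)

lemma csc_reindex:
  fixes K :: "(real ^ 'n) set"
  assumes K: "centrally_symmetric_convex_body K"
  shows "centrally_symmetric_convex_body (reindex ` K)"
proof -
  have Kp: "compact K" "convex K" "K = uminus ` K"
    using K by (auto simp: centrally_symmetric_convex_body_def)
  have "compact (reindex ` K)"
    using Kp(1) linear_reindex linear_conv_bounded_linear linear_continuous_on
    by (intro compact_continuous_image) blast+
  moreover have "convex (reindex ` K)" using Kp(2) linear_reindex by (rule convex_linear_image[rotated])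
  moreover have "0 \<in> interior (reindex ` K)"
  proof -
    obtain r where r: "r > 0" "ball 0 r \<subseteq> K"
      using csc_zero_interior[OF K] mem_interior by blast
    have "ball 0 r \<subseteq> reindex ` K"
    proof
      fix y :: "real ^ 'n enumerated" assume "y \<in> ball 0 r"
      moreover obtain x where "y = reindex x" using bij_reindex by (metis bij_pointE)
      ultimately show "y \<in> reindex ` K" using r(2) by (auto simp: norm_reindex)
    qed
    then show ?thesis using r(1) mem_interior by blast
  qed
  moreover have "reindex ` K = uminus ` reindex ` K"
  proof -
    have "reindex ` K = reindex ` uminus ` K" using Kp(3) by simp
    then show ?thesis by (simp add: image_image linear_neg[OF linear_reindex])
  qed
  ultimately show ?thesis unfolding centrally_symmetric_convex_body_def by blast
qed

lemma polar_body_reindex: "polar_body (reindex ` K) = reindex ` polar_body (K :: (real ^ 'n) set)"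
proof (intro equalityI subsetI)
  fix y assume y: "y \<in> polar_body (reindex ` K)"
  obtain x where x: "y = reindex x" using bij_reindex by (metis bij_pointE)
  then have "x \<in> polar_body K" using y by (auto simp: polar_body_def reindex_inner)
  then show "y \<in> reindex ` polar_body K" using x by blast
qed (auto simp: polar_body_def reindex_inner)

lemma measure_reindex:
  fixes A :: "(real ^ 'n) set"
  assumes "compact A"
  shows "measure lebesgue (reindex ` A) = measure lebesgue A"
proof -
  have cont: "continuous_on UNIV (reindex :: real ^ 'n \<Rightarrow> _)"
    using linear_reindex linear_conv_bounded_linear linear_continuous_on by blast
  then have [measurable]: "(reindex :: real ^ 'n \<Rightarrow> _) \<in> borel_measurable borel"
    by (rule borel_measurable_continuous_onI)
  have "compact (reindex ` A)"
    using assms cont by (intro compact_continuous_image) (auto intro: continuous_on_subset)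
  then have b: "reindex ` A \<in> sets borel" by (simp add: compact_imp_closed borel_closed)
  have "measure lborel (reindex ` A) = measure (distr lborel borel reindex) (reindex ` A)"
    by (simp only: distr_reindex)
  also have "\<dots> = measure lborel A"
    using b by (subst measure_distr) (auto simp: inj_vimage_image_eq[OF bij_is_inj[OF bij_reindex]])
  finally show ?thesis
    using b assms by (simp add: measure_completion compact_imp_closed borel_closed)
qed

lemma mahler_bound:
  fixes K :: "(real ^ 'n) set"
  assumes K: "centrally_symmetric_convex_body K"
  shows "mahler_volume K \<ge> kuperberg_bound CARD('n)"
proof -
  have "compact K" "compact (polar_body K)"
    using K compact_polar_body csc_zero_interior by (auto simp: centrally_symmetric_convex_body_def)
  then have "mahler_volume (reindex ` K) = mahler_volume K"
    by (simp add: mahler_volume_def polar_body_reindex measure_reindex)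
  then show ?thesis using mahler_ordered[OF csc_reindex[OF K]] by (simp add: card_enumerated)
qed

section \<open>The constants\<close>

lemma half_fact_Suc_Suc: "half_fact (n + 2) = (real n / 2 + 1) * half_fact n"
proof -
  have "real n / 2 + 1 > 0" by simp
  then have "real n / 2 + 1 \<notin> \<int>\<^sub>\<le>\<^sub>0" by (auto elim!: nonpos_Ints_cases)
  then show ?thesis
    using Gamma_plus1[of "real n / 2 + 1"] by (simp add: half_fact_def add_divide_distrib add_ac)
qed

lemma half_fact_pos: "half_fact n > 0"
  unfolding half_fact_def by (intro Gamma_real_pos) simp

lemma half_fact_0: "half_fact 0 = 1"
  by (simp add: half_fact_def)

lemma half_fact_1: "half_fact 1 = sqrt pi / 2"
proof -
  have "(1/2 :: real) \<notin> \<int>\<^sub>\<le>\<^sub>0" by (auto elim!: nonpos_Ints_cases)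
  then show ?thesis using Gamma_plus1[of "1/2 :: real"] by (simp add: half_fact_def Gamma_one_half_real)
qed

text \<open>The factors of Wallis's product for pi/2.\<close>

definition wallis_factor :: "nat \<Rightarrow> real" where
  "wallis_factor j = 4 * (real j)\<^sup>2 / (4 * (real j)\<^sup>2 - 1)"

text \<open>A step of two is natural because Gamma(n/2 + 1) obeys its functional equation only when
  n grows by 2.\<close>

lemma gamma_const_Suc_Suc: "gamma_const (n + 2) = gamma_const n * wallis_factor (n + 1)"
proof -
  define x where "x = real n"
  define h where "h = half_fact n"
  have x: "x \<ge> 0" by (simp add: x_def)
  have h: "h > 0" by (simp add: h_def half_fact_pos)
  have f1: "fact (n + 2) = (x + 2) * (x + 1) * (fact n :: real)"
    by (simp add: x_def algebra_simps)
  have "fact (2 * (n + 2)) = (2 * x + 4) * (2 * x + 3) * (2 * x + 2) * (2 * x + 1) * (fact (2 * n) :: real)"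
    by (simp add: x_def numeral_eq_Suc algebra_simps)
  also have "\<dots> = 4 * ((x + 2) * (x + 1) * ((2 * x + 3) * (2 * x + 1))) * fact (2 * n)"
    by (simp add: algebra_simps)
  finally have f2: "fact (2 * (n + 2)) = 4 * ((x + 2) * (x + 1) * ((2 * x + 3) * (2 * x + 1))) * (fact (2 * n) :: real)" .
  have w: "wallis_factor (n + 1) = 4 * (x + 1)\<^sup>2 / ((2 * x + 3) * (2 * x + 1))"
    by (simp add: wallis_factor_def x_def power2_eq_square algebra_simps)
  have alg: "(a * f) ^ 3 * (4 * p) / (4 * (a * r) * F * (e * h)\<^sup>2) = f ^ 3 * p / (F * h\<^sup>2) * (a ^ 3 / (a * r * e\<^sup>2))"
    for a f p r F e h :: real by (simp add: power_mult_distrib mult_ac)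
  have "gamma_const (n + 2) = ((x + 2) * (x + 1) * fact n) ^ 3 * (4 * 2 ^ n) / (4 * ((x + 2) * (x + 1) * ((2 * x + 3) * (2 * x + 1))) * fact (2 * n) * ((x / 2 + 1) * h)\<^sup>2)"
    unfolding gamma_const_def f1 f2 half_fact_Suc_Suc by (simp add: x_def h_def)
  also have "\<dots> = fact n ^ 3 * 2 ^ n / (fact (2 * n) * h\<^sup>2) * (((x + 2) * (x + 1)) ^ 3 / ((x + 2) * (x + 1) * ((2 * x + 3) * (2 * x + 1)) * (x / 2 + 1)\<^sup>2))"
    by (rule alg)
  also have "((x + 2) * (x + 1)) ^ 3 / ((x + 2) * (x + 1) * ((2 * x + 3) * (2 * x + 1)) * (x / 2 + 1)\<^sup>2) = 4 * (x + 1)\<^sup>2 / ((2 * x + 3) * (2 * x + 1))"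
  proof -
    have e: "x / 2 + 1 = (x + 2) / 2" by (simp add: field_simps)
    have "x + 2 \<noteq> 0" "x + 1 \<noteq> 0" "(2 * x + 3) * (2 * x + 1) \<noteq> 0" using x by auto
    then show ?thesis unfolding e
      by (simp add: power2_eq_square power3_eq_cube)
  qed
  finally show ?thesis unfolding w[symmetric] h_def gamma_const_def[of n, symmetric] .
qed

lemma gamma_const_0: "gamma_const 0 = 1"
  by (simp add: gamma_const_def half_fact_0)

lemma gamma_const_1: "gamma_const 1 = 4 / pi"
  unfolding gamma_const_def half_fact_1 by (simp add: power_divide numeral_eq_Suc)

lemma gamma_const_pos: "gamma_const n > 0"
  unfolding gamma_const_def using half_fact_pos[of n] by (intro divide_pos_pos mult_pos_pos) auto

lemma wallis_factor_ge_1: "j \<ge> 1 \<Longrightarrow> wallis_factor j \<ge> 1"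
proof -
  assume "j \<ge> 1"
  then have "(real j)\<^sup>2 \<ge> 1" by simp
  then show ?thesis by (simp add: wallis_factor_def field_simps)
qed

lemma gamma_const_ge: "n \<ge> 1 \<Longrightarrow> gamma_const n \<ge> 4 / pi"
proof (induction n rule: induct_nat_012)
  case 1 then show ?case using gamma_const_1 by simp
next
  case (ge2 n)
  show ?case
  proof (cases "n = 0")
    case True
    \<comment> \<open>The value at 0 is 1, which is below 4/pi, so the even case starts with the
      explicit value at 2.\<close>
    have "gamma_const (0 + 2) = 4 / 3"
      unfolding gamma_const_Suc_Suc by (simp add: gamma_const_0 wallis_factor_def)
    moreover have "4 / pi \<le> 4 / (3::real)" using pi_gt3 by (intro divide_left_mono) auto
    ultimately show ?thesis using True by (simp add: numeral_2_eq_2)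
  next
    case False
    then have "4 / pi * 1 \<le> gamma_const n * wallis_factor (n + 1)"
      using ge2 by (intro mult_mono wallis_factor_ge_1) (auto intro: order_less_imp_le gamma_const_pos)
    then show ?thesis using gamma_const_Suc_Suc[of n] by simp
  qed
qed simp

text \<open>At odd indices only Wallis factors with even index occur, and the factor at 2i is the
  reciprocal of 1 - (1/4)^2/i^2, a factor of Euler's sine product at 1/4.\<close>

lemma gamma_const_odd: "gamma_const (2 * m + 1) = 4 / pi / (\<Prod>i=1..m. 1 - (1/4)\<^sup>2 / (real i)\<^sup>2)"
proof (induction m)
  case (Suc m)
  have "gamma_const (2 * Suc m + 1) = gamma_const (2 * m + 1) * wallis_factor (2 * Suc m)"
    using gamma_const_Suc_Suc[of "2 * m + 1"] by simp
  moreover have "wallis_factor (2 * Suc m) = 1 / (1 - (1/4)\<^sup>2 / (real (Suc m))\<^sup>2)"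
  proof -
    define y where "y = (real (Suc m))\<^sup>2"
    have y: "y \<ge> 1" unfolding y_def by simp
    have "wallis_factor (2 * Suc m) = 16 * y / (16 * y - 1)"
      by (simp add: wallis_factor_def y_def power2_eq_square algebra_simps)
    also have "\<dots> = 1 / (1 - (1/4)\<^sup>2 / y)" using y by (simp add: field_simps power2_eq_square)
    finally show ?thesis by (simp add: y_def)
  qed
  ultimately show ?case using Suc by simp
qed (use gamma_const_1 in simp)

text \<open>Consecutive values together use every Wallis factor exactly once, so their product is
  governed by the full Wallis product.\<close>

lemma gamma_const_consecutive: "gamma_const n * gamma_const (n + 1) = 4 / pi * (\<Prod>j=1..n. wallis_factor j)"
proof (induction n)
  case (Suc n)
  have "gamma_const (Suc n) * gamma_const (Suc n + 1) = gamma_const n * gamma_const (n + 1) * wallis_factor (n + 1)"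
    using gamma_const_Suc_Suc[of n] by simp
  also have "\<dots> = 4 / pi * (\<Prod>j=1..n. wallis_factor j) * wallis_factor (n + 1)"
    unfolding Suc ..
  finally show ?case by simp
qed (use gamma_const_0 gamma_const_1 in simp)

lemma tendsto_even_odd:
  fixes f :: "nat \<Rightarrow> real"
  assumes "(\<lambda>m. f (2 * m)) \<longlonglongrightarrow> L" "(\<lambda>m. f (2 * m + 1)) \<longlonglongrightarrow> L"
  shows "f \<longlonglongrightarrow> L"
proof (rule LIMSEQ_I)
  fix r :: real assume "r > 0"
  obtain a b where ab: "\<And>m. m \<ge> a \<Longrightarrow> norm (f (2 * m) - L) < r" "\<And>m. m \<ge> b \<Longrightarrow> norm (f (2 * m + 1) - L) < r"
    using LIMSEQ_D[OF assms(1) \<open>r > 0\<close>] LIMSEQ_D[OF assms(2) \<open>r > 0\<close>] by blast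
  have "norm (f n - L) < r" if "n \<ge> 2 * (a + b) + 1" for n
  proof (cases "even n")
    case True
    then obtain m where "n = 2 * m" by (elim evenE)
    then show ?thesis using ab(1)[of m] that by simp
  next
    case False
    then obtain m where "n = 2 * m + 1" by (elim oddE)
    then show ?thesis using ab(2)[of m] that by simp
  qed
  then show "\<exists>no. \<forall>n\<ge>no. norm (f n - L) < r" by blast
qed

text \<open>The odd subsequence is evaluated by the sine product, where sin(pi/4) supplies the
  square root. Consecutive products tend to (4/pi)(pi/2) = 2, and division by the odd limit gives
  the even one.\<close>

lemma gamma_const_limit: "gamma_const \<longlonglongrightarrow> sqrt 2"
proof (rule tendsto_even_odd)
  have "(\<lambda>m. \<Prod>i=1..m. 1 - (1/4)\<^sup>2 / (real i)\<^sup>2) \<longlonglongrightarrow> sin (pi * (1/4)) / (pi * (1/4))"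
    by (rule sin_product_formula_real') simp
  moreover have "sin (pi * (1/4)) / (pi * (1/4)) = sqrt 2 / 2 * (4 / pi)"
    by (simp add: sin_45)
  ultimately have "(\<lambda>m. \<Prod>i=1..m. 1 - (1/4)\<^sup>2 / (real i)\<^sup>2) \<longlonglongrightarrow> sqrt 2 / 2 * (4 / pi)" by (simp only:)
  then have "(\<lambda>m. gamma_const (2 * m + 1)) \<longlonglongrightarrow> 4 / pi / (sqrt 2 / 2 * (4 / pi))"
    unfolding gamma_const_odd by (intro tendsto_divide tendsto_const) auto
  also have "4 / pi / (sqrt 2 / 2 * (4 / pi)) = sqrt 2" by (simp add: real_div_sqrt)
  finally show odd: "(\<lambda>m. gamma_const (2 * m + 1)) \<longlonglongrightarrow> sqrt 2" .
  have "(\<lambda>n. gamma_const n * gamma_const (n + 1)) \<longlonglongrightarrow> 4 / pi * (pi / 2)"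
    unfolding gamma_const_consecutive wallis_factor_def by (intro tendsto_mult tendsto_const wallis)
  then have "(\<lambda>n. gamma_const n * gamma_const (n + 1)) \<longlonglongrightarrow> 2" by simp
  then have "(\<lambda>m. gamma_const (2 * m) * gamma_const (2 * m + 1)) \<longlonglongrightarrow> 2"
    by (rule filterlim_compose) (rule filterlim_subseq, simp add: strict_mono_def)
  then have "(\<lambda>m. gamma_const (2 * m) * gamma_const (2 * m + 1) / gamma_const (2 * m + 1)) \<longlonglongrightarrow> 2 / sqrt 2"
    using odd by (intro tendsto_divide) auto
  moreover have "gamma_const (2 * m) * gamma_const (2 * m + 1) / gamma_const (2 * m + 1) = gamma_const (2 * m)" for m
    using gamma_const_pos[of "2 * m + 1"] by simp
  ultimately show "(\<lambda>m. gamma_const (2 * m)) \<longlonglongrightarrow> sqrt 2" by (simp add: real_div_sqrt)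
qed

section \<open>The cube\<close>

lemma nn_integral_exp_tail:
  "(\<integral>\<^sup>+r. ennreal (exp (- r)) * indicator {a..} r \<partial>lborel) = ennreal (exp (- a))" for a :: real
proof -
  have "((\<lambda>t::real. - exp (- t)) \<longlongrightarrow> 0) at_top"
    using tendsto_minus[OF filterlim_compose[OF exp_at_bot filterlim_uminus_at_bot_at_top]] by simp
  then have "(\<integral>\<^sup>+r. ennreal (exp (- r)) * indicator {a..} r \<partial>lborel) = ennreal (0 - (- exp (- a)))"
    by (intro nn_integral_FTC_atLeast) (auto intro!: derivative_eq_intros)
  then show ?thesis by simp
qed

lemma nn_integral_exp_abs: "(\<integral>\<^sup>+t. ennreal (exp (- \<bar>t\<bar>)) \<partial>lborel) = 2"
proof -
  have half: "(\<integral>\<^sup>+t. ennreal (exp (- t)) * indicator {0..} t \<partial>lborel) = 1"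
    by (simp add: nn_integral_exp_tail)
  have neg: "(\<integral>\<^sup>+t. ennreal (exp t) * indicator {..<0} t \<partial>lborel) = 1"
  proof -
    have "(\<integral>\<^sup>+t. ennreal (exp t) * indicator {..<0} t \<partial>lborel)
      = (\<integral>\<^sup>+t. ennreal (exp t) * indicator {..<0} t \<partial>distr lborel borel uminus)"
      by (simp only: lborel_distr_uminus)
    also have "\<dots> = (\<integral>\<^sup>+t. ennreal (exp (- t)) * indicator {..<0} (- t) \<partial>lborel)"
      by (subst nn_integral_distr) auto
    also have "\<dots> = (\<integral>\<^sup>+t. ennreal (exp (- t)) * indicator {0..} t \<partial>lborel)"
    proof (rule nn_integral_cong_AE)
      have "AE t in lborel. t \<noteq> (0::real)" by (rule AE_lborel_singleton)
      then show "AE t in lborel. ennreal (exp (- t)) * indicator {..<0} (- t) = ennreal (exp (- t)) * indicator {0::real..} t"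
        by eventually_elim (auto simp: indicator_def)
    qed
    finally show ?thesis unfolding half .
  qed
  have "(\<integral>\<^sup>+t. ennreal (exp (- \<bar>t\<bar>)) \<partial>lborel)
    = (\<integral>\<^sup>+t. ennreal (exp (- t)) * indicator {0..} t + ennreal (exp t) * indicator {..<0} t \<partial>lborel)"
    by (intro nn_integral_cong) (auto simp: indicator_def)
  also have "\<dots> = 1 + 1" by (subst nn_integral_add) (auto simp: half neg)
  finally show ?thesis by simp
qed

lemma nn_integral_power_exp:
  assumes "n \<ge> 1"
  shows "(\<integral>\<^sup>+r. ennreal (r ^ n * exp (- r)) * indicator {0..} r \<partial>lborel) = ennreal (fact n)"
proof -
  have "((\<lambda>r. r powr (real (Suc n) - 1) / exp r) has_integral Gamma (real (Suc n))) {0..}"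
    by (rule Gamma_integral_real) simp
  then have "((\<lambda>r. r ^ n * exp (- r)) has_integral Gamma (real (Suc n))) {0..}"
    by (rule has_integral_eq[rotated])
      (use assms in \<open>auto simp: powr_realpow' exp_minus divide_inverse\<close>)
  then have "(\<integral>\<^sup>+r. ennreal (r ^ n * exp (- r)) * indicator {0..} r \<partial>lborel) = ennreal (Gamma (real (Suc n)))"
    by (intro nn_integral_has_integral_lebesgue') auto
  also have "Gamma (real (Suc n)) = fact n" using Gamma_fact[of n, where ?'a = real] by (simp add: add_ac)
  finally show ?thesis by simp
qed

definition cross_polytope :: "(real ^ 'n) set" where
  "cross_polytope = {y. (\<Sum>i\<in>UNIV. \<bar>y $ i\<bar>) \<le> 1}"

text \<open>Integrate exp (- |y|_1) over the whole space once as a product and once by layers.\<close>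
lemma emeasure_cross_polytope:
  "emeasure lborel (cross_polytope :: (real ^ 'n) set) = ennreal (2 ^ CARD('n) / fact CARD('n))"
proof -
  define g where "g y = (\<Sum>i\<in>UNIV. \<bar>y $ i\<bar>)" for y :: "real ^ 'n"
  define V where "V = emeasure lborel (cross_polytope :: (real ^ 'n) set)"
  define n where "n = CARD('n)"
  have n1: "n \<ge> 1" by (simp add: n_def Suc_le_eq)
  have cont: "continuous_on UNIV g" unfolding g_def by (intro continuous_intros)
  have [measurable]: "g \<in> borel_measurable borel" using cont by (rule borel_measurable_continuous_onI)
  have g0: "g y \<ge> 0" for y unfolding g_def by (intro sum_nonneg) auto
  have gs: "g (r *\<^sub>R y) = r * g y" if "r > 0" for r y
    using that by (simp add: g_def abs_mult sum_distrib_left)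
  have "(\<integral>\<^sup>+y. ennreal (exp (- g y)) \<partial>lborel) = (\<integral>\<^sup>+y. (\<Prod>b\<in>Basis. ennreal (exp (- \<bar>y \<bullet> b\<bar>))) \<partial>(lborel :: (real ^ 'n) measure))"
  proof (intro nn_integral_cong)
    fix y :: "real ^ 'n"
    have "(\<Prod>b\<in>Basis. ennreal (exp (- \<bar>y \<bullet> b\<bar>))) = (\<Prod>i\<in>UNIV. ennreal (exp (- \<bar>y $ i\<bar>)))"
      by (simp add: prod_Basis_cart inner_axis)
    also have "\<dots> = ennreal (exp (- g y))"
      by (simp add: prod_ennreal g_def exp_sum[symmetric] sum_negf)
    finally show "ennreal (exp (- g y)) = (\<Prod>b\<in>Basis. ennreal (exp (- \<bar>y \<bullet> b\<bar>)))" ..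
  qed
  also have "\<dots> = (\<Prod>b\<in>(Basis :: (real ^ 'n) set). \<integral>\<^sup>+t. ennreal (exp (- \<bar>t\<bar>)) \<partial>lborel)"
    by (intro nn_integral_lborel_prod) auto
  also have "\<dots> = 2 ^ n" by (simp add: nn_integral_exp_abs n_def)
  finally have 1: "(\<integral>\<^sup>+y. ennreal (exp (- g y)) \<partial>lborel) = 2 ^ n" .
  have meas: "(\<lambda>(y, r). ennreal (exp (- r)) * indicator {z. g (fst z) \<le> snd z} (y, r)) \<in> borel_measurable (lborel \<Otimes>\<^sub>M lborel)"
    by measurable
  have "(\<integral>\<^sup>+y. ennreal (exp (- g y)) \<partial>lborel) = (\<integral>\<^sup>+y. \<integral>\<^sup>+r. ennreal (exp (- r)) * indicator {z. g (fst z) \<le> snd z} (y, r) \<partial>lborel \<partial>lborel)"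
    by (subst nn_integral_exp_tail[symmetric]) (auto intro!: nn_integral_cong simp: indicator_def)
  also have "\<dots> = (\<integral>\<^sup>+r. \<integral>\<^sup>+y. ennreal (exp (- r)) * indicator {z. g (fst z) \<le> snd z} (y, r) \<partial>lborel \<partial>lborel)"
    by (rule lborel_pair.Fubini'[OF meas, symmetric])
  also have "\<dots> = (\<integral>\<^sup>+r. V * (ennreal (r ^ n * exp (- r)) * indicator {0..} r) \<partial>lborel)"
  proof (rule nn_integral_cong_AE)
    have "AE r in lborel. r \<noteq> (0::real)" by (rule AE_lborel_singleton)
    then show "AE r in lborel. (\<integral>\<^sup>+y. ennreal (exp (- r)) * indicator {z. g (fst z) \<le> snd z} (y, r) \<partial>lborel) = V * (ennreal (r ^ n * exp (- r)) * indicator {0..} r)"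
    proof eventually_elim
      fix r :: real assume "r \<noteq> 0"
      show "(\<integral>\<^sup>+y. ennreal (exp (- r)) * indicator {z. g (fst z) \<le> snd z} (y, r) \<partial>lborel) = V * (ennreal (r ^ n * exp (- r)) * indicator {0..} r)"
      proof (cases "r > 0")
        case True
        have "(\<integral>\<^sup>+y. ennreal (exp (- r)) * indicator {z. g (fst z) \<le> snd z} (y, r) \<partial>lborel) = (\<integral>\<^sup>+y. ennreal (exp (- r)) * indicator {y. g y \<le> r} y \<partial>lborel)"
          by (intro nn_integral_cong) (auto simp: indicator_def)
        also have "\<dots> = ennreal (exp (- r)) * (\<integral>\<^sup>+y. indicator {y. g y \<le> r} y \<partial>lborel)"
          by (intro nn_integral_cmult) measurable
        also have "(\<integral>\<^sup>+y. indicator {y. g y \<le> r} y \<partial>lborel) = ennreal (r ^ n) * (\<integral>\<^sup>+y. indicator {y. g y \<le> r} (r *\<^sub>R y) \<partial>lborel)"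
          using True by (subst nn_integral_lborel_scale[of _ r]) (auto simp: n_def)
        also have "(\<integral>\<^sup>+y. indicator {y. g y \<le> r} (r *\<^sub>R y) \<partial>lborel) = (\<integral>\<^sup>+y. indicator cross_polytope y \<partial>(lborel :: (real ^ 'n) measure))"
          using True by (intro nn_integral_cong) (auto simp: indicator_def gs cross_polytope_def g_def[symmetric])
        also have "\<dots> = V"
        proof -
          have "closed (cross_polytope :: (real ^ 'n) set)"
            unfolding cross_polytope_def by (intro closed_Collect_le continuous_intros)
          then show ?thesis by (simp add: V_def borel_closed)
        qed
        finally show ?thesis using True by (simp add: ennreal_mult' mult_ac)
      next
        case False
        then have "r < 0" using \<open>r \<noteq> 0\<close> by simp
        then have "\<not> g y \<le> r" for y using g0[of y] by simp
        then show ?thesis using \<open>r < 0\<close> by (simp add: indicator_def)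
      qed
    qed
  qed
  also have "\<dots> = V * ennreal (fact n)"
    by (subst nn_integral_cmult) (auto simp: nn_integral_power_exp[OF n1])
  finally have 2: "V * ennreal (fact n) = ennreal (2 ^ n)" using 1 by (simp add: ennreal_power[symmetric])
  have "V = V * ennreal (fact n) / ennreal (fact n)"
    by (subst ennreal_mult_divide_eq) auto
  also have "\<dots> = ennreal (2 ^ n / fact n)" unfolding 2 by (simp add: divide_ennreal)
  finally show ?thesis by (simp add: V_def n_def)
qed

lemma polar_body_cube: "polar_body cube = (cross_polytope :: (real ^ 'n) set)"
proof (intro equalityI subsetI)
  fix y :: "real ^ 'n" assume y: "y \<in> polar_body cube"
  \<comment> \<open>The sign vector is the point of the cube at which the functional y attains its
    maximum, the 1-norm of y.\<close>
  have "(\<chi> i. sgn (y $ i)) \<in> (cube :: (real ^ 'n) set)" by (auto simp: cube_def sgn_real_def)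
  then have "(\<chi> i. sgn (y $ i)) \<bullet> y \<le> 1" using y by (auto simp: polar_body_def)
  moreover have "(\<chi> i. sgn (y $ i)) \<bullet> y = (\<Sum>i\<in>UNIV. \<bar>y $ i\<bar>)"
    by (simp add: inner_vec_def sgn_mult_self_eq abs_sgn mult.commute)
  ultimately show "y \<in> cross_polytope" by (simp add: cross_polytope_def)
next
  fix y :: "real ^ 'n" assume y: "y \<in> cross_polytope"
  have "x \<bullet> y \<le> 1" if "x \<in> cube" for x
  proof -
    have "x \<bullet> y = (\<Sum>i\<in>UNIV. x $ i * y $ i)" by (simp add: inner_vec_def)
    also have "\<dots> \<le> (\<Sum>i\<in>UNIV. \<bar>y $ i\<bar>)"
    proof (rule sum_mono)
      fix i
      have "\<bar>x $ i\<bar> \<le> 1" using that by (simp add: cube_def abs_le_iff minus_le_iff)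
      then have "\<bar>x $ i\<bar> * \<bar>y $ i\<bar> \<le> 1 * \<bar>y $ i\<bar>" by (intro mult_right_mono) auto
      then show "x $ i * y $ i \<le> \<bar>y $ i\<bar>" using abs_ge_self[of "x $ i * y $ i"] by (simp add: abs_mult)
    qed
    also have "\<dots> \<le> 1" using y by (simp add: cross_polytope_def)
    finally show ?thesis .
  qed
  then show "y \<in> polar_body cube" by (simp add: polar_body_def)
qed

lemma mahler_volume_cube: "mahler_volume (cube :: (real ^ 'n) set) = 4 ^ CARD('n) / fact CARD('n)"
proof -
  have box: "(cube :: (real ^ 'n) set) = cbox (\<chi> i. - 1) (\<chi> i. 1)"
    by (auto simp: cube_def mem_box_cart)
  have "cbox (\<chi> i. - 1) (\<chi> i. 1) \<noteq> ({} :: (real ^ 'n) set)"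
    by (simp add: interval_ne_empty_cart)
  then have c: "measure lebesgue (cube :: (real ^ 'n) set) = 2 ^ CARD('n)"
    unfolding box by (simp add: content_cbox_cart)
  have "closed (cross_polytope :: (real ^ 'n) set)"
    unfolding cross_polytope_def by (intro closed_Collect_le continuous_intros)
  then have "measure lebesgue (cross_polytope :: (real ^ 'n) set) = 2 ^ CARD('n) / fact CARD('n)"
    using emeasure_cross_polytope[where 'n = 'n] by (simp add: measure_def)
  then show ?thesis
    by (simp add: mahler_volume_def c polar_body_cube flip: power_mult_distrib)
qed

theorem corollary1p6:
  fixes n :: nat
  assumes n_def: "n = CARD('n::finite)"
  shows "(\<forall>K :: (real ^ 'n) set. centrally_symmetric_convex_body K \<longrightarrow>
            mahler_volume K \<ge>
              2 ^ n * (fact n)\<^sup>2 * pi ^ n / (fact (2 * n) * (half_fact n)\<^sup>2))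
       \<and> 2 ^ n * (fact n)\<^sup>2 * pi ^ n / (fact (2 * n) * (half_fact n)\<^sup>2)
            = gamma_const n * (pi / 4) ^ n * mahler_volume (cube :: (real ^ 'n) set)
       \<and> (\<forall>m\<ge>1. gamma_const m \<ge> 4 / pi)
       \<and> gamma_const \<longlonglongrightarrow> sqrt 2"
proof (intro conjI allI impI)
  fix K :: "(real ^ 'n) set" assume "centrally_symmetric_convex_body K"
  then show "mahler_volume K \<ge> 2 ^ n * (fact n)\<^sup>2 * pi ^ n / (fact (2 * n) * (half_fact n)\<^sup>2)"
    using mahler_bound by (simp add: n_def kuperberg_bound_def)
next
  have "(fact n :: real) ^ 3 = (fact n)\<^sup>2 * fact n" by (simp add: power2_eq_square power3_eq_cube)
  then show "2 ^ n * (fact n)\<^sup>2 * pi ^ n / (fact (2 * n) * (half_fact n)\<^sup>2)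
    = gamma_const n * (pi / 4) ^ n * mahler_volume (cube :: (real ^ 'n) set)"
    by (simp add: mahler_volume_cube gamma_const_def n_def power_divide)
next
  show "gamma_const m \<ge> 4 / pi" if "m \<ge> 1" for m using that by (rule gamma_const_ge)
  show "gamma_const \<longlonglongrightarrow> sqrt 2" by (rule gamma_const_limit)
qed

end
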